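(* Let $n\in\mathbb{N}$, $s\in(0,\infty)$ and let $\varrho$ be a function on $E=[0,\infty)^n$ such that (a) $\varrho$ is $m_{n,s}$-a.e. positive and $\varrho\in L^1(E;m_{n,s})$; (b) for every $\varnothing\neq B\subset I$ one has $\varrho=0$ $\lambda_B^{n,s}$-a.e. on $\overline{E_+(B)}\setminus R_\varrho\big(\overline{E_+(B)}\big)$. Then $$\mathcal{E}(f,g)=\sum_{\varnothing\neq B\subset I}\mathcal{E}_B(f,g),\quad f,g\in\mathcal{D}=C_c^2(E),\qquad \mathcal{E}_B(f,g)=\sum_{i\in B}\int_{E_+(B)}\partial_i f\,\partial_i g\,d\mu_B^{\varrho,n,s},$$ is a densely defined, positive definite (i.e. $\mathcal{E}(f,f)\ge 0$), symmetric bilinear form, which is closable on $L^2(E;\mu_{n,s,\varrho})$. Its closure $(\mathcal{E},D(\mathcal{E}))$ is a conservative, strongly local, regular, symmetric Dirichlet form on $L^2(E;\mu_{n,s,\varrho})$.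
   Context: $I=\{1,\dots,n\}$, $E=[0,\infty)^n$, $\mathring E=(0,\infty)^n$; $\subset$ allows equality. For $B\subset I$, $E_+(B)=\{x\in E:\{i\in I:x_i>0\}=B\}$, and $\overline{E_+(B)}$ is its closure in the Euclidean norm $|\cdot|_{\rm euc}$. On the Borel $\sigma$-algebra $\mathcal{B}_E$ of $E$ put $\lambda_B^{(n)}=\prod_{i\in B}dx_+^i\prod_{j\in I\setminus B}d\delta_0^j$ (Lebesgue measure on $[0,\infty)$ in the coordinates $i\in B$, Dirac measure at $0$ in the coordinates $j\in I\setminus B$), $\lambda_B^{n,s}=s^{n-\#B}\lambda_B^{(n)}$, $m_{n,s}=\sum_{B\subset I}\lambda_B^{n,s}$, $\mu_{n,s,\varrho}=\varrho\,m_{n,s}$ and $\mu_B^{\varrho,n,s}=\varrho\,\lambda_B^{n,s}$. For $\varnothing\ne B\subset I$, $R_\varrho(\overline{E_+(B)})=\{x\in\overline{E_+(B)}:\int_{B_\varepsilon(x)}\varrho^{-1}\,d\lambda_B^{n,s}<\infty\text{ for some }\varepsilon>0\}$ with $B_\varepsilon(x)=\{y\in\overline{E_+(B)}:|x-y|_{\rm euc}\le\varepsilon\}$. For $k\in\mathbb{N}$, $C_c^k(E)$ is the set of $f:E\to\mathbb{R}$ that are $k$-times continuously differentiable on $\mathring E$, have compact support in $E$, and for which $\partial^l f$ extends continuously to $E$ for all $|l|\le k$; on $\partial E$, $\partial^l f$ denotes this extension. *)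

theory Defs
  imports "HOL-Probability.Giry_Monad"
begin

section \<open>Symmetric forms on $L^2$\<close>

text \<open>
  Elements of $L^2(M)$ are represented by square integrable functions rather than by classes;
  everything below is insensitive to the choice of representatives, and to the values of the
  representatives outside \<^term>\<open>space M\<close>.
\<close>

definition L2 :: "'a measure \<Rightarrow> ('a \<Rightarrow> real) set" where
  "L2 M = {f \<in> borel_measurable M. integrable M (\<lambda>x. (f x)\<^sup>2)}"

definition L2_inner :: "'a measure \<Rightarrow> ('a \<Rightarrow> real) \<Rightarrow> ('a \<Rightarrow> real) \<Rightarrow> real" where
  "L2_inner M f g = (\<integral>x. f x * g x \<partial>M)"

definition L2_norm :: "'a measure \<Rightarrow> ('a \<Rightarrow> real) \<Rightarrow> real" where
  "L2_norm M f = sqrt (L2_inner M f f)"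

text \<open>The last conjunct says that the form is well defined on almost everywhere classes.\<close>

definition symmetric_bilinear_form ::
  "'a measure \<Rightarrow> ('a \<Rightarrow> real) set \<Rightarrow> (('a \<Rightarrow> real) \<Rightarrow> ('a \<Rightarrow> real) \<Rightarrow> real) \<Rightarrow> bool" where
  "symmetric_bilinear_form M D Q \<longleftrightarrow>
     D \<subseteq> L2 M \<and>
     (\<lambda>x. 0) \<in> D \<and>
     (\<forall>f\<in>D. \<forall>g\<in>D. (\<lambda>x. f x + g x) \<in> D) \<and>
     (\<forall>c. \<forall>f\<in>D. (\<lambda>x. c * f x) \<in> D) \<and>
     (\<forall>f\<in>D. \<forall>g\<in>D. Q f g = Q g f) \<and>
     (\<forall>f\<in>D. \<forall>g\<in>D. \<forall>h\<in>D. Q (\<lambda>x. f x + g x) h = Q f h + Q g h) \<and>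
     (\<forall>c. \<forall>f\<in>D. \<forall>g\<in>D. Q (\<lambda>x. c * f x) g = c * Q f g) \<and>
     (\<forall>f\<in>D. \<forall>f'\<in>D. \<forall>g\<in>D. (AE x in M. f x = f' x) \<longrightarrow> Q f g = Q f' g)"

definition positive_definite ::
  "('a \<Rightarrow> real) set \<Rightarrow> (('a \<Rightarrow> real) \<Rightarrow> ('a \<Rightarrow> real) \<Rightarrow> real) \<Rightarrow> bool" where
  "positive_definite D Q \<longleftrightarrow> (\<forall>f\<in>D. 0 \<le> Q f f)"

definition densely_defined :: "'a measure \<Rightarrow> ('a \<Rightarrow> real) set \<Rightarrow> bool" where
  "densely_defined M D \<longleftrightarrow>
     (\<forall>f\<in>L2 M. \<forall>\<epsilon>>0. \<exists>g\<in>D. L2_norm M (\<lambda>x. f x - g x) < \<epsilon>)"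

definition form_Cauchy ::
  "(('a \<Rightarrow> real) \<Rightarrow> ('a \<Rightarrow> real) \<Rightarrow> real) \<Rightarrow> (nat \<Rightarrow> 'a \<Rightarrow> real) \<Rightarrow> bool" where
  "form_Cauchy Q u \<longleftrightarrow>
     (\<forall>\<epsilon>>0. \<exists>N. \<forall>j\<ge>N. \<forall>k\<ge>N. Q (\<lambda>x. u j x - u k x) (\<lambda>x. u j x - u k x) < \<epsilon>)"

definition L2_tendsto :: "'a measure \<Rightarrow> (nat \<Rightarrow> 'a \<Rightarrow> real) \<Rightarrow> ('a \<Rightarrow> real) \<Rightarrow> bool" where
  "L2_tendsto M u f \<longleftrightarrow> (\<lambda>k. L2_norm M (\<lambda>x. u k x - f x)) \<longlonglongrightarrow> 0"

definition closable ::
  "'a measure \<Rightarrow> ('a \<Rightarrow> real) set \<Rightarrow> (('a \<Rightarrow> real) \<Rightarrow> ('a \<Rightarrow> real) \<Rightarrow> real) \<Rightarrow> bool" where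
  "closable M D Q \<longleftrightarrow>
     (\<forall>u. (\<forall>k. u k \<in> D) \<and> form_Cauchy Q u \<and> L2_tendsto M u (\<lambda>x. 0)
        \<longrightarrow> (\<lambda>k. Q (u k) (u k)) \<longlonglongrightarrow> 0)"

text \<open>$Q_1(f,g) = Q(f,g) + (f,g)_{L^2}$\<close>

definition form1 ::
  "'a measure \<Rightarrow> (('a \<Rightarrow> real) \<Rightarrow> ('a \<Rightarrow> real) \<Rightarrow> real)
     \<Rightarrow> ('a \<Rightarrow> real) \<Rightarrow> ('a \<Rightarrow> real) \<Rightarrow> real" where
  "form1 M Q f g = Q f g + L2_inner M f g"

definition closed_form ::
  "'a measure \<Rightarrow> ('a \<Rightarrow> real) set \<Rightarrow> (('a \<Rightarrow> real) \<Rightarrow> ('a \<Rightarrow> real) \<Rightarrow> real) \<Rightarrow> bool" where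
  "closed_form M D Q \<longleftrightarrow>
     (\<forall>u. (\<forall>k. u k \<in> D) \<and> form_Cauchy (form1 M Q) u \<longrightarrow>
        (\<exists>f\<in>D. (\<lambda>k. form1 M Q (\<lambda>x. u k x - f x) (\<lambda>x. u k x - f x)) \<longlonglongrightarrow> 0))"

definition approximating ::
  "'a measure \<Rightarrow> ('a \<Rightarrow> real) set \<Rightarrow> (('a \<Rightarrow> real) \<Rightarrow> ('a \<Rightarrow> real) \<Rightarrow> real)
     \<Rightarrow> (nat \<Rightarrow> 'a \<Rightarrow> real) \<Rightarrow> ('a \<Rightarrow> real) \<Rightarrow> bool" where
  "approximating M D Q u f \<longleftrightarrow> (\<forall>k. u k \<in> D) \<and> form_Cauchy Q u \<and> L2_tendsto M u f"

text \<open>The closure of a closable form; the value of the form is the common limit of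
  $Q(u_k,v_k)$ along all approximating sequences.\<close>

definition closure_dom ::
  "'a measure \<Rightarrow> ('a \<Rightarrow> real) set \<Rightarrow> (('a \<Rightarrow> real) \<Rightarrow> ('a \<Rightarrow> real) \<Rightarrow> real)
     \<Rightarrow> ('a \<Rightarrow> real) set" where
  "closure_dom M D Q = {f \<in> L2 M. \<exists>u. approximating M D Q u f}"

definition closure_form ::
  "'a measure \<Rightarrow> ('a \<Rightarrow> real) set \<Rightarrow> (('a \<Rightarrow> real) \<Rightarrow> ('a \<Rightarrow> real) \<Rightarrow> real)
     \<Rightarrow> ('a \<Rightarrow> real) \<Rightarrow> ('a \<Rightarrow> real) \<Rightarrow> real" where
  "closure_form M D Q f g =
     (THE c. \<forall>u v. approximating M D Q u f \<and> approximating M D Q v g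
               \<longrightarrow> (\<lambda>k. Q (u k) (v k)) \<longlonglongrightarrow> c)"

text \<open>The Markov property is required in the form that the unit contraction
  $f \mapsto (0 \vee f) \wedge 1$ operates on the form.\<close>

definition symmetric_Dirichlet_form ::
  "'a measure \<Rightarrow> ('a \<Rightarrow> real) set \<Rightarrow> (('a \<Rightarrow> real) \<Rightarrow> ('a \<Rightarrow> real) \<Rightarrow> real) \<Rightarrow> bool" where
  "symmetric_Dirichlet_form M D Q \<longleftrightarrow>
     symmetric_bilinear_form M D Q \<and> positive_definite D Q \<and> densely_defined M D \<and>
     closed_form M D Q \<and>
     (\<forall>f\<in>D. (\<lambda>x. min (max 0 (f x)) 1) \<in> D \<and>
        Q (\<lambda>x. min (max 0 (f x)) 1) (\<lambda>x. min (max 0 (f x)) 1) \<le> Q f f)"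

subsection \<open>Regularity and strong locality\<close>

definition Cc :: "'a::topological_space set \<Rightarrow> ('a \<Rightarrow> real) set" where
  "Cc X = {f. continuous_on X f \<and> compact (X \<inter> closure {x \<in> X. f x \<noteq> 0})}"

definition regular_form ::
  "'a::topological_space measure \<Rightarrow> ('a \<Rightarrow> real) set
     \<Rightarrow> (('a \<Rightarrow> real) \<Rightarrow> ('a \<Rightarrow> real) \<Rightarrow> real) \<Rightarrow> bool" where
  "regular_form M D Q \<longleftrightarrow>
     (\<forall>f\<in>D. \<forall>\<epsilon>>0. \<exists>g\<in>D \<inter> Cc (space M).
        sqrt (form1 M Q (\<lambda>x. f x - g x) (\<lambda>x. f x - g x)) < \<epsilon>) \<and>
     (\<forall>f\<in>Cc (space M). \<forall>\<epsilon>>0. \<exists>g\<in>D \<inter> Cc (space M). \<forall>x\<in>space M. \<bar>f x - g x\<bar> < \<epsilon>)"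

text \<open>The support of the measure $|f| \cdot M$, as a subset of the topological
  space \<^term>\<open>space M\<close>.\<close>

definition ae_support :: "'a::topological_space measure \<Rightarrow> ('a \<Rightarrow> real) \<Rightarrow> 'a set" where
  "ae_support M f =
     {x \<in> space M. \<forall>U. open U \<and> x \<in> U \<longrightarrow> \<not> (AE y in M. y \<in> U \<longrightarrow> f y = 0)}"

definition strongly_local ::
  "'a::topological_space measure \<Rightarrow> ('a \<Rightarrow> real) set
     \<Rightarrow> (('a \<Rightarrow> real) \<Rightarrow> ('a \<Rightarrow> real) \<Rightarrow> real) \<Rightarrow> bool" where
  "strongly_local M D Q \<longleftrightarrow>
     (\<forall>f\<in>D. \<forall>g\<in>D.
        compact (ae_support M f) \<and> compact (ae_support M g) \<and>
        (\<exists>U c. open U \<and> ae_support M f \<subseteq> U \<and> (AE x in M. x \<in> U \<longrightarrow> g x = c))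
        \<longrightarrow> Q f g = 0)"

subsection \<open>The associated semigroup and conservativity\<close>

definition contraction_semigroup ::
  "'a measure \<Rightarrow> (real \<Rightarrow> ('a \<Rightarrow> real) \<Rightarrow> 'a \<Rightarrow> real) \<Rightarrow> bool" where
  "contraction_semigroup M T \<longleftrightarrow>
     (\<forall>t>0. \<forall>f\<in>L2 M. T t f \<in> L2 M \<and> L2_norm M (T t f) \<le> L2_norm M f) \<and>
     (\<forall>t>0. \<forall>f\<in>L2 M. \<forall>g\<in>L2 M. \<forall>a b.
        AE x in M. T t (\<lambda>y. a * f y + b * g y) x = a * T t f x + b * T t g x) \<and>
     (\<forall>r>0. \<forall>t>0. \<forall>f\<in>L2 M. AE x in M. T (r + t) f x = T r (T t f) x) \<and>
     (\<forall>f\<in>L2 M. ((\<lambda>t. L2_norm M (\<lambda>x. T t f x - f x)) \<longlongrightarrow> 0) (at_right 0))"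

text \<open>\<open>semigroup_generator M T f h\<close>: $f$ is in the domain of the generator of
  $(T_t)_{t>0}$, and the generator maps $f$ to $h$.\<close>

definition semigroup_generator ::
  "'a measure \<Rightarrow> (real \<Rightarrow> ('a \<Rightarrow> real) \<Rightarrow> 'a \<Rightarrow> real)
     \<Rightarrow> ('a \<Rightarrow> real) \<Rightarrow> ('a \<Rightarrow> real) \<Rightarrow> bool" where
  "semigroup_generator M T f h \<longleftrightarrow> f \<in> L2 M \<and> h \<in> L2 M \<and>
     ((\<lambda>t. L2_norm M (\<lambda>x. (T t f x - f x) / t - h x)) \<longlongrightarrow> 0) (at_right 0)"

text \<open>\<open>form_generator M D Q f h\<close>: the same for the generator $L$ of the closed form $Q$, that
  is, $Q(f,g) = (-Lf,g)_{L^2}$ for all $g$ in the domain of $Q$.\<close>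

definition form_generator ::
  "'a measure \<Rightarrow> ('a \<Rightarrow> real) set \<Rightarrow> (('a \<Rightarrow> real) \<Rightarrow> ('a \<Rightarrow> real) \<Rightarrow> real)
     \<Rightarrow> ('a \<Rightarrow> real) \<Rightarrow> ('a \<Rightarrow> real) \<Rightarrow> bool" where
  "form_generator M D Q f h \<longleftrightarrow> f \<in> D \<and> h \<in> L2 M \<and> (\<forall>g\<in>D. Q f g = L2_inner M (\<lambda>x. - h x) g)"

definition associated_semigroup ::
  "'a measure \<Rightarrow> ('a \<Rightarrow> real) set \<Rightarrow> (('a \<Rightarrow> real) \<Rightarrow> ('a \<Rightarrow> real) \<Rightarrow> real)
     \<Rightarrow> (real \<Rightarrow> ('a \<Rightarrow> real) \<Rightarrow> 'a \<Rightarrow> real) \<Rightarrow> bool" where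
  "associated_semigroup M D Q T \<longleftrightarrow>
     contraction_semigroup M T \<and>
     (\<forall>f h. semigroup_generator M T f h \<longleftrightarrow> form_generator M D Q f h)"

text \<open>$T_t 1 = 1$ for all $t > 0$, for the semigroup associated with the form (which is unique up
  to null sets). This is the right notion for finite $M$ only: otherwise $1 \notin L^2(M)$ and
  $T_t$ would first have to be extended to $L^\infty(M)$.\<close>

definition conservative ::
  "'a measure \<Rightarrow> ('a \<Rightarrow> real) set \<Rightarrow> (('a \<Rightarrow> real) \<Rightarrow> ('a \<Rightarrow> real) \<Rightarrow> real) \<Rightarrow> bool" where
  "conservative M D Q \<longleftrightarrow>
     (\<exists>T. associated_semigroup M D Q T \<and> (\<forall>t>0. AE x in M. T t (\<lambda>y. 1) x = 1))"

section \<open>The orthant, its faces, and the measures on them\<close>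

text \<open>The index set $I = \{1,\dots,n\}$ is the finite type \<open>'n\<close>, so $n$ is \<open>CARD('n)\<close>.\<close>

definition orthant :: "(real^'n) set" where
  "orthant = {x. \<forall>i. 0 \<le> x $ i}"

definition open_orthant :: "(real^'n) set" where
  "open_orthant = {x. \<forall>i. 0 < x $ i}"

definition Eplus :: "'n set \<Rightarrow> (real^'n) set" where
  "Eplus B = {x \<in> orthant. {i. 0 < x $ i} = B}"

definition lam :: "'n set \<Rightarrow> (real^'n) measure" where
  "lam B = distr
     (Pi\<^sub>M UNIV (\<lambda>i. if i \<in> B then restrict_space lborel {0..}
                   else return (restrict_space borel {0..}) 0))
     (restrict_space borel orthant) (\<lambda>\<omega>. \<chi> i. \<omega> i)"

definition lam_s :: "real \<Rightarrow> 'n set \<Rightarrow> (real^'n) measure" where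
  "lam_s s B = scale_measure (ennreal (s ^ (CARD('n) - card B))) (lam B)"

definition m_s :: "real \<Rightarrow> (real^'n) measure" where
  "m_s s = measure_of orthant (sets (restrict_space borel orthant))
     (\<lambda>A. \<Sum>B\<in>UNIV. emeasure (lam_s s B) A)"

definition mu :: "real \<Rightarrow> (real^'n \<Rightarrow> real) \<Rightarrow> (real^'n) measure" where
  "mu s \<rho> = density (m_s s) (\<lambda>x. ennreal (\<rho> x))"

definition mu_face :: "real \<Rightarrow> (real^'n \<Rightarrow> real) \<Rightarrow> 'n set \<Rightarrow> (real^'n) measure" where
  "mu_face s \<rho> B = density (lam_s s B) (\<lambda>x. ennreal (\<rho> x))"

text \<open>The integral is taken in $[0,\infty]$, where $0^{-1} = \infty$.\<close>

definition R_set :: "real \<Rightarrow> (real^'n \<Rightarrow> real) \<Rightarrow> 'n set \<Rightarrow> (real^'n) set" where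
  "R_set s \<rho> B =
     {x \<in> closure (Eplus B). \<exists>\<epsilon>>0.
        (\<integral>\<^sup>+y\<in>{y \<in> closure (Eplus B). norm (x - y) \<le> \<epsilon>}.
            inverse (ennreal (\<rho> y)) \<partial>lam_s s B) < \<infinity>}"

section \<open>The spaces $C_c^k(E)$ and the form\<close>

definition partial_deriv :: "'n \<Rightarrow> (real^'n \<Rightarrow> real) \<Rightarrow> real^'n \<Rightarrow> real" where
  "partial_deriv i f x = frechet_derivative f (at x) (axis i 1)"

text \<open>A multi-index $l$ is written as a list of directions in which $f$ is differentiated
  successively; its length is $|l|$. Only used at points of the open orthant.\<close>

fun iter_partial :: "'n list \<Rightarrow> (real^'n \<Rightarrow> real) \<Rightarrow> real^'n \<Rightarrow> real" where
  "iter_partial [] f = f"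
| "iter_partial (i # l) f = partial_deriv i (iter_partial l f)"

definition C_k_on :: "nat \<Rightarrow> (real^'n) set \<Rightarrow> (real^'n \<Rightarrow> real) \<Rightarrow> bool" where
  "C_k_on k U f \<longleftrightarrow>
     (\<forall>l. length l < k \<longrightarrow> (\<forall>x\<in>U. iter_partial l f differentiable (at x))) \<and>
     (\<forall>l. length l \<le> k \<longrightarrow> continuous_on U (iter_partial l f))"

text \<open>Membership depends on the values of $f$ on $E$ only. For $l = 0$ the boundary values of
  the extension are those of $f$ itself, that is, $f$ is continuous on $E$; this is
  contained in \<^term>\<open>f \<in> Cc orthant\<close>.\<close>

definition Cck :: "nat \<Rightarrow> (real^'n \<Rightarrow> real) set" where
  "Cck k = {f \<in> Cc orthant. C_k_on k open_orthant f \<and>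
     (\<forall>l. length l \<le> k \<longrightarrow>
        (\<exists>h. continuous_on orthant h \<and> (\<forall>x\<in>open_orthant. h x = iter_partial l f x)))}"

text \<open>$\partial_i f$ on $E$, on the boundary the continuous extension from the interior.\<close>

definition ext_partial :: "'n \<Rightarrow> (real^'n \<Rightarrow> real) \<Rightarrow> real^'n \<Rightarrow> real" where
  "ext_partial i f x = Lim (at x within open_orthant) (partial_deriv i f)"

definition form_face ::
  "real \<Rightarrow> (real^'n \<Rightarrow> real) \<Rightarrow> 'n set \<Rightarrow> (real^'n \<Rightarrow> real) \<Rightarrow> (real^'n \<Rightarrow> real) \<Rightarrow> real" where
  "form_face s \<rho> B f g =
     (\<Sum>i\<in>B. set_lebesgue_integral (mu_face s \<rho> B) (Eplus B)
              (\<lambda>x. ext_partial i f x * ext_partial i g x))"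

definition form ::
  "real \<Rightarrow> (real^'n \<Rightarrow> real) \<Rightarrow> (real^'n \<Rightarrow> real) \<Rightarrow> (real^'n \<Rightarrow> real) \<Rightarrow> real" where
  "form s \<rho> f g = (\<Sum>B\<in>{B. B \<noteq> {}}. form_face s \<rho> B f g)"

end

theory Submission
  imports Defs "HOL-Library.Function_Algebras"
begin

text \<open>The form is a finite sum of weighted Dirichlet integrals, one for each face of the orthant and each
direction tangential to it. Everything analytic about it rests on \<open>weak_derivative_zero\<close>: if
\<open>u\<^sub>k\<close> are functions of class \<open>C\<^sub>c\<^sup>2\<close> converging in \<open>L\<^sup>2(\<mu>)\<close> to a function \<open>f\<close> that is constant on an open
set \<open>V\<close>, and if \<open>\<partial>\<^sub>i u\<^sub>k\<close> converges to \<open>h\<close> in \<open>L\<^sup>2\<close> of a face to which the direction \<open>i\<close> is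
tangential, then \<open>h = 0\<close> on \<open>V\<close>. Near a point of \<open>R\<^sub>\<rho>\<close> the function \<open>1/\<rho>\<close> is integrable over a small
box, so by the Cauchy--Schwarz inequality convergence in the weighted \<open>L\<^sup>2\<close> space implies convergence
of the unweighted integrals against bounded functions. Hence one may pass to the limit in the
integration by parts on the face against functions of \<open>x\<^sub>i\<close> that vanish at the ends of the box,
and conclude that \<open>h\<close> integrates to zero over every smaller box. Since \<open>\<rho>\<close> is positive, hypothesis
(b) says that almost every point of a face belongs to \<open>R\<^sub>\<rho>\<close>, and countably many such boxes
cover these points.

With \<open>f = 0\<close> and \<open>V\<close> the whole space this is closability. For strong locality it is applied twice: the
gradient of \<open>f\<close> vanishes off the support of \<open>f\<close>, and the gradient of \<open>g\<close> vanishes on the neighbourhood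
of this support where \<open>g\<close> is constant.

For the Markov property, smooth functions with slope at most \<open>1\<close> approximate the unit contraction,
composition with them does not increase the energy on \<open>C\<^sub>c\<^sup>2\<close>, and the bound survives in
the limit by \<open>lower_semicontinuity\<close> of the closed form. Density of \<open>C\<^sub>c\<^sup>2\<close> in \<open>L\<^sup>2(\<mu>)\<close>
and regularity come from the Weierstrass approximation theorem and cut-off functions (\<open>Cck_dense\<close>,
\<open>Cck_uniformly_dense\<close>).

Conservativity is a statement about the semigroup, which has to be constructed from the form. If \<open>A\<close>
denotes the nonnegative self-adjoint operator of the form, the resolvents \<open>J h = (1 + h A)\<^bsup>-1\<^esup>\<close> exist
by the representation theorem of Riesz. On the domain of \<open>A\<^sup>2\<close>, replacing \<open>J a (J b f)\<close> by
\<open>J (a + b) f\<close> costs only \<open>a b |A\<^sup>2 f|\<close> (\<open>J_J_approx\<close>). This makes the implicit Euler scheme with dyadic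
steps converge to a contraction semigroup, without spectral calculus, and shows that its generator is
\<open>- A\<close> (\<open>T_difference_quotient\<close>, \<open>generator_imp_A\<close>). The semigroup fixes every vector of energy zero.
As \<open>\<mu>\<close> is finite, cut-off functions on balls of radius \<open>k\<close>, whose gradients are of order \<open>1/k\<close>, show that the
constant \<open>1\<close> is such a vector (\<open>one_in_closure\<close>).

The elements of \<open>L\<^sup>2\<close> are functions, not classes. The abstract part therefore works with
semi-inner products: limits are unique, and operators are linear and commute, only up to vectors of norm zero.\<close>

section \<open>Semi-inner product spaces\<close>

text \<open>A symmetric, nonnegative bilinear form on a subspace \<open>V\<close> of the ambient vector space. The locale serves
both for the scalar product of \<open>L\<^sup>2\<close> and for an energy form on its domain.\<close>

locale semi_inner =
  fixes V :: "'v::real_vector set" and b :: "'v \<Rightarrow> 'v \<Rightarrow> real"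
  assumes V_subspace: "subspace V"
    and sym: "u \<in> V \<Longrightarrow> v \<in> V \<Longrightarrow> b u v = b v u"
    and add_left: "u \<in> V \<Longrightarrow> v \<in> V \<Longrightarrow> w \<in> V \<Longrightarrow> b (u + v) w = b u w + b v w"
    and scale_left: "u \<in> V \<Longrightarrow> v \<in> V \<Longrightarrow> b (c *\<^sub>R u) v = c * b u v"
    and nonneg: "u \<in> V \<Longrightarrow> 0 \<le> b u u"
begin

lemma zero_mem [simp, intro]: "0 \<in> V"
  and add_mem [simp, intro]: "u \<in> V \<Longrightarrow> v \<in> V \<Longrightarrow> u + v \<in> V"
  and diff_mem [simp, intro]: "u \<in> V \<Longrightarrow> v \<in> V \<Longrightarrow> u - v \<in> V"
  and scale_mem [simp, intro]: "u \<in> V \<Longrightarrow> c *\<^sub>R u \<in> V"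
  and neg_mem [simp, intro]: "u \<in> V \<Longrightarrow> - u \<in> V"
  using V_subspace by (auto simp: subspace_0 subspace_add subspace_diff subspace_scale subspace_neg)

lemma add_right: "u \<in> V \<Longrightarrow> v \<in> V \<Longrightarrow> w \<in> V \<Longrightarrow> b w (u + v) = b w u + b w v"
  by (simp add: sym[of w] add_left)

lemma scale_right: "u \<in> V \<Longrightarrow> v \<in> V \<Longrightarrow> b v (c *\<^sub>R u) = c * b v u"
  by (simp add: sym[of v] scale_left)

lemma zero_left [simp]: "u \<in> V \<Longrightarrow> b 0 u = 0"
  using scale_left[of 0 u 0] by simp

lemma zero_right [simp]: "u \<in> V \<Longrightarrow> b u 0 = 0"
  by (simp add: sym[of u])

lemma neg_left: "u \<in> V \<Longrightarrow> v \<in> V \<Longrightarrow> b (- u) v = - b u v"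
  using scale_left[of u v "-1"] by simp

lemma neg_right: "u \<in> V \<Longrightarrow> v \<in> V \<Longrightarrow> b v (- u) = - b v u"
  by (simp add: sym[of v] neg_left)

lemma diff_left: "u \<in> V \<Longrightarrow> v \<in> V \<Longrightarrow> w \<in> V \<Longrightarrow> b (u - v) w = b u w - b v w"
  using add_left[of u "- v" w] by (simp add: neg_left)

lemma diff_right: "u \<in> V \<Longrightarrow> v \<in> V \<Longrightarrow> w \<in> V \<Longrightarrow> b w (u - v) = b w u - b w v"
  by (simp add: sym[of w] diff_left)

lemmas bil = add_left add_right scale_left scale_right neg_left neg_right diff_left diff_right

definition N :: "'v \<Rightarrow> real" where "N u = sqrt (b u u)"

lemma N_nonneg [simp]: "u \<in> V \<Longrightarrow> 0 \<le> N u"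
  by (simp add: N_def nonneg)

lemma N_sq: "u \<in> V \<Longrightarrow> (N u)\<^sup>2 = b u u"
  by (simp add: N_def nonneg)

lemma N_zero [simp]: "N 0 = 0"
  by (simp add: N_def)

lemma Cauchy_Schwarz_sq:
  assumes [simp]: "u \<in> V" "v \<in> V"
  shows "(b u v)\<^sup>2 \<le> b u u * b v v"
proof -
  have q: "0 \<le> b v v * t\<^sup>2 + 2 * b u v * t + b u u" for t
    using nonneg[of "u + t *\<^sub>R v"] by (simp add: bil sym[of v u] power2_eq_square algebra_simps)
  show ?thesis
  proof (cases "b v v = 0")
    case True
    \<comment> \<open>otherwise the affine function \<open>2 t b(u, v) + b(u, u)\<close> of \<open>t\<close> takes the value \<open>-1\<close>\<close>
    have "b u v = 0"
    proof (rule ccontr)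
      assume "b u v \<noteq> 0"
      with q[of "- (b u u + 1) / (2 * b u v)"] True show False by (simp add: field_simps)
    qed
    then show ?thesis using nonneg by simp
  next
    case False
    then have pos: "b v v > 0" using nonneg[of v] by simp
    have "0 \<le> b v v * (- b u v / b v v)\<^sup>2 + 2 * b u v * (- b u v / b v v) + b u u" by (rule q)
    also have "\<dots> = b u u - (b u v)\<^sup>2 / b v v"
      using pos by (simp add: field_simps power2_eq_square)
    finally show ?thesis using pos by (simp add: field_simps)
  qed
qed

lemma Cauchy_Schwarz: "u \<in> V \<Longrightarrow> v \<in> V \<Longrightarrow> \<bar>b u v\<bar> \<le> N u * N v"
  using real_sqrt_le_mono[OF Cauchy_Schwarz_sq[of u v]] by (simp add: N_def real_sqrt_mult)

lemma N_triangle: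
  assumes [simp]: "u \<in> V" "v \<in> V"
  shows "N (u + v) \<le> N u + N v"
proof -
  have "(N (u + v))\<^sup>2 = (N u)\<^sup>2 + 2 * b u v + (N v)\<^sup>2"
    by (simp add: N_sq bil sym[of v u])
  also have "\<dots> \<le> (N u + N v)\<^sup>2"
    using Cauchy_Schwarz[of u v] by (simp add: power2_sum)
  finally show ?thesis by (rule power2_le_imp_le) simp
qed

lemma N_scale: "u \<in> V \<Longrightarrow> N (c *\<^sub>R u) = \<bar>c\<bar> * N u"
proof -
  assume "u \<in> V"
  then have "b (c *\<^sub>R u) (c *\<^sub>R u) = c\<^sup>2 * b u u" by (simp add: bil power2_eq_square)
  then show ?thesis by (simp add: N_def real_sqrt_mult)
qed

lemma N_neg: "u \<in> V \<Longrightarrow> N (- u) = N u"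
  using N_scale[of u "-1"] by simp

lemma N_commute: "u \<in> V \<Longrightarrow> v \<in> V \<Longrightarrow> N (u - v) = N (v - u)"
  using N_neg[of "u - v"] by simp

lemma N_triangle_diff: "u \<in> V \<Longrightarrow> v \<in> V \<Longrightarrow> w \<in> V \<Longrightarrow> N (u - w) \<le> N (u - v) + N (v - w)"
  using N_triangle[of "u - v" "v - w"] by simp

lemma N_minus_le: "u \<in> V \<Longrightarrow> v \<in> V \<Longrightarrow> N (u - v) \<le> N u + N v"
  using N_triangle[of u "- v"] by (simp add: N_neg)

lemma N_reverse: "u \<in> V \<Longrightarrow> v \<in> V \<Longrightarrow> \<bar>N u - N v\<bar> \<le> N (u - v)"
  using N_triangle[of "u - v" v] N_triangle[of "v - u" u] N_commute[of u v] by simp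

lemma parallelogram:
  "u \<in> V \<Longrightarrow> v \<in> V \<Longrightarrow> b (u - v) (u - v) = 2 * b u u + 2 * b v v - b (u + v) (u + v)"
  by (simp add: bil sym[of v u])

subsection \<open>Convergence with respect to the seminorm\<close>

definition conv :: "(nat \<Rightarrow> 'v) \<Rightarrow> 'v \<Rightarrow> bool" where
  "conv u f \<longleftrightarrow> (\<lambda>k. b (u k - f) (u k - f)) \<longlonglongrightarrow> 0"

definition Cau :: "(nat \<Rightarrow> 'v) \<Rightarrow> bool" where
  "Cau u \<longleftrightarrow> (\<forall>\<epsilon>>0. \<exists>n. \<forall>j\<ge>n. \<forall>k\<ge>n. b (u j - u k) (u j - u k) < \<epsilon>)"

lemma conv_N:
  assumes "\<And>k. u k \<in> V" "f \<in> V"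
  shows "conv u f \<longleftrightarrow> (\<lambda>k. N (u k - f)) \<longlonglongrightarrow> 0"
proof
  assume "conv u f"
  then show "(\<lambda>k. N (u k - f)) \<longlonglongrightarrow> 0"
    unfolding conv_def N_def using tendsto_real_sqrt by fastforce
next
  assume "(\<lambda>k. N (u k - f)) \<longlonglongrightarrow> 0"
  then have "(\<lambda>k. (N (u k - f))\<^sup>2) \<longlonglongrightarrow> 0\<^sup>2" by (rule tendsto_power)
  then show "conv u f" unfolding conv_def by (simp add: N_sq assms)
qed

lemma Cau_N:
  assumes "\<And>k. u k \<in> V"
  shows "Cau u \<longleftrightarrow> (\<forall>\<epsilon>>0. \<exists>n. \<forall>j\<ge>n. \<forall>k\<ge>n. N (u j - u k) < \<epsilon>)"
proof
  assume c: "Cau u"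
  show "\<forall>\<epsilon>>0. \<exists>n. \<forall>j\<ge>n. \<forall>k\<ge>n. N (u j - u k) < \<epsilon>"
  proof (intro allI impI)
    fix e :: real assume "e > 0"
    then have "e\<^sup>2 > 0" by simp
    then obtain n where "\<forall>j\<ge>n. \<forall>k\<ge>n. b (u j - u k) (u j - u k) < e\<^sup>2"
      using c unfolding Cau_def by blast
    then show "\<exists>n. \<forall>j\<ge>n. \<forall>k\<ge>n. N (u j - u k) < e"
      unfolding N_def using \<open>e > 0\<close> by (intro exI[of _ n]) (auto intro: real_less_lsqrt)
  qed
next
  assume c: "\<forall>\<epsilon>>0. \<exists>n. \<forall>j\<ge>n. \<forall>k\<ge>n. N (u j - u k) < \<epsilon>"
  show "Cau u"
    unfolding Cau_def
  proof (intro allI impI)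
    fix e :: real assume "e > 0"
    then have "sqrt e > 0" by simp
    then obtain n where "\<forall>j\<ge>n. \<forall>k\<ge>n. N (u j - u k) < sqrt e"
      using c by blast
    then show "\<exists>n. \<forall>j\<ge>n. \<forall>k\<ge>n. b (u j - u k) (u j - u k) < e"
      unfolding N_def by auto
  qed
qed

lemma CauI:
  assumes "\<And>k. u k \<in> V"
    and "\<And>\<epsilon>. \<epsilon> > 0 \<Longrightarrow> \<exists>n. \<forall>j\<ge>n. \<forall>k\<ge>n. N (u j - u k) < \<epsilon>"
  shows "Cau u"
  using assms by (subst Cau_N) auto

lemma conv_const: "f \<in> V \<Longrightarrow> conv (\<lambda>_. f) f"
  by (simp add: conv_def)

lemma conv_tendsto_b:
  assumes u: "\<And>k. u k \<in> V" "f \<in> V" "conv u f" and v: "\<And>k. v k \<in> V" "g \<in> V" "conv v g"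
  shows "(\<lambda>k. b (u k) (v k)) \<longlonglongrightarrow> b f g"
proof (rule LIM_zero_cancel, rule Lim_null_comparison)
  have "\<bar>b (u k) (v k) - b f g\<bar> \<le> N (u k - f) * N (v k - g) + N (u k - f) * N g + N f * N (v k - g)" for k
  proof -
    have "b (u k) (v k) - b f g = b (u k - f) (v k - g) + b (u k - f) g + b f (v k - g)"
      using u v by (simp add: bil)
    then show ?thesis
      using Cauchy_Schwarz[of "u k - f" "v k - g"] Cauchy_Schwarz[of "u k - f" g]
        Cauchy_Schwarz[of f "v k - g"] u v by simp
  qed
  then show "\<forall>\<^sub>F k in sequentially. norm (b (u k) (v k) - b f g) \<le>
      N (u k - f) * N (v k - g) + N (u k - f) * N g + N f * N (v k - g)" by simp
  have "(\<lambda>k. N (u k - f)) \<longlonglongrightarrow> 0" "(\<lambda>k. N (v k - g)) \<longlonglongrightarrow> 0"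
    using u v conv_N by auto
  then have "(\<lambda>k. N (u k - f) * N (v k - g) + N (u k - f) * N g + N f * N (v k - g))
      \<longlonglongrightarrow> 0 * 0 + 0 * N g + N f * 0"
    by (intro tendsto_intros)
  then show "(\<lambda>k. N (u k - f) * N (v k - g) + N (u k - f) * N g + N f * N (v k - g)) \<longlonglongrightarrow> 0"
    by simp
qed

lemma conv_tendsto_N:
  assumes "\<And>k. u k \<in> V" "f \<in> V" "conv u f"
  shows "(\<lambda>k. N (u k)) \<longlonglongrightarrow> N f"
  unfolding N_def by (intro tendsto_real_sqrt conv_tendsto_b assms)

lemma conv_add:
  assumes "\<And>k. u k \<in> V" "f \<in> V" "conv u f" "\<And>k. v k \<in> V" "g \<in> V" "conv v g"
  shows "conv (\<lambda>k. u k + v k) (f + g)"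
proof (subst conv_N)
  have "(\<lambda>k. N (u k - f)) \<longlonglongrightarrow> 0" "(\<lambda>k. N (v k - g)) \<longlonglongrightarrow> 0"
    using assms conv_N by auto
  from tendsto_add[OF this] have lim: "(\<lambda>k. N (u k - f) + N (v k - g)) \<longlonglongrightarrow> 0" by simp
  have "norm (N (u k + v k - (f + g))) \<le> N (u k - f) + N (v k - g)" for k
    using N_triangle[of "u k - f" "v k - g"] N_nonneg[of "u k + v k - (f + g)"] assms
    by (simp add: algebra_simps)
  then show "(\<lambda>k. N (u k + v k - (f + g))) \<longlonglongrightarrow> 0"
    by (intro Lim_null_comparison[OF always_eventually lim]) blast
qed (use assms in auto)

lemma conv_scale:
  assumes "\<And>k. u k \<in> V" "f \<in> V" "conv u f"
  shows "conv (\<lambda>k. c *\<^sub>R u k) (c *\<^sub>R f)"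
proof (subst conv_N)
  have "(\<lambda>k. N (u k - f)) \<longlonglongrightarrow> 0" using assms conv_N by auto
  then have "(\<lambda>k. \<bar>c\<bar> * N (u k - f)) \<longlonglongrightarrow> \<bar>c\<bar> * 0" by (intro tendsto_intros)
  moreover have "N (c *\<^sub>R u k - c *\<^sub>R f) = \<bar>c\<bar> * N (u k - f)" for k
    using assms by (simp flip: scaleR_diff_right add: N_scale)
  ultimately show "(\<lambda>k. N (c *\<^sub>R u k - c *\<^sub>R f)) \<longlonglongrightarrow> 0" by simp
qed (use assms in auto)

lemma conv_diff:
  assumes "\<And>k. u k \<in> V" "f \<in> V" "conv u f" "\<And>k. v k \<in> V" "g \<in> V" "conv v g"
  shows "conv (\<lambda>k. u k - v k) (f - g)"
  using conv_add[OF assms(1-3), of "\<lambda>k. (-1) *\<^sub>R v k" "(-1) *\<^sub>R g"] conv_scale[OF assms(4-6), of "-1"] assms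
  by simp

lemma conv_unique:
  assumes "\<And>k. u k \<in> V" "f \<in> V" "conv u f" "g \<in> V" "conv u g"
  shows "N (f - g) = 0"
proof -
  have "conv (\<lambda>k. u k - u k) (f - g)" using assms by (intro conv_diff) auto
  then show ?thesis using assms by (simp add: conv_def N_def LIMSEQ_const_iff bil)
qed

lemma conv_imp_Cau:
  assumes "\<And>k. u k \<in> V" "f \<in> V" "conv u f"
  shows "Cau u"
proof (rule CauI)
  fix e :: real assume "e > 0"
  have "(\<lambda>k. N (u k - f)) \<longlonglongrightarrow> 0" using assms conv_N by auto
  then obtain n where n: "\<forall>k\<ge>n. N (u k - f) < e/2"
    using \<open>e > 0\<close> by (fastforce simp: assms dest: LIMSEQ_D[where r="e/2"])
  have "N (u j - u k) < e" if "j \<ge> n" "k \<ge> n" for j k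
    using N_triangle_diff[of "u j" f "u k"] N_commute[of f "u k"] n that assms
    by (smt (verit) field_sum_of_halves)
  then show "\<exists>n. \<forall>j\<ge>n. \<forall>k\<ge>n. N (u j - u k) < e" by auto
qed (use assms in auto)

lemma Cau_bounded:
  assumes "\<And>k. u k \<in> V" "Cau u"
  obtains C where "C \<ge> 0" "\<And>k. N (u k) \<le> C"
proof -
  obtain n where n: "\<forall>j\<ge>n. \<forall>k\<ge>n. N (u j - u k) < 1"
    using assms Cau_N[of u] by (meson zero_less_one)
  have *: "N (u k) \<le> N (u n) + 1" if "k \<ge> n" for k
    using N_reverse[of "u k" "u n"] n that assms by (smt (verit) order_refl)
  define C where "C = Max (insert (N (u n) + 1) ((\<lambda>k. N (u k)) ` {..n}))"
  have "N (u k) \<le> C" for k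
  proof (cases "k \<ge> n")
    case True
    then show ?thesis using *[of k] Max_ge[of "insert (N (u n) + 1) ((\<lambda>k. N (u k)) ` {..n})" "N (u n) + 1"]
      by (simp add: C_def)
  next
    case False
    then have "N (u k) \<in> insert (N (u n) + 1) ((\<lambda>k. N (u k)) ` {..n})" by auto
    then show ?thesis unfolding C_def by (intro Max_ge) auto
  qed
  moreover have "C \<ge> 0" using calculation[of 0] N_nonneg[OF assms(1)[of 0]] by linarith
  ultimately show ?thesis using that by blast
qed

lemma Cau_add:
  assumes "\<And>k. u k \<in> V" "Cau u" "\<And>k. v k \<in> V" "Cau v"
  shows "Cau (\<lambda>k. u k + v k)"
proof (rule CauI)
  fix e :: real assume "e > 0"
  then have "e/2 > 0" by simp
  then obtain n m where n: "\<forall>j\<ge>n. \<forall>k\<ge>n. N (u j - u k) < e/2" and m: "\<forall>j\<ge>m. \<forall>k\<ge>m. N (v j - v k) < e/2"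
    using assms Cau_N[of u] Cau_N[of v] by meson
  have "N (u j + v j - (u k + v k)) < e" if "j \<ge> max n m" "k \<ge> max n m" for j k
  proof -
    have "N (u j + v j - (u k + v k)) \<le> N (u j - u k) + N (v j - v k)"
      using N_triangle[of "u j - u k" "v j - v k"] assms by (simp add: algebra_simps)
    also have "\<dots> < e/2 + e/2" using n m that by (intro add_strict_mono) auto
    finally show ?thesis by simp
  qed
  then show "\<exists>n. \<forall>j\<ge>n. \<forall>k\<ge>n. N (u j + v j - (u k + v k)) < e" by blast
qed (use assms in auto)

lemma Cau_scale:
  assumes "\<And>k. u k \<in> V" "Cau u"
  shows "Cau (\<lambda>k. c *\<^sub>R u k)"
proof (rule CauI)
  fix e :: real assume "e > 0"
  then have "e / (\<bar>c\<bar> + 1) > 0" by simp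
  then obtain n where n: "\<forall>j\<ge>n. \<forall>k\<ge>n. N (u j - u k) < e / (\<bar>c\<bar> + 1)"
    using assms Cau_N[of u] by meson
  have "N (c *\<^sub>R u j - c *\<^sub>R u k) < e" if "j \<ge> n" "k \<ge> n" for j k
  proof -
    have "N (c *\<^sub>R u j - c *\<^sub>R u k) = \<bar>c\<bar> * N (u j - u k)"
      using assms by (simp flip: scaleR_diff_right add: N_scale)
    also have "\<dots> \<le> \<bar>c\<bar> * (e / (\<bar>c\<bar> + 1))" using n that by (intro mult_left_mono) (auto intro: less_imp_le)
    also have "\<dots> < e" using \<open>e > 0\<close> by (simp add: field_simps)
    finally show ?thesis .
  qed
  then show "\<exists>n. \<forall>j\<ge>n. \<forall>k\<ge>n. N (c *\<^sub>R u j - c *\<^sub>R u k) < e" by blast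
qed (use assms in auto)

lemma Cau_tendsto_b:
  assumes u: "\<And>k. u k \<in> V" "Cau u" and v: "\<And>k. v k \<in> V" "Cau v"
  shows "convergent (\<lambda>k. b (u k) (v k))"
proof (rule Cauchy_convergent, rule metric_CauchyI)
  fix e :: real assume "e > 0"
  obtain C where C: "C \<ge> 0" "\<And>k. N (u k) \<le> C" using Cau_bounded[OF u] by blast
  obtain C' where C': "C' \<ge> 0" "\<And>k. N (v k) \<le> C'" using Cau_bounded[OF v] by blast
  define d where "d = e / (C + C' + 1)"
  have "d > 0" using \<open>e > 0\<close> C C' by (simp add: d_def add_nonneg_pos)
  then obtain n m where n: "\<forall>j\<ge>n. \<forall>k\<ge>n. N (u j - u k) < d" and m: "\<forall>j\<ge>m. \<forall>k\<ge>m. N (v j - v k) < d"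
    using u v Cau_N[of u] Cau_N[of v] by meson
  have "\<bar>b (u j) (v j) - b (u k) (v k)\<bar> < e" if "j \<ge> max n m" "k \<ge> max n m" for j k
  proof -
    have "b (u j) (v j) - b (u k) (v k) = b (u j) (v j - v k) + b (u j - u k) (v k)"
      using u v by (simp add: bil)
    also have "\<bar>\<dots>\<bar> \<le> N (u j) * N (v j - v k) + N (u j - u k) * N (v k)"
      using Cauchy_Schwarz[of "u j" "v j - v k"] Cauchy_Schwarz[of "u j - u k" "v k"] u v by simp
    also have "\<dots> \<le> C * d + d * C'"
      using C C' n m that u v \<open>d > 0\<close> by (intro add_mono mult_mono) (auto intro: less_imp_le)
    also have "\<dots> < (C + C' + 1) * d" using \<open>d > 0\<close> by (simp add: algebra_simps)
    also have "\<dots> = e" using C C' by (simp add: d_def)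
    finally show ?thesis .
  qed
  then show "\<exists>M. \<forall>m\<ge>M. \<forall>n\<ge>M. dist (b (u m) (v m)) (b (u n) (v n)) < e"
    unfolding dist_real_def by blast
qed

lemma conv_N_le:
  assumes u: "\<And>k. u k \<in> V" "f \<in> V" "conv u f" and v: "\<And>k. v k \<in> V" "g \<in> V" "conv v g"
    and le: "\<And>k. N (u k - v k) \<le> e k" and e: "e \<longlonglongrightarrow> c"
  shows "N (f - g) \<le> c"
proof (rule LIMSEQ_le)
  show "(\<lambda>k. N (u k - v k)) \<longlonglongrightarrow> N (f - g)"
    by (rule conv_tendsto_N[OF _ _ conv_diff[OF u v]]) (simp_all add: u v)
qed (use le e in auto)

text \<open>Telescoping: the sum of the distances from index \<open>k\<close> on is at most \<open>2 C (1/2)\<^sup>k\<close>.\<close>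

lemma Cau_geometric:
  assumes u: "\<And>k. u k \<in> V" and C: "C \<ge> 0" and step: "\<And>k. N (u (Suc k) - u k) \<le> C * (1/2) ^ k"
  shows "Cau u"
proof (rule CauI[OF u])
  have tele: "N (u (k + m) - u k) \<le> 2 * C * (1/2) ^ k - 2 * C * (1/2) ^ (k + m)" for k m
  proof (induction m)
    case (Suc m)
    have "N (u (k + Suc m) - u k) \<le> N (u (Suc (k + m)) - u (k + m)) + N (u (k + m) - u k)"
      using N_triangle_diff[OF u u u] by simp
    also have "\<dots> \<le> C * (1/2) ^ (k + m) + (2 * C * (1/2) ^ k - 2 * C * (1/2) ^ (k + m))"
      by (intro add_mono step Suc)
    finally show ?case by simp
  qed simp
  fix e :: real assume "e > 0"
  have "(\<lambda>n. 4 * C * (1/2) ^ n) \<longlonglongrightarrow> 4 * C * 0"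
    by (intro tendsto_intros LIMSEQ_power_zero) simp
  then have "eventually (\<lambda>n. 4 * C * (1/2) ^ n < e) sequentially"
    using \<open>e > 0\<close> by (intro order_tendstoD) auto
  then obtain n where n: "4 * C * (1/2) ^ n < e" by (auto simp: eventually_sequentially)
  have near: "N (u j - u n) \<le> 2 * C * (1/2) ^ n" if "j \<ge> n" for j
  proof -
    have "0 \<le> 2 * C * (1/2) ^ (n + (j - n))" using C by simp
    then show ?thesis using tele[of n "j - n"] that by simp
  qed
  have "N (u j - u k) < e" if "j \<ge> n" "k \<ge> n" for j k
    using N_triangle_diff[of "u j" "u n" "u k"] u near[OF that(1)] near[OF that(2)] N_commute[of "u n" "u k"] n
    by simp
  then show "\<exists>n. \<forall>j\<ge>n. \<forall>k\<ge>n. N (u j - u k) < e" by blast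
qed

definition is_complete :: bool where
  "is_complete \<longleftrightarrow> (\<forall>u. (\<forall>k. u k \<in> V) \<and> Cau u \<longrightarrow> (\<exists>f\<in>V. conv u f))"

lemma completeD: "is_complete \<Longrightarrow> (\<And>k. u k \<in> V) \<Longrightarrow> Cau u \<Longrightarrow> \<exists>f\<in>V. conv u f"
  by (auto simp: is_complete_def)

text \<open>The representing vector minimises \<open>b v v - 2 * l v\<close>; minimising sequences are Cauchy by
  the parallelogram law.\<close>

lemma Riesz_representation:
  assumes complete: "is_complete"
    and l_add: "\<And>u v. u \<in> V \<Longrightarrow> v \<in> V \<Longrightarrow> l (u + v) = l u + l v"
    and l_scale: "\<And>c u. u \<in> V \<Longrightarrow> l (c *\<^sub>R u) = c * l u"
    and bound: "\<And>u. u \<in> V \<Longrightarrow> \<bar>l u\<bar> \<le> C * N u"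
  obtains u where "u \<in> V" "\<And>v. v \<in> V \<Longrightarrow> b u v = l v"
proof -
  define F where "F v = b v v - 2 * l v" for v
  have bdd: "- C\<^sup>2 \<le> F v" if "v \<in> V" for v
  proof -
    have "0 \<le> (N v - C)\<^sup>2" by simp
    then show ?thesis using bound[OF that] N_sq[OF that] by (simp add: F_def power2_diff algebra_simps)
  qed
  define m where "m = Inf (F ` V)"
  have bb: "bdd_below (F ` V)" using bdd by (auto intro!: bdd_belowI2)
  have m_le: "m \<le> F v" if "v \<in> V" for v
    unfolding m_def using bb that by (auto intro: cInf_lower)
  have "\<exists>v\<in>V. F v < m + 1 / real (Suc k)" for k
  proof -
    have "m < m + 1 / real (Suc k)" by simp
    then show ?thesis using cInf_less_iff[OF _ bb, of "m + 1 / real (Suc k)"] zero_mem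
      unfolding m_def by blast
  qed
  then obtain w where w [simp]: "\<And>k. w k \<in> V" and Fw: "\<And>k. F (w k) < m + 1 / real (Suc k)"
    by metis
  have par: "b (w j - w k) (w j - w k) \<le> 2 / real (Suc j) + 2 / real (Suc k)" for j k
  proof -
    have "4 * F ((1/2) *\<^sub>R (w j + w k)) = b (w j + w k) (w j + w k) - 4 * (l (w j) + l (w k))"
      by (simp add: F_def bil l_add l_scale algebra_simps)
    then have "b (w j - w k) (w j - w k) = 2 * F (w j) + 2 * F (w k) - 4 * F ((1/2) *\<^sub>R (w j + w k))"
      by (simp add: F_def parallelogram)
    moreover have "m \<le> F ((1/2) *\<^sub>R (w j + w k))" by (rule m_le) simp
    ultimately show ?thesis using Fw[of j] Fw[of k] by simp
  qed
  have "Cau w"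
    unfolding Cau_def
  proof (intro allI impI)
    fix e :: real assume "e > 0"
    then obtain n where n: "inverse (real (Suc n)) < e / 4"
      using reals_Archimedean[of "e/4"] by auto
    have "b (w j - w k) (w j - w k) < e" if "j \<ge> n" "k \<ge> n" for j k
    proof -
      have "1 / real (Suc j) \<le> 1 / real (Suc n)" "1 / real (Suc k) \<le> 1 / real (Suc n)"
        using that by (simp_all add: frac_le)
      then show ?thesis using par[of j k] n by (simp add: inverse_eq_divide)
    qed
    then show "\<exists>n. \<forall>j\<ge>n. \<forall>k\<ge>n. b (w j - w k) (w j - w k) < e" by blast
  qed
  from completeD[OF complete w this] obtain u where u [simp]: "u \<in> V" and cu: "conv w u" by blast
  have wu: "(\<lambda>k. N (w k - u)) \<longlonglongrightarrow> 0"
    using cu by (simp add: conv_N)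
  have "(\<lambda>k. l (w k)) \<longlonglongrightarrow> l u"
  proof (rule LIM_zero_cancel, rule Lim_null_comparison)
    have "l (w k) - l u = l (w k - u)" for k
      using l_add[of "w k" "(-1) *\<^sub>R u"] l_scale[of u "-1"] by simp
    then show "\<forall>\<^sub>F k in sequentially. norm (l (w k) - l u) \<le> C * N (w k - u)"
      using bound[OF diff_mem[OF w u]] by (intro always_eventually) simp
    show "(\<lambda>k. C * N (w k - u)) \<longlonglongrightarrow> 0"
      by (rule tendsto_mult_right_zero[OF wu])
  qed
  then have "(\<lambda>k. F (w k)) \<longlonglongrightarrow> F u"
    unfolding F_def by (intro tendsto_intros conv_tendsto_b cu) auto
  moreover have "(\<lambda>k. m + 1 / real (Suc k)) \<longlonglongrightarrow> m + 0"
    using LIMSEQ_inverse_real_of_nat by (intro tendsto_intros) (simp add: inverse_eq_divide)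
  ultimately have "F u \<le> m + 0"
    using Fw by (intro LIMSEQ_le) (auto intro: less_imp_le)
  then have min: "F u \<le> F v" if "v \<in> V" for v using m_le[OF that] by simp
  have "b u v = l v" if [simp]: "v \<in> V" for v
  proof (rule ccontr)
    assume ne: "b u v \<noteq> l v"
    define d where "d = b u v - l v"
    have q: "0 \<le> 2 * t * d + t\<^sup>2 * b v v" for t
      using min[of "u + t *\<^sub>R v"]
      by (simp add: F_def d_def bil l_add l_scale sym[of v u] power2_eq_square algebra_simps)
    \<comment> \<open>the parabola \<open>2 t d + t\<^sup>2 b(v, v)\<close> is negative at \<open>t = - d / s\<close> for every \<open>s > b(v, v) / 2\<close>\<close>
    define s where "s = b v v + 1"
    have s: "s > 0" "b v v < s" using nonneg[of v] by (auto simp: s_def)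
    have "d\<^sup>2 * b v v \<le> d\<^sup>2 * s" using s by (intro mult_left_mono) auto
    have "0 \<le> 2 * (- d / s) * d + (- d / s)\<^sup>2 * b v v" by (rule q)
    also have "\<dots> = (d\<^sup>2 * b v v - 2 * d\<^sup>2 * s) / s\<^sup>2"
      using s by (simp add: field_simps power2_eq_square)
    finally have "0 \<le> d\<^sup>2 * b v v - 2 * d\<^sup>2 * s" using s by (simp add: zero_le_divide_iff)
    with \<open>d\<^sup>2 * b v v \<le> d\<^sup>2 * s\<close> have "d\<^sup>2 * s \<le> 0" by simp
    then show False using s ne by (simp add: d_def mult_le_0_iff)
  qed
  then show ?thesis using that u by blast
qed

end

section \<open>The resolvent and the semigroup of a closed form\<close>

text \<open>A closed, densely defined, nonnegative form \<open>Q\<close> with domain \<open>D\<close> in the space \<open>H\<close>. The last assumption expresses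
that the form does not distinguish vectors at distance zero: null vectors belong to the domain and have energy zero.\<close>

locale closed_form_space =
  H: semi_inner H ip + Q: semi_inner D Q
  for H :: "'v::real_vector set" and ip :: "'v \<Rightarrow> 'v \<Rightarrow> real"
    and D :: "'v set" and Q :: "'v \<Rightarrow> 'v \<Rightarrow> real" +
  assumes H_complete: "H.is_complete"
    and D_sub: "D \<subseteq> H"
    and dense: "\<And>f e. f \<in> H \<Longrightarrow> e > 0 \<Longrightarrow> \<exists>g\<in>D. H.N (f - g) < e"
    and D_complete: "\<And>u. (\<And>k. u k \<in> D) \<Longrightarrow> H.Cau u \<Longrightarrow> Q.Cau u
                       \<Longrightarrow> \<exists>f\<in>D. H.conv u f \<and> Q.conv u f"
    and null: "\<And>f. f \<in> H \<Longrightarrow> ip f f = 0 \<Longrightarrow> f \<in> D \<and> Q f f = 0"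
begin

lemma D_H [simp]: "f \<in> D \<Longrightarrow> f \<in> H"
  using D_sub by auto

lemma N_le_0 [simp]: "f \<in> H \<Longrightarrow> H.N f \<le> 0 \<longleftrightarrow> H.N f = 0"
  using H.N_nonneg[of f] by (auto intro: antisym)

lemma N_zero_iff: "f \<in> H \<Longrightarrow> H.N f = 0 \<longleftrightarrow> ip f f = 0"
  using H.N_sq[of f] by (auto simp: H.N_def)

lemma Q_null: "f \<in> H \<Longrightarrow> H.N f = 0 \<Longrightarrow> v \<in> D \<Longrightarrow> f \<in> D \<and> Q f v = 0"
  using null[of f] Q.Cauchy_Schwarz_sq[of f v] N_zero_iff[of f] by auto

lemma ip_null: "f \<in> H \<Longrightarrow> H.N f = 0 \<Longrightarrow> v \<in> H \<Longrightarrow> ip f v = 0"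
  using H.Cauchy_Schwarz[of f v] by auto

lemma D_cong: "f \<in> D \<Longrightarrow> g \<in> H \<Longrightarrow> H.N (f - g) = 0 \<Longrightarrow> g \<in> D"
  using Q.diff_mem[of f "f - g"] null[of "f - g"] N_zero_iff[of "f - g"] by auto

lemma eq_of_ip:
  assumes "f \<in> H" "g \<in> H" "\<And>v. v \<in> D \<Longrightarrow> ip f v = ip g v"
  shows "H.N (f - g) = 0"
proof (rule ccontr)
  let ?n = "H.N (f - g)"
  assume "?n \<noteq> 0"
  then have pos: "?n > 0" using H.N_nonneg[OF H.diff_mem[OF assms(1,2)]] by linarith
  then obtain v where v: "v \<in> D" "H.N (f - g - v) < ?n" using dense[of "f - g" ?n] assms by auto
  have "?n\<^sup>2 = ip (f - g) (f - g - v)"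
    using assms v by (simp add: H.N_sq H.bil)
  also have "\<dots> \<le> ?n * H.N (f - g - v)"
    using H.Cauchy_Schwarz[of "f - g" "f - g - v"] assms v by simp
  also have "\<dots> < ?n * ?n" using pos v by simp
  finally show False by (simp add: power2_eq_square)
qed

text \<open>\<open>A f g\<close>: \<open>g\<close> is a value at \<open>f\<close> of the nonnegative self-adjoint operator defined by the form.\<close>

definition A :: "'v \<Rightarrow> 'v \<Rightarrow> bool" where
  "A f g \<longleftrightarrow> f \<in> D \<and> g \<in> H \<and> (\<forall>v\<in>D. Q f v = ip g v)"

lemma A_D: "A f g \<Longrightarrow> f \<in> D" and A_H: "A f g \<Longrightarrow> g \<in> H" and A_HD: "A f g \<Longrightarrow> f \<in> H"
  by (auto simp: A_def)

lemma A_eq: "A f g \<Longrightarrow> v \<in> D \<Longrightarrow> Q f v = ip g v"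
  by (auto simp: A_def)

lemma A_lin: "A f g \<Longrightarrow> A f' g' \<Longrightarrow> A (f + f') (g + g')"
  and A_scale: "A f g \<Longrightarrow> A (c *\<^sub>R f) (c *\<^sub>R g)"
  by (auto simp: A_def H.bil Q.bil)

lemma A_diff: "A f g \<Longrightarrow> A f' g' \<Longrightarrow> A (f - f') (g - g')"
  by (auto simp: A_def H.bil Q.bil)

lemma A_value_unique: "A f g \<Longrightarrow> A f g' \<Longrightarrow> H.N (g - g') = 0"
  by (rule eq_of_ip) (auto simp: A_def)

lemma A_cong_value: "A f g \<Longrightarrow> g' \<in> H \<Longrightarrow> H.N (g - g') = 0 \<Longrightarrow> A f g'"
  using ip_null[of "g - g'"] by (auto simp: A_def H.bil)

lemma A_cong_arg: "A f g \<Longrightarrow> f' \<in> H \<Longrightarrow> H.N (f - f') = 0 \<Longrightarrow> A f' g"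
  using Q_null[of "f - f'"] D_cong[of f f'] by (auto simp: A_def Q.bil)

lemma form_plus_ip: "h > 0 \<Longrightarrow> semi_inner D (\<lambda>u v. h * Q u v + ip u v)"
proof unfold_locales
  assume "h > 0"
  then show "0 \<le> h * Q u u + ip u u" if "u \<in> D" for u
    using that by (intro add_nonneg_nonneg mult_nonneg_nonneg Q.nonneg H.nonneg) auto
  show "h * Q u v + ip u v = h * Q v u + ip v u" if "u \<in> D" "v \<in> D" for u v
    using that Q.sym[of u v] H.sym[of u v] by simp
qed (auto simp: Q.V_subspace Q.bil H.bil algebra_simps)

text \<open>The domain is complete for the scalar product \<open>h Q + ip\<close>, so the functional \<open>ip f\<close> is represented in it.\<close>

lemma resolvent_exists:
  assumes h: "h > 0" and f [simp]: "f \<in> H"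
  shows "\<exists>u\<in>D. \<forall>v\<in>D. h * Q u v + ip u v = ip f v"
proof -
  interpret E: semi_inner D "\<lambda>u v. h * Q u v + ip u v" by (rule form_plus_ip[OF h])
  have "E.is_complete"
    unfolding E.is_complete_def
  proof (intro allI impI, elim conjE)
    fix u assume u: "\<forall>k. u k \<in> D" and c: "E.Cau u"
    have "Q.Cau u"
      unfolding Q.Cau_def
    proof (intro allI impI)
      fix e :: real assume "e > 0"
      then have "h * e > 0" using h by simp
      then obtain n where n: "\<forall>j\<ge>n. \<forall>k\<ge>n. h * Q (u j - u k) (u j - u k) + ip (u j - u k) (u j - u k) < h * e"
        using c unfolding E.Cau_def by blast
      have "Q (u j - u k) (u j - u k) < e" if "j \<ge> n" "k \<ge> n" for j k
      proof -
        have "h * Q (u j - u k) (u j - u k) < h * e"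
          using n that H.nonneg[of "u j - u k"] u by (smt (verit) D_H H.diff_mem)
        then show ?thesis using h by simp
      qed
      then show "\<exists>n. \<forall>j\<ge>n. \<forall>k\<ge>n. Q (u j - u k) (u j - u k) < e" by blast
    qed
    moreover have "H.Cau u"
      unfolding H.Cau_def
    proof (intro allI impI)
      fix e :: real assume "e > 0"
      then obtain n where n: "\<forall>j\<ge>n. \<forall>k\<ge>n. h * Q (u j - u k) (u j - u k) + ip (u j - u k) (u j - u k) < e"
        using c unfolding E.Cau_def by blast
      have "ip (u j - u k) (u j - u k) < e" if "j \<ge> n" "k \<ge> n" for j k
      proof -
        have "0 \<le> h * Q (u j - u k) (u j - u k)" using h Q.nonneg u by simp
        then show ?thesis using n that by (smt (verit))
      qed
      then show "\<exists>n. \<forall>j\<ge>n. \<forall>k\<ge>n. ip (u j - u k) (u j - u k) < e" by blast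
    qed
    ultimately have "\<exists>g\<in>D. H.conv u g \<and> Q.conv u g"
      using u by (intro D_complete) (auto simp del: D_H)
    then obtain g where g: "g \<in> D" "H.conv u g" "Q.conv u g" by blast
    then have "(\<lambda>k. h * Q (u k - g) (u k - g) + ip (u k - g) (u k - g)) \<longlonglongrightarrow> h * 0 + 0"
      unfolding H.conv_def Q.conv_def by (intro tendsto_intros)
    then show "\<exists>g\<in>D. E.conv u g" using g unfolding E.conv_def by auto
  qed
  moreover have "\<bar>ip f u\<bar> \<le> H.N f * E.N u" if "u \<in> D" for u
  proof -
    have "H.N u \<le> E.N u"
      unfolding H.N_def E.N_def using h Q.nonneg[OF that] by simp
    then show ?thesis
      using H.Cauchy_Schwarz[of f u] that mult_left_mono[of "H.N u" "E.N u" "H.N f"] by simp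
  qed
  ultimately obtain u where "u \<in> D" "\<And>v. v \<in> D \<Longrightarrow> h * Q u v + ip u v = ip f v"
    using E.Riesz_representation[of "ip f" "H.N f"] by (auto simp: H.bil)
  then show ?thesis by blast
qed

text \<open>The resolvent \<open>(1 + h A)\<^bsup>-1\<^esup>\<close>, which is determined up to vectors of norm zero.\<close>

definition J :: "real \<Rightarrow> 'v \<Rightarrow> 'v" where
  "J h f = (SOME u. u \<in> D \<and> (\<forall>v\<in>D. h * Q u v + ip u v = ip f v))"

lemma J_D: "h > 0 \<Longrightarrow> f \<in> H \<Longrightarrow> J h f \<in> D"
  and J_eq: "h > 0 \<Longrightarrow> f \<in> H \<Longrightarrow> v \<in> D \<Longrightarrow> h * Q (J h f) v + ip (J h f) v = ip f v"
proof -
  assume hf: "h > 0" "f \<in> H"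
  then have "\<exists>u. u \<in> D \<and> (\<forall>v\<in>D. h * Q u v + ip u v = ip f v)"
    using resolvent_exists[OF hf] by blast
  from someI_ex[OF this] have "J h f \<in> D \<and> (\<forall>v\<in>D. h * Q (J h f) v + ip (J h f) v = ip f v)"
    unfolding J_def .
  then show "J h f \<in> D" "v \<in> D \<Longrightarrow> h * Q (J h f) v + ip (J h f) v = ip f v" by auto
qed

lemma J_H [simp]: "h > 0 \<Longrightarrow> f \<in> H \<Longrightarrow> J h f \<in> H"
  using J_D by auto

lemma A_J: "h > 0 \<Longrightarrow> f \<in> H \<Longrightarrow> A (J h f) ((1/h) *\<^sub>R (f - J h f))"
  unfolding A_def using J_D J_eq by (auto simp: H.bil field_simps)

text \<open>The operator \<open>A\<close> is monotone: testing \<open>v - w + h (A v - A w) = f - f'\<close> with \<open>v - w\<close> and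
dropping the energy term leaves \<open>|v - w|\<^sup>2 \<le> ip (f - f') (v - w)\<close>.\<close>

lemma resolvent_contraction:
  assumes h: "h > 0" and A: "A v ((1/h) *\<^sub>R (f - v))" "A w ((1/h) *\<^sub>R (f' - w))" and [simp]: "f \<in> H" "f' \<in> H"
  shows "H.N (v - w) \<le> H.N (f - f')"
proof -
  have [simp]: "v \<in> D" "w \<in> D" using A A_D by auto
  have "Q (v - w) (v - w) = ip ((1/h) *\<^sub>R (f - v) - (1/h) *\<^sub>R (f' - w)) (v - w)"
    using A_diff[OF A] by (auto simp: A_def)
  also have "\<dots> = (ip (f - f') (v - w) - ip (v - w) (v - w)) / h"
    by (simp add: H.bil algebra_simps add_divide_distrib diff_divide_distrib)
  finally have "ip (v - w) (v - w) \<le> ip (f - f') (v - w)"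
    using Q.nonneg[of "v - w"] h by (simp add: zero_le_divide_iff)
  then have "(H.N (v - w))\<^sup>2 \<le> H.N (f - f') * H.N (v - w)"
    using H.Cauchy_Schwarz[of "f - f'" "v - w"] by (simp add: H.N_sq)
  then show ?thesis
    using H.N_nonneg[of "v - w"] H.N_nonneg[of "f - f'"]
    by (smt (verit) \<open>v \<in> D\<close> \<open>w \<in> D\<close> assms(4,5) D_H H.diff_mem mult_right_le_imp_le power2_eq_square)
qed

lemma J_unique:
  assumes "h > 0" "A v ((1/h) *\<^sub>R (f - v))" "f \<in> H"
  shows "H.N (v - J h f) = 0"
  using resolvent_contraction[OF assms(1,2) A_J, of f] assms A_HD[OF assms(2)] H.N_nonneg[of "v - J h f"]
  by (simp add: antisym)

lemma J_contraction_diff: "h > 0 \<Longrightarrow> f \<in> H \<Longrightarrow> g \<in> H \<Longrightarrow> H.N (J h f - J h g) \<le> H.N (f - g)"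
  using resolvent_contraction[OF _ A_J A_J] by simp

lemma A_zero: "A 0 0"
  by (auto simp: A_def)

lemma J_contraction: "h > 0 \<Longrightarrow> f \<in> H \<Longrightarrow> H.N (J h f) \<le> H.N f"
  using resolvent_contraction[OF _ A_J, of h f 0 0] A_zero by simp

text \<open>From \<open>A f = g\<close> one gets \<open>A (f - J h f) = g - A (J h f)\<close>, and dividing by \<open>h\<close> shows that \<open>(f - J h f) / h\<close>,
which is \<open>A (J h f)\<close>, solves the resolvent equation for \<open>g\<close>.\<close>

lemma A_J_commute:
  assumes "h > 0" "A f g"
  shows "A (J h f) (J h g)"
proof -
  note [simp] = A_HD[OF assms(2)] A_H[OF assms(2)] assms(1)
  have "A (f - J h f) (g - (1/h) *\<^sub>R (f - J h f))" using assms A_J by (intro A_diff) auto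
  then have "A ((1/h) *\<^sub>R (f - J h f)) ((1/h) *\<^sub>R (g - (1/h) *\<^sub>R (f - J h f)))" by (rule A_scale)
  then have "H.N ((1/h) *\<^sub>R (f - J h f) - J h g) = 0" by (intro J_unique) auto
  then show ?thesis by (intro A_cong_value[OF A_J]) auto
qed

lemma J_diff_eq:
  assumes "h > 0" "A f g"
  shows "H.N (J h f - f + h *\<^sub>R J h g) = 0"
proof -
  note [simp] = A_HD[OF assms(2)] A_H[OF assms(2)] assms(1)
  have "H.N ((1/h) *\<^sub>R (f - J h f) - J h g) = 0"
    using A_J[of h f] A_J_commute[OF assms] by (intro A_value_unique) auto
  moreover have "J h f - f + h *\<^sub>R J h g = (- h) *\<^sub>R ((1/h) *\<^sub>R (f - J h f) - J h g)"
    using assms(1) by (simp add: scaleR_diff_right less_imp_neq[symmetric])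
  ultimately show ?thesis by (simp only: H.N_scale H.diff_mem H.scale_mem J_H \<open>f \<in> H\<close> \<open>g \<in> H\<close> assms(1) mult_zero_right)
qed

lemma J_commute:
  assumes [simp]: "a > 0" "b > 0" "f \<in> H"
  shows "H.N (J a (J b f) - J b (J a f)) = 0"
proof (rule J_unique)
  have "A (J a (J b f)) (J a ((1/b) *\<^sub>R (f - J b f)))" by (intro A_J_commute A_J) auto
  then show "A (J a (J b f)) ((1/b) *\<^sub>R (J a f - J a (J b f)))"
  proof (rule A_cong_value)
    show "H.N (J a ((1/b) *\<^sub>R (f - J b f)) - (1/b) *\<^sub>R (J a f - J a (J b f))) = 0"
  proof -
    let ?x = "(1/b) *\<^sub>R (J a f - J a (J b f))"
    have "A ?x ((1/b) *\<^sub>R ((1/a) *\<^sub>R (f - J a f) - (1/a) *\<^sub>R (J b f - J a (J b f))))"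
      by (intro A_scale A_diff A_J) auto
    moreover have "(1/b) *\<^sub>R ((1/a) *\<^sub>R (f - J a f) - (1/a) *\<^sub>R (J b f - J a (J b f)))
        = (1/a) *\<^sub>R ((1/b) *\<^sub>R (f - J b f) - ?x)"
      by (simp add: algebra_simps)
    ultimately have "H.N (?x - J a ((1/b) *\<^sub>R (f - J b f))) = 0" by (intro J_unique) auto
    then show ?thesis by (subst H.N_commute) auto
  qed
  qed auto
qed auto

lemma J_lin:
  assumes [simp]: "h > 0" "f \<in> H" "g \<in> H"
  shows "H.N (J h (a *\<^sub>R f + c *\<^sub>R g) - (a *\<^sub>R J h f + c *\<^sub>R J h g)) = 0"
proof -
  have "A (a *\<^sub>R J h f + c *\<^sub>R J h g) (a *\<^sub>R ((1/h) *\<^sub>R (f - J h f)) + c *\<^sub>R ((1/h) *\<^sub>R (g - J h g)))"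
    by (intro A_scale A_lin A_J) auto
  moreover have "a *\<^sub>R ((1/h) *\<^sub>R (f - J h f)) + c *\<^sub>R ((1/h) *\<^sub>R (g - J h g))
      = (1/h) *\<^sub>R ((a *\<^sub>R f + c *\<^sub>R g) - (a *\<^sub>R J h f + c *\<^sub>R J h g))"
    by (simp add: algebra_simps)
  ultimately have "H.N (a *\<^sub>R J h f + c *\<^sub>R J h g - J h (a *\<^sub>R f + c *\<^sub>R g)) = 0"
    by (intro J_unique) auto
  then show ?thesis by (subst H.N_commute) auto
qed

subsection \<open>Strong convergence of the resolvents\<close>

text \<open>For \<open>u = J h f\<close> the resolvent equation gives \<open>|f - u|\<^sup>2 = h Q (u, f - u)\<close>, and \<open>Q (u, f) - Q (u, u) \<le> Q (f, f)\<close>.\<close>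

lemma J_approx_D:
  assumes [simp]: "h > 0" "f \<in> D"
  shows "(H.N (J h f - f))\<^sup>2 \<le> h * Q f f"
proof -
  let ?u = "J h f"
  have [simp]: "?u \<in> D" by (simp add: J_D)
  have "ip (f - ?u) (f - ?u) = h * Q ?u (f - ?u)"
    using J_eq[of h f "f - ?u"] by (simp add: H.bil)
  also have "Q ?u (f - ?u) \<le> Q f f"
    using Q.nonneg[of "f - ?u"] Q.nonneg[of ?u] Q.nonneg[of f] by (simp add: Q.bil Q.sym[of ?u f])
  finally show ?thesis using assms(1) H.N_commute[of ?u f] by (simp add: H.N_sq mult_left_mono)
qed

lemma J_tendsto:
  assumes f [simp]: "f \<in> H" and e: "e > 0"
  shows "\<exists>d>0. \<forall>h. 0 < h \<and> h < d \<longrightarrow> H.N (J h f - f) < e"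
proof -
  obtain g where g [simp]: "g \<in> D" and fg: "H.N (f - g) < e/3" using dense[of f "e/3"] e by auto
  define d where "d = e\<^sup>2 / (9 * (Q g g + 1))"
  have Qp: "Q g g + 1 > 0" using Q.nonneg[of g] by (simp add: add_nonneg_pos)
  have "d > 0" using e Qp by (simp add: d_def)
  moreover have "H.N (J h f - f) < e" if h: "0 < h" "h < d" for h
  proof -
    have "(H.N (J h g - g))\<^sup>2 \<le> h * Q g g" using h by (intro J_approx_D) auto
    also have "\<dots> \<le> d * (Q g g + 1)" using h Q.nonneg[of g] by (intro mult_mono) auto
    also have "\<dots> = e\<^sup>2 / 9"
    proof -
      have "Q g g + 1 \<noteq> 0" using Qp by simp
      then show ?thesis unfolding d_def by (metis nonzero_mult_divide_mult_cancel_right times_divide_eq_left)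
    qed
    also have "\<dots> = (e/3)\<^sup>2" by (simp add: power_divide)
    finally have "H.N (J h g - g) \<le> e/3" by (rule power2_le_imp_le) (use e in simp)
    moreover have "H.N (J h f - f) \<le> H.N (J h f - J h g) + H.N (J h g - g) + H.N (g - f)"
      using H.N_triangle_diff[of "J h f" "J h g" f] H.N_triangle_diff[of "J h g" g f] h by simp
    ultimately show ?thesis using fg J_contraction_diff[of h f g] H.N_commute[of g f] h by simp
  qed
  ultimately show ?thesis by blast
qed

text \<open>\<open>dom2 c f\<close>: \<open>f\<close> is in the domain of the square of the operator, whose value at \<open>f\<close> has
  norm at most \<open>c\<close>.\<close>

definition dom2 :: "real \<Rightarrow> 'v \<Rightarrow> bool" where
  "dom2 c f \<longleftrightarrow> (\<exists>g k. A f g \<and> A g k \<and> H.N k \<le> c)"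

lemma dom2_H: "dom2 c f \<Longrightarrow> f \<in> H"
  by (auto simp: dom2_def A_HD)

lemma dom2_nonneg: "dom2 c f \<Longrightarrow> 0 \<le> c"
  unfolding dom2_def using order_trans[OF H.N_nonneg[OF A_H]] by blast

lemma dom2_J:
  assumes "h > 0" "dom2 c f"
  shows "dom2 c (J h f)"
proof -
  obtain g k where "A f g" "A g k" "H.N k \<le> c" using assms by (auto simp: dom2_def)
  then show ?thesis using assms(1)
    unfolding dom2_def by (intro exI[of _ "J h g"] exI[of _ "J h k"])
      (auto intro: A_J_commute order_trans[OF J_contraction] A_H)
qed

text \<open>Two resolvents regularise into the domain of the square of the operator, and for small \<open>h\<close> they hardly
move the vector.\<close>

lemma dom2_dense:
  assumes f [simp]: "f \<in> H" and e: "e > 0"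
  obtains g c where "dom2 c g" "H.N (f - g) < e"
proof -
  obtain d where d: "d > 0" "\<And>h. 0 < h \<and> h < d \<Longrightarrow> H.N (J h f - f) < e/2"
    using J_tendsto[of f "e/2"] e by auto
  define h where "h = d/2"
  have [simp]: "h > 0" and s: "H.N (J h f - f) < e/2" using d by (auto simp: h_def)
  let ?g = "J h (J h f)"
  have "A ?g (J h ((1/h) *\<^sub>R (f - J h f)))" by (intro A_J_commute A_J) auto
  moreover have "\<exists>k. A (J h ((1/h) *\<^sub>R (f - J h f))) k" using A_J[of h "(1/h) *\<^sub>R (f - J h f)"] by auto
  ultimately have "\<exists>c. dom2 c ?g" unfolding dom2_def by blast
  moreover have "H.N (f - ?g) < e"
  proof -
    have "H.N (f - ?g) = H.N (?g - f)" by (rule H.N_commute) auto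
    also have "\<dots> \<le> H.N (?g - J h f) + H.N (J h f - f)" by (rule H.N_triangle_diff) auto
    also have "\<dots> \<le> H.N (J h f - f) + H.N (J h f - f)" using J_contraction_diff[of h "J h f" f] by simp
    finally show ?thesis using s by simp
  qed
  ultimately show ?thesis using that by blast
qed

subsection \<open>Products of resolvents\<close>

text \<open>On vectors with \<open>f = (1 + b A) (1 + a A) v\<close> one has \<open>f = (1 + (a + b) A) v + a b A\<^sup>2 v\<close>, so
  replacing \<open>J a \<circ> J b\<close> by \<open>J (a + b)\<close> costs only a term of second order.\<close>

lemma J_J_approx:
  assumes [simp]: "a > 0" "b > 0" and f: "dom2 c f"
  shows "H.N (J a (J b f) - J (a + b) f) \<le> a * b * c"
proof -
  obtain g k where A: "A f g" "A g k" "H.N k \<le> c" using f by (auto simp: dom2_def)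
  have [simp]: "f \<in> H" "g \<in> H" "k \<in> H" using A by (auto intro: A_H A_HD)
  define u v g1 g' z where "u = J b f" and "v = J a u" and "g1 = J b g" and "g' = J a g1" and "z = J a (J b k)"
  note defs = u_def v_def g1_def g'_def z_def
  have [simp]: "u \<in> H" "v \<in> H" "g1 \<in> H" "g' \<in> H" "z \<in> H" by (auto simp: defs)
  have Avg: "A v g'" unfolding defs by (intro A_J_commute A) auto
  have Nz: "H.N z \<le> c"
    using J_contraction[of a "J b k"] J_contraction[of b k] A(3) by (simp add: z_def)
  have e1: "H.N (v - u + a *\<^sub>R g') = 0"
    unfolding v_def g'_def g1_def u_def by (intro J_diff_eq A_J_commute A) auto
  have e2: "H.N (u - f + b *\<^sub>R g1) = 0"
    unfolding u_def g1_def by (intro J_diff_eq A) auto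
  have e3: "H.N (g' - g1 + a *\<^sub>R z) = 0"
    unfolding g'_def g1_def z_def by (intro J_diff_eq A_J_commute A) auto
  \<comment> \<open>\<open>A v = ?x\<close> says that \<open>v\<close> is the resolvent with parameter \<open>a + b\<close> of \<open>f - a b z\<close>, where \<open>z\<close> represents \<open>A\<^sup>2 v\<close>\<close>
  let ?x = "(1/(a+b)) *\<^sub>R ((f - (a * b) *\<^sub>R z) - v)"
  have "g' - ?x = (1/(a+b)) *\<^sub>R ((v - u + a *\<^sub>R g') + (u - f + b *\<^sub>R g1) + b *\<^sub>R (g' - g1 + a *\<^sub>R z))"
  proof -
    have ab: "a + b \<noteq> 0" using add_pos_pos[OF assms(1,2)] by simp
    then have "(a + b) *\<^sub>R (g' - ?x) = (a + b) *\<^sub>R g' - ((f - (a * b) *\<^sub>R z) - v)"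
      by (simp only: scaleR_diff_right scaleR_scaleR) simp
    also have "\<dots> = (v - u + a *\<^sub>R g') + (u - f + b *\<^sub>R g1) + b *\<^sub>R (g' - g1 + a *\<^sub>R z)"
      by (simp add: scaleR_add_left scaleR_add_right scaleR_diff_right mult.commute)
    finally have "(1/(a+b)) *\<^sub>R ((a + b) *\<^sub>R (g' - ?x)) =
      (1/(a+b)) *\<^sub>R ((v - u + a *\<^sub>R g') + (u - f + b *\<^sub>R g1) + b *\<^sub>R (g' - g1 + a *\<^sub>R z))" by (rule arg_cong)
    then show ?thesis using ab by simp
  qed
  moreover have "H.N ((v - u + a *\<^sub>R g') + (u - f + b *\<^sub>R g1) + b *\<^sub>R (g' - g1 + a *\<^sub>R z)) = 0"
  proof -
    have "H.N ((v - u + a *\<^sub>R g') + (u - f + b *\<^sub>R g1) + b *\<^sub>R (g' - g1 + a *\<^sub>R z))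
      \<le> H.N (v - u + a *\<^sub>R g') + H.N (u - f + b *\<^sub>R g1) + H.N (b *\<^sub>R (g' - g1 + a *\<^sub>R z))"
      using H.N_triangle[of "v - u + a *\<^sub>R g'" "u - f + b *\<^sub>R g1"]
        H.N_triangle[of "(v - u + a *\<^sub>R g') + (u - f + b *\<^sub>R g1)" "b *\<^sub>R (g' - g1 + a *\<^sub>R z)"] by simp
    also have "\<dots> = 0" using e1 e2 e3 H.N_scale[of "g' - g1 + a *\<^sub>R z" b] by simp
    finally show ?thesis by (intro antisym H.N_nonneg) auto
  qed
  ultimately have "H.N (g' - ?x) = 0" using H.N_scale by simp
  then have "A v ?x" by (intro A_cong_value[OF Avg]) auto
  then have "H.N (v - J (a + b) f) \<le> H.N ((f - (a * b) *\<^sub>R z) - f)"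
    by (intro resolvent_contraction[where h="a + b"] A_J) (auto simp: add_pos_pos)
  also have "\<dots> = H.N (- ((a * b) *\<^sub>R z))" by simp
  also have "\<dots> = a * b * H.N z" by (simp only: H.N_neg H.N_scale \<open>z \<in> H\<close> H.scale_mem) (simp add: less_imp_le)
  also have "\<dots> \<le> a * b * c" using Nz by (intro mult_left_mono) (auto simp: less_imp_le)
  finally show ?thesis by (simp add: defs)
qed

definition P :: "nat \<Rightarrow> real \<Rightarrow> 'v \<Rightarrow> 'v" where "P n h = (J h ^^ n)"

lemma P_0 [simp]: "P 0 h f = f" and P_Suc: "P (Suc n) h f = J h (P n h f)"
  and P_Suc2: "P (Suc n) h f = P n h (J h f)" and P_add: "P (m + n) h f = P m h (P n h f)"
proof -
  show "P (Suc n) h f = P n h (J h f)" unfolding P_def by (subst funpow_Suc_right) simp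
qed (simp_all add: P_def funpow_add)

lemma P_H [simp]: "h > 0 \<Longrightarrow> f \<in> H \<Longrightarrow> P n h f \<in> H"
  by (induction n) (auto simp: P_Suc)

lemma P_contraction_diff: "h > 0 \<Longrightarrow> f \<in> H \<Longrightarrow> g \<in> H \<Longrightarrow> H.N (P n h f - P n h g) \<le> H.N (f - g)"
proof (induction n)
  case (Suc n)
  then show ?case using J_contraction_diff[of h "P n h f" "P n h g"] by (simp add: P_Suc)
qed simp

lemma P_contraction: "h > 0 \<Longrightarrow> f \<in> H \<Longrightarrow> H.N (P n h f) \<le> H.N f"
proof (induction n)
  case (Suc n)
  then show ?case using J_contraction[of h "P n h f"] by (simp add: P_Suc)
qed simp

lemma A_P_commute: "h > 0 \<Longrightarrow> A f g \<Longrightarrow> A (P n h f) (P n h g)"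
  by (induction n) (auto simp: P_Suc A_J_commute)

lemma P_lin:
  assumes [simp]: "h > 0" "f \<in> H" "g \<in> H"
  shows "H.N (P n h (a *\<^sub>R f + c *\<^sub>R g) - (a *\<^sub>R P n h f + c *\<^sub>R P n h g)) = 0"
proof (induction n)
  case (Suc n)
  let ?x = "P n h (a *\<^sub>R f + c *\<^sub>R g)" and ?y = "a *\<^sub>R P n h f + c *\<^sub>R P n h g"
  let ?z = "a *\<^sub>R J h (P n h f) + c *\<^sub>R J h (P n h g)"
  have "H.N (J h ?x - ?z) \<le> H.N (J h ?x - J h ?y) + H.N (J h ?y - ?z)"
    by (rule H.N_triangle_diff) auto
  also have "\<dots> \<le> 0 + 0"
    using J_contraction_diff[of h ?x ?y] J_lin[of h "P n h f" "P n h g" a c] Suc by simp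
  finally show ?case using H.N_nonneg[of "J h ?x - ?z"] by (simp add: P_Suc)
qed simp

lemma J_P_commute:
  assumes [simp]: "a > 0" "b > 0" "f \<in> H"
  shows "H.N (J a (P n b f) - P n b (J a f)) = 0"
proof (induction n)
  case (Suc n)
  have "H.N (J a (J b (P n b f)) - J b (P n b (J a f)))
      \<le> H.N (J a (J b (P n b f)) - J b (J a (P n b f))) + H.N (J b (J a (P n b f)) - J b (P n b (J a f)))"
    by (rule H.N_triangle_diff) auto
  also have "\<dots> \<le> 0 + H.N (J a (P n b f) - P n b (J a f))"
    using J_commute[of a b "P n b f"] J_contraction_diff[of b "J a (P n b f)" "P n b (J a f)"] by simp
  finally show ?case using Suc H.N_nonneg[of "J a (J b (P n b f)) - J b (P n b (J a f))"] by (simp add: P_Suc)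
qed simp

text \<open>The factors are merged pair by pair; contractivity keeps the errors from growing, so that they just add up.\<close>

lemma P_P_approx:
  assumes [simp]: "a > 0" "b > 0"
  shows "dom2 c f \<Longrightarrow> H.N (P n a (P n b f) - P n (a + b) f) \<le> n * (a * b * c)"
proof (induction n arbitrary: f)
  case (Suc n)
  have [simp]: "f \<in> H" "a + b > 0" using Suc.prems by (auto simp: dom2_H add_pos_pos)
  let ?L = "P n a (J a (P n b (J b f)))" and ?M1 = "P n a (P n b (J a (J b f)))"
  let ?M2 = "P n a (P n b (J (a + b) f))" and ?R = "P n (a + b) (J (a + b) f)"
  have "H.N (?L - ?R) \<le> H.N (?L - ?M1) + H.N (?M1 - ?M2) + H.N (?M2 - ?R)"
    using H.N_triangle_diff[of ?L ?M1 ?R] H.N_triangle_diff[of ?M1 ?M2 ?R] by simp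
  moreover have "H.N (?L - ?M1) \<le> 0"
    using P_contraction_diff[of a "J a (P n b (J b f))" "P n b (J a (J b f))" n] J_P_commute[of a b "J b f" n] by simp
  moreover have "H.N (?M1 - ?M2) \<le> a * b * c"
    using P_contraction_diff[of a "P n b (J a (J b f))" "P n b (J (a + b) f)" n]
      P_contraction_diff[of b "J a (J b f)" "J (a + b) f" n] J_J_approx[OF assms Suc.prems] by simp
  moreover have "H.N (?M2 - ?R) \<le> n * (a * b * c)"
    by (intro Suc.IH dom2_J Suc.prems) simp
  moreover have "n * (a * b * c) + a * b * c = real (Suc n) * (a * b * c)" by (simp add: algebra_simps)
  ultimately show ?case unfolding P_Suc2 by linarith
qed simp

lemma P_approx_id:
  assumes [simp]: "h > 0" and A: "A f g"
  shows "H.N (P n h f - f) \<le> n * h * H.N g"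
proof (induction n)
  case 0
  show ?case by (simp only: P_0 diff_self H.N_zero of_nat_0 mult_zero_left order_refl scaleR_zero_left add_0)
next
  case (Suc n)
  have [simp]: "f \<in> H" "g \<in> H" using A by (auto intro: A_H A_HD)
  have eq: "H.N (J h f - f) \<le> h * H.N g"
  proof -
    have "H.N (J h f - f) \<le> H.N (J h f - f + h *\<^sub>R J h g) + H.N (h *\<^sub>R J h g)"
      using H.N_minus_le[of "J h f - f + h *\<^sub>R J h g" "h *\<^sub>R J h g"] by simp
    also have "\<dots> = h * H.N (J h g)" using J_diff_eq[OF _ A, of h] H.N_scale[of "J h g" h] assms(1) by simp
    also have "\<dots> \<le> h * H.N g" using J_contraction[of h g] by simp
    finally show ?thesis .
  qed
  have "H.N (P (Suc n) h f - f) \<le> H.N (J h (P n h f) - J h f) + H.N (J h f - f)"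
    unfolding P_Suc by (rule H.N_triangle_diff) auto
  also have "\<dots> \<le> n * h * H.N g + h * H.N g"
    using J_contraction_diff[of h "P n h f" f] eq Suc by simp
  also have "\<dots> = real (Suc n) * h * H.N g" by (simp add: algebra_simps)
  finally show ?case .
qed

text \<open>Since \<open>J h - 1 = - h A J h\<close>, the vector \<open>P n h f - f\<close> is \<open>- h\<close> times the sum of the \<open>P j h g\<close> for
\<open>1 \<le> j \<le> n\<close>, each of which is close to \<open>g\<close>.\<close>

lemma P_difference_quotient:
  assumes [simp]: "h > 0" and A: "A f g"
  shows "(\<And>j. j \<le> n \<Longrightarrow> H.N (P j h g - g) \<le> d) \<Longrightarrow> H.N (P n h f - f + (n * h) *\<^sub>R g) \<le> n * h * d"
proof (induction n)
  case 0
  show ?case by (simp only: P_0 diff_self H.N_zero of_nat_0 mult_zero_left order_refl scaleR_zero_left add_0)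
next
  case (Suc n)
  have [simp]: "f \<in> H" "g \<in> H" using A by (auto intro: A_H A_HD)
  let ?x = "P n h f - f + (n * h) *\<^sub>R g" and ?y = "J h (P n h f) - P n h f + h *\<^sub>R J h (P n h g)"
    and ?z = "h *\<^sub>R (P (Suc n) h g - g)"
  have "P (Suc n) h f - f + (real (Suc n) * h) *\<^sub>R g = ?x + ?y - ?z"
    by (simp add: P_Suc algebra_simps)
  then have "H.N (P (Suc n) h f - f + (real (Suc n) * h) *\<^sub>R g) = H.N (?x + ?y - ?z)" by (rule arg_cong)
  also have "\<dots> \<le> H.N ?x + H.N ?y + H.N ?z"
    using H.N_minus_le[of "?x + ?y" ?z] H.N_triangle[of ?x ?y] by simp
  also have "\<dots> \<le> n * h * d + 0 + h * d"
  proof (intro add_mono)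
    show "H.N ?x \<le> n * h * d" by (rule Suc.IH, rule Suc.prems) simp
    show "H.N ?y \<le> 0" using J_diff_eq[OF assms(1) A_P_commute[OF assms(1) A, of n]] by simp
    show "H.N ?z \<le> h * d" using Suc.prems[of "Suc n"] H.N_scale[of "P (Suc n) h g - g" h] assms(1) by simp
  qed
  also have "\<dots> = real (Suc n) * h * d" by (simp add: algebra_simps)
  finally show ?case .
qed

subsection \<open>The semigroup\<close>

text \<open>The implicit Euler scheme with \<open>2\<^sup>k\<close> steps of equal length. Halving the steps replaces each \<open>J (a + a)\<close> by
\<open>J a \<circ> J a\<close>, which is the situation of \<open>P_P_approx\<close>.\<close>

definition dyad :: "nat \<Rightarrow> real \<Rightarrow> 'v \<Rightarrow> 'v" where
  "dyad k t = P (2 ^ k) (t / 2 ^ k)"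

lemma dyad_H [simp]: "t > 0 \<Longrightarrow> f \<in> H \<Longrightarrow> dyad k t f \<in> H"
  by (simp add: dyad_def)

lemma dyad_contraction_diff: "t > 0 \<Longrightarrow> f \<in> H \<Longrightarrow> g \<in> H \<Longrightarrow> H.N (dyad k t f - dyad k t g) \<le> H.N (f - g)"
  unfolding dyad_def by (rule P_contraction_diff) auto

lemma dyad_contraction: "t > 0 \<Longrightarrow> f \<in> H \<Longrightarrow> H.N (dyad k t f) \<le> H.N f"
  unfolding dyad_def by (rule P_contraction) auto

lemma dyad_step:
  assumes t: "t > 0" and f: "dom2 c f"
  shows "H.N (dyad (Suc k) t f - dyad k t f) \<le> t\<^sup>2 * c * (1/2) ^ k"
proof -
  define a where "a = t / 2 ^ Suc k"
  have a: "a > 0" "a + a = t / 2 ^ k" using t by (auto simp: a_def field_simps)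
  have "H.N (dyad (Suc k) t f - dyad k t f) \<le> real (2 ^ k) * (a * a * c)"
  proof -
    have "dyad (Suc k) t f = P (2 ^ k) a (P (2 ^ k) a f)"
      by (simp only: dyad_def a_def mult_2 power_Suc P_add)
    moreover have "dyad k t f = P (2 ^ k) (a + a) f" by (simp only: dyad_def a)
    ultimately show ?thesis using P_P_approx[OF a(1) a(1) f, of "2 ^ k"] by (simp only:)
  qed
  also have "\<dots> = (1/4) * (t\<^sup>2 * c * (1/2) ^ k)"
  proof -
    define x :: real where "x = 2 ^ k"
    have x: "x \<noteq> 0" "real (2 ^ k) = x" "2 ^ Suc k = 2 * x" "(1/2) ^ k = 1 / x"
      by (simp_all add: x_def power_one_over)
    show ?thesis unfolding a_def x(2-4) using x(1) by (simp add: power2_eq_square)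
  qed
  also have "\<dots> \<le> t\<^sup>2 * c * (1/2) ^ k"
    using dom2_nonneg[OF f] by simp
  finally show ?thesis .
qed

text \<open>On the domain of \<open>A\<^sup>2\<close> consecutive approximations differ by a geometrically decreasing amount; as all of them
are contractions, convergence extends to the closure of this domain.\<close>

lemma dyad_Cau:
  assumes t: "t > 0" and f: "f \<in> H"
  shows "H.Cau (\<lambda>k. dyad k t f)"
proof (rule H.CauI)
  fix e :: real assume "e > 0"
  then have e3: "e / 3 > 0" by simp
  obtain g c where g: "dom2 c g" and fg: "H.N (f - g) < e/3" by (rule dom2_dense[OF f e3])
  have gH [simp]: "g \<in> H" by (rule dom2_H[OF g])
  have "H.Cau (\<lambda>k. dyad k t g)"
    using dyad_step[OF t g] t dom2_nonneg[OF g] by (intro H.Cau_geometric[where C="t\<^sup>2 * c"]) auto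
  then obtain n where n: "\<forall>j\<ge>n. \<forall>k\<ge>n. H.N (dyad j t g - dyad k t g) < e/3"
    using e3 t H.Cau_N[of "\<lambda>k. dyad k t g"] dyad_H[OF t gH] by blast
  have "H.N (dyad j t f - dyad k t f) < e" if "j \<ge> n" "k \<ge> n" for j k
  proof -
    have "H.N (dyad j t f - dyad k t f)
        \<le> H.N (dyad j t f - dyad j t g) + H.N (dyad j t g - dyad k t g) + H.N (dyad k t g - dyad k t f)"
      using H.N_triangle_diff[of "dyad j t f" "dyad j t g" "dyad k t f"]
        H.N_triangle_diff[of "dyad j t g" "dyad k t g" "dyad k t f"] t f by simp
    then show ?thesis
      using dyad_contraction_diff[OF t f gH, of j] dyad_contraction_diff[OF t gH f, of k]
        H.N_commute[OF gH f] fg n[rule_format, OF that] by linarith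
  qed
  then show "\<exists>n. \<forall>j\<ge>n. \<forall>k\<ge>n. H.N (dyad j t f - dyad k t f) < e" by blast
qed (use t f in simp)

definition T :: "real \<Rightarrow> 'v \<Rightarrow> 'v" where
  "T t f = (SOME g. g \<in> H \<and> H.conv (\<lambda>k. dyad k t f) g)"

lemma T_conv_ex:
  assumes t: "t > 0" and f: "f \<in> H"
  shows "T t f \<in> H \<and> H.conv (\<lambda>k. dyad k t f) (T t f)"
proof -
  have "\<exists>g. g \<in> H \<and> H.conv (\<lambda>k. dyad k t f) g"
    using H.completeD[OF H_complete _ dyad_Cau[OF t f]] t f by auto
  from someI_ex[OF this] show ?thesis unfolding T_def .
qed

lemma T_H [simp]: "t > 0 \<Longrightarrow> f \<in> H \<Longrightarrow> T t f \<in> H"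
  and T_conv: "t > 0 \<Longrightarrow> f \<in> H \<Longrightarrow> H.conv (\<lambda>k. dyad k t f) (T t f)"
  by (rule conjunct1[OF T_conv_ex], assumption+) (rule conjunct2[OF T_conv_ex], assumption+)

lemma T_N_le:
  assumes t: "t > 0" and f: "f \<in> H" and g: "g \<in> H"
    and le: "\<And>k. H.N (dyad k t f - g) \<le> e k" and e: "e \<longlonglongrightarrow> c"
  shows "H.N (T t f - g) \<le> c"
proof (rule H.conv_N_le)
  show "H.conv (\<lambda>k. dyad k t f) (T t f)" by (rule T_conv[OF t f])
  show "H.conv (\<lambda>_. g) g" by (rule H.conv_const[OF g])
  show "H.N (dyad k t f - g) \<le> e k" for k by (rule le)
qed (use t f g e in simp_all)

lemma T_contraction_diff:
  assumes t: "t > 0" and f: "f \<in> H" and g: "g \<in> H"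
  shows "H.N (T t f - T t g) \<le> H.N (f - g)"
proof (rule H.conv_N_le)
  show "H.conv (\<lambda>k. dyad k t f) (T t f)" "H.conv (\<lambda>k. dyad k t g) (T t g)"
    by (rule T_conv[OF t f], rule T_conv[OF t g])
  show "H.N (dyad k t f - dyad k t g) \<le> H.N (f - g)" for k by (rule dyad_contraction_diff[OF t f g])
qed (use t f g in simp_all)

lemma T_contraction:
  assumes t: "t > 0" and f: "f \<in> H"
  shows "H.N (T t f) \<le> H.N f"
  using T_N_le[OF t f H.zero_mem, of "\<lambda>_. H.N f"] dyad_contraction[OF t f] by simp

lemma T_lin:
  assumes t: "t > 0" and f: "f \<in> H" and g: "g \<in> H"
  shows "H.N (T t (a *\<^sub>R f + c *\<^sub>R g) - (a *\<^sub>R T t f + c *\<^sub>R T t g)) = 0"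
proof -
  have "H.N (T t (a *\<^sub>R f + c *\<^sub>R g) - (a *\<^sub>R T t f + c *\<^sub>R T t g)) \<le> 0"
  proof (rule H.conv_N_le)
    show "H.conv (\<lambda>k. dyad k t (a *\<^sub>R f + c *\<^sub>R g)) (T t (a *\<^sub>R f + c *\<^sub>R g))"
      using t f g by (intro T_conv) auto
    show "H.conv (\<lambda>k. a *\<^sub>R dyad k t f + c *\<^sub>R dyad k t g) (a *\<^sub>R T t f + c *\<^sub>R T t g)"
      using t f g by (intro H.conv_add H.conv_scale T_conv) auto
    show "H.N (dyad k t (a *\<^sub>R f + c *\<^sub>R g) - (a *\<^sub>R dyad k t f + c *\<^sub>R dyad k t g)) \<le> 0" for k
      unfolding dyad_def using P_lin[OF _ f g, of "t / 2 ^ k" "2 ^ k" a c] t by simp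
  qed (use t f g in auto)
  then show ?thesis using t f g by simp
qed

text \<open>On the domain of \<open>A\<^sup>2\<close>, merging \<open>2\<^sup>k\<close> pairs of steps of lengths \<open>r / 2\<^sup>k\<close> and \<open>t / 2\<^sup>k\<close> costs
\<open>r t c / 2\<^sup>k\<close>, which tends to zero.\<close>

lemma T_semigroup:
  assumes r: "r > 0" and t: "t > 0" and f: "f \<in> H"
  shows "H.N (T (r + t) f - T r (T t f)) = 0"
proof -
  have rt: "r + t > 0" using r t by simp
  have dom: "H.N (T (r + t) g - T r (T t g)) \<le> 0" if g: "dom2 c g" for c g
  proof (rule H.conv_N_le)
    have gH [simp]: "g \<in> H" by (rule dom2_H[OF g])
    show "H.conv (\<lambda>k. dyad k (r + t) g) (T (r + t) g)" by (rule T_conv[OF rt gH])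
    show "H.conv (\<lambda>k. dyad k r (T t g)) (T r (T t g))" by (rule T_conv[OF r]) (use t in simp)
    show "dyad k (r + t) g \<in> H" "T (r + t) g \<in> H" "dyad k r (T t g) \<in> H" "T r (T t g) \<in> H" for k
      using r t rt by simp_all
    show "H.N (dyad k (r + t) g - dyad k r (T t g)) \<le> r * t * c * (1/2) ^ k + H.N (dyad k t g - T t g)" for k
    proof -
      have "H.N (dyad k r (dyad k t g) - dyad k (r + t) g) \<le> real (2 ^ k) * (r / 2 ^ k * (t / 2 ^ k) * c)"
        using P_P_approx[OF _ _ g, of "r / 2 ^ k" "t / 2 ^ k" "2 ^ k"] r t
        by (simp add: dyad_def add_divide_distrib)
      also have "\<dots> = r * t * c * (1/2) ^ k" by (simp add: power_one_over field_simps)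
      finally have 1: "H.N (dyad k r (dyad k t g) - dyad k (r + t) g) \<le> r * t * c * (1/2) ^ k" .
      have 2: "H.N (dyad k r (dyad k t g) - dyad k r (T t g)) \<le> H.N (dyad k t g - T t g)"
        using r t by (intro dyad_contraction_diff) auto
      have "H.N (dyad k (r + t) g - dyad k r (T t g))
         \<le> H.N (dyad k (r + t) g - dyad k r (dyad k t g)) + H.N (dyad k r (dyad k t g) - dyad k r (T t g))"
        using r t rt by (intro H.N_triangle_diff) auto
      moreover have "H.N (dyad k (r + t) g - dyad k r (dyad k t g)) = H.N (dyad k r (dyad k t g) - dyad k (r + t) g)"
        using r t rt by (intro H.N_commute) auto
      ultimately show ?thesis using 1 2 by linarith
    qed
    have "(\<lambda>k. H.N (dyad k t g - T t g)) \<longlonglongrightarrow> 0"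
      using T_conv[OF t gH] H.conv_N[of "\<lambda>k. dyad k t g" "T t g"] t by simp
    then have "(\<lambda>k. r * t * c * (1/2) ^ k + H.N (dyad k t g - T t g)) \<longlonglongrightarrow> r * t * c * 0 + 0"
      by (intro tendsto_intros LIMSEQ_power_zero) auto
    then show "(\<lambda>k. r * t * c * (1/2) ^ k + H.N (dyad k t g - T t g)) \<longlonglongrightarrow> 0" by simp
  qed
  have "H.N (T (r + t) f - T r (T t f)) \<le> e" if "e > 0" for e
  proof -
    have e2: "e/2 > 0" using that by simp
    obtain g c where g: "dom2 c g" and fg: "H.N (f - g) < e/2" by (rule dom2_dense[OF f e2])
    have gH [simp]: "g \<in> H" by (rule dom2_H[OF g])
    have "H.N (T (r + t) f - T r (T t f)) \<le> H.N (T (r + t) f - T (r + t) g)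
        + H.N (T (r + t) g - T r (T t g)) + H.N (T r (T t g) - T r (T t f))"
      using H.N_triangle_diff[of "T (r + t) f" "T (r + t) g" "T r (T t f)"]
        H.N_triangle_diff[of "T (r + t) g" "T r (T t g)" "T r (T t f)"] r t rt f by simp
    moreover have "H.N (T (r + t) f - T (r + t) g) \<le> H.N (f - g)" by (rule T_contraction_diff[OF rt f gH])
    moreover have "H.N (T r (T t g) - T r (T t f)) \<le> H.N (T t g - T t f)"
      using r t f by (intro T_contraction_diff) auto
    moreover have "H.N (T t g - T t f) \<le> H.N (g - f)" by (rule T_contraction_diff[OF t gH f])
    ultimately show ?thesis using dom[OF g] H.N_commute[OF gH f] fg by linarith
  qed
  then have "H.N (T (r + t) f - T r (T t f)) \<le> 0" by (rule field_le_epsilon[where y=0, simplified])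
  then show ?thesis using r t rt f by simp
qed

lemma T_approx_id:
  assumes t: "t > 0" and A: "A f g"
  shows "H.N (T t f - f) \<le> t * H.N g"
proof (rule T_N_le[OF t _ _ _ tendsto_const])
  show "H.N (dyad k t f - f) \<le> t * H.N g" for k
    using P_approx_id[OF _ A, of "t / 2 ^ k" "2 ^ k"] t by (simp add: dyad_def)
qed (use A A_HD in auto)

lemma T_strong_continuity:
  assumes f: "f \<in> H"
  shows "((\<lambda>t. H.N (T t f - f)) \<longlongrightarrow> 0) (at_right 0)"
proof (rule tendstoI)
  fix e :: real assume "e > 0"
  then have e3: "e/3 > 0" by simp
  obtain g c where g: "dom2 c g" and fg: "H.N (f - g) < e/3" by (rule dom2_dense[OF f e3])
  then obtain k where k: "A g k" by (auto simp: dom2_def)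
  have [simp]: "g \<in> H" "k \<in> H" by (rule A_HD[OF k], rule A_H[OF k])
  define d where "d = e / (3 * (H.N k + 1))"
  have kp: "H.N k + 1 > 0" using H.N_nonneg[OF \<open>k \<in> H\<close>] by linarith
  have "d > 0" using e3 kp by (simp add: d_def)
  have "dist (H.N (T t f - f)) 0 < e" if t: "0 < t" "t < d" for t
  proof -
    have "H.N (T t f - f) \<le> H.N (T t f - T t g) + H.N (T t g - g) + H.N (g - f)"
      using H.N_triangle_diff[of "T t f" "T t g" f] H.N_triangle_diff[of "T t g" g f] t f by simp
    moreover have "t * H.N k \<le> d * (H.N k + 1)" using t \<open>d > 0\<close> by (intro mult_mono) auto
    moreover have "d * (H.N k + 1) = e/3" using less_imp_neq[OF kp] by (simp add: d_def divide_simps)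
    ultimately have "H.N (T t f - f) < e"
      using T_contraction_diff[OF t(1) f \<open>g \<in> H\<close>] T_approx_id[OF t(1) k] H.N_commute[OF \<open>g \<in> H\<close> f] fg
      by linarith
    then show ?thesis using t f by simp
  qed
  then show "\<forall>\<^sub>F t in at_right 0. dist (H.N (T t f - f)) 0 < e"
    unfolding eventually_at_right_field using \<open>d > 0\<close> by blast
qed

text \<open>The estimate \<open>P_difference_quotient\<close> is uniform in the number of steps, as soon as all intermediate
\<open>P j h g\<close> with \<open>j h \<le> t\<close> are close to \<open>g\<close>. This holds for small \<open>t\<close> because \<open>g\<close> is approximated by
an element \<open>g'\<close> of the domain of the operator, for which \<open>P_approx_id\<close> gives a rate.\<close>

lemma T_difference_quotient:
  assumes A: "A f g"
  shows "((\<lambda>t. H.N ((1/t) *\<^sub>R (T t f - f) + g)) \<longlongrightarrow> 0) (at_right 0)"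
proof (rule tendstoI)
  fix e :: real assume "e > 0"
  then have e4: "e/4 > 0" by simp
  have [simp]: "f \<in> H" "g \<in> H" by (rule A_HD[OF A], rule A_H[OF A])
  obtain g' c where g': "dom2 c g'" and gg: "H.N (g - g') < e/4" by (rule dom2_dense[OF \<open>g \<in> H\<close> e4])
  then obtain k where k: "A g' k" by (auto simp: dom2_def)
  have [simp]: "g' \<in> H" "k \<in> H" by (rule A_HD[OF k], rule A_H[OF k])
  define d where "d = e / (4 * (H.N k + 1))"
  have kp: "H.N k + 1 > 0" using H.N_nonneg[OF \<open>k \<in> H\<close>] by linarith
  have "d > 0" using e4 kp by (simp add: d_def)
  have "dist (H.N ((1/t) *\<^sub>R (T t f - f) + g)) 0 < e" if t: "0 < t" "t < d" for t
  proof -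
    have "t * H.N k \<le> d * (H.N k + 1)" using t \<open>d > 0\<close> by (intro mult_mono) auto
    moreover have "d * (H.N k + 1) = e/4" using less_imp_neq[OF kp] by (simp add: d_def divide_simps)
    ultimately have tk: "t * H.N k \<le> e/4" by simp
    have dq: "H.N (dyad m t f - (f - t *\<^sub>R g)) \<le> t * (3 * e / 4)" for m
    proof -
      define h where "h = t / 2 ^ m"
      have h: "h > 0" "2 ^ m * h = t" using t by (auto simp: h_def)
      have "H.N (P j h g - g) \<le> 3 * e / 4" if "j \<le> 2 ^ m" for j
      proof -
        have "H.N (P j h g - g) \<le> H.N (P j h g - P j h g') + H.N (P j h g' - g') + H.N (g' - g)"
          using H.N_triangle_diff[of "P j h g" "P j h g'" g] H.N_triangle_diff[of "P j h g'" g' g] h by simp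
        moreover have "real j * h * H.N k \<le> t * H.N k"
        proof -
          have "real j \<le> 2 ^ m" using that by (metis of_nat_le_iff of_nat_numeral of_nat_power)
          then have "real j * h \<le> 2 ^ m * h" using h by (intro mult_right_mono) auto
          then show ?thesis using h by (intro mult_right_mono) auto
        qed
        ultimately show ?thesis
          using P_contraction_diff[OF h(1) \<open>g \<in> H\<close> \<open>g' \<in> H\<close>, of j] P_approx_id[OF h(1) k, of j]
            H.N_commute[OF \<open>g \<in> H\<close> \<open>g' \<in> H\<close>] gg tk by linarith
      qed
      then have "H.N (P (2 ^ m) h f - f + (real (2 ^ m) * h) *\<^sub>R g) \<le> real (2 ^ m) * h * (3 * e / 4)"
        by (rule P_difference_quotient[OF h(1) A])
      then show ?thesis using h by (simp add: dyad_def h_def algebra_simps)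
    qed
    have "H.N (T t f - (f - t *\<^sub>R g)) \<le> t * (3 * e / 4)"
      by (rule T_N_le[OF t(1) _ _ dq tendsto_const]) auto
    moreover have "(1/t) *\<^sub>R (T t f - f) + g = (1/t) *\<^sub>R (T t f - (f - t *\<^sub>R g))"
      using t by (simp add: scaleR_diff_right)
    moreover have "H.N ((1/t) *\<^sub>R (T t f - (f - t *\<^sub>R g))) = \<bar>1/t\<bar> * H.N (T t f - (f - t *\<^sub>R g))"
      using t by (intro H.N_scale) auto
    ultimately have "H.N ((1/t) *\<^sub>R (T t f - f) + g) \<le> (1/t) * (t * (3 * e / 4))"
      using t by (simp only: abs_of_pos zero_less_divide_1_iff) (intro mult_left_mono, auto)
    also have "\<dots> < e" using t \<open>e > 0\<close> by simp
    finally show ?thesis using t by simp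
  qed
  then show "\<forall>\<^sub>F t in at_right 0. dist (H.N ((1/t) *\<^sub>R (T t f - f) + g)) 0 < e"
    unfolding eventually_at_right_field using \<open>d > 0\<close> by blast
qed

text \<open>The generator of a contraction semigroup is dissipative, hence cannot properly extend \<open>- A\<close>, as \<open>1 + A\<close>
is onto: if the generator maps \<open>f\<close> to \<open>h\<close>, solve \<open>(1 + A) u = f - h\<close>. Then the generator maps \<open>w = f - u\<close> to
\<open>w\<close> itself, which forces \<open>w = 0\<close>.\<close>

lemma generator_imp_A:
  assumes f: "f \<in> H" and h: "h \<in> H"
    and lim: "((\<lambda>t. H.N ((1/t) *\<^sub>R (T t f - f) - h)) \<longlongrightarrow> 0) (at_right 0)"
  shows "A f (- h)"
proof -
  define u where "u = J 1 (f - h)"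
  define w where "w = f - u"
  have [simp]: "u \<in> H" using f h by (simp add: u_def)
  have wH [simp]: "w \<in> H" using f by (simp add: w_def)
  have Au: "A u (w - h)" using A_J[of 1 "f - h"] f h by (simp add: u_def w_def algebra_simps)
  have "((\<lambda>t. H.N ((1/t) *\<^sub>R (T t f - f) - h) + H.N ((1/t) *\<^sub>R (T t u - u) + (w - h))) \<longlongrightarrow> 0 + 0) (at_right 0)"
    by (intro tendsto_add lim T_difference_quotient[OF Au])
  then have lim2: "((\<lambda>t. (H.N ((1/t) *\<^sub>R (T t f - f) - h) + H.N ((1/t) *\<^sub>R (T t u - u) + (w - h))) * H.N w)
      \<longlongrightarrow> 0) (at_right 0)"
    using tendsto_mult_left_zero by fastforce
  have "ip w w \<le> (H.N ((1/t) *\<^sub>R (T t f - f) - h) + H.N ((1/t) *\<^sub>R (T t u - u) + (w - h))) * H.N w"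
    if t: "t > 0" for t
  proof -
    let ?a = "(1/t) *\<^sub>R (T t f - f) - h" and ?b = "(1/t) *\<^sub>R (T t u - u) + (w - h)"
    let ?q = "(1/t) *\<^sub>R (T t w - w)" and ?n = "T t w - (T t f - T t u)"
    have n0: "H.N ?n = 0" using T_lin[OF t f \<open>u \<in> H\<close>, of 1 "-1"] by (simp add: w_def)
    have qle: "ip ?q w \<le> 0"
    proof -
      have "ip (T t w) w \<le> H.N w * H.N w"
        using H.Cauchy_Schwarz[of "T t w" w] mult_right_mono[OF T_contraction[OF t wH] H.N_nonneg[OF wH]] t
        by (simp add: abs_le_iff)
      also have "\<dots> = ip w w" using H.N_sq[OF wH] by (simp add: power2_eq_square)
      finally show ?thesis using t by (simp add: H.bil divide_le_0_iff mult_le_0_iff)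
    qed
    have "w = ?q - (?a - ?b) - (1/t) *\<^sub>R ?n"
      using t by (simp add: w_def scaleR_diff_right)
    then have "ip w w = ip (?q - (?a - ?b) - (1/t) *\<^sub>R ?n) w" by (rule arg_cong)
    also have "\<dots> = ip ?q w - ip (?a - ?b) w - (1/t) * ip ?n w"
      using t f h by (simp only: H.diff_left H.scale_left H.diff_mem H.add_mem H.scale_mem T_H \<open>u \<in> H\<close> wH)
    also have "\<dots> \<le> \<bar>ip (?a - ?b) w\<bar>" using qle ip_null[OF _ n0 wH] t f by simp
    also have "\<dots> \<le> H.N (?a - ?b) * H.N w" using t f h by (intro H.Cauchy_Schwarz) auto
    also have "\<dots> \<le> (H.N ?a + H.N ?b) * H.N w"
      using t f h by (intro mult_right_mono H.N_minus_le) auto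
    finally show ?thesis .
  qed
  then have "ip w w \<le> 0"
    by (intro tendsto_le[OF _ lim2 tendsto_const]) (auto simp: eventually_at_right_field intro!: exI[of _ 1])
  then have "ip w w = 0" using H.nonneg[OF wH] by simp
  then have w0: "H.N w = 0" by (simp add: H.N_def)
  have "A f (w - h)" using w0 H.N_commute[of f u] f by (intro A_cong_arg[OF Au]) (auto simp: w_def)
  then show ?thesis
  proof (rule A_cong_value)
    show "H.N (w - h - - h) = 0" using w0 by simp
  qed (use h in auto)
qed

text \<open>By the Cauchy--Schwarz inequality a vector of energy zero is in the kernel of \<open>A\<close>.\<close>

lemma T_fixed:
  assumes t: "t > 0" and e: "e \<in> D" "Q e e = 0"
  shows "H.N (T t e - e) = 0"
proof -
  have "Q e v = 0" if "v \<in> D" for v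
    using Q.Cauchy_Schwarz_sq[OF e(1) that] e by simp
  then have "A e 0" using e by (auto simp: A_def)
  from T_approx_id[OF t this] show ?thesis using t e by simp
qed

subsection \<open>Lower semicontinuity\<close>

text \<open>With \<open>w = f - J h f\<close> and \<open>w' = f - J h' f\<close> the claim is \<open>Q (J h f, J h' f - J h f) \<ge> 0\<close>, that is,
\<open>ip w w' \<le> ip w w\<close>. It follows from \<open>|w'| \<le> |w|\<close>, which is extracted from the nonnegativity of the energy of
the difference of the two resolvents.\<close>

lemma J_form_diff:
  assumes h: "0 < h'" "h' \<le> h" and f: "f \<in> H"
  shows "Q (J h f - J h' f) (J h f - J h' f) \<le> Q (J h' f) (J h' f) - Q (J h f) (J h f)"
proof -
  have h0: "h > 0" using h by simp
  define u u' w w' where "u = J h f" and "u' = J h' f" and "w = f - u" and "w' = f - u'"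
  note defs = u_def u'_def w_def w'_def
  have uD [simp]: "u \<in> D" "u' \<in> D" using J_D[OF h0 f] J_D[OF h(1) f] by (auto simp: defs)
  have [simp]: "w \<in> H" "w' \<in> H" using f h0 h by (auto simp: defs)
  have Qu: "Q u v = ip w v / h" and Qu': "Q u' v = ip w' v / h'" if "v \<in> D" for v
    using A_eq[OF A_J[OF h0 f] that] A_eq[OF A_J[OF h(1) f] that] f that h0 h
    by (simp_all add: H.bil defs)
  have uw: "u - u' = w' - w" by (simp add: defs)
  define x y where "x = H.N w" and "y = H.N w'"
  have xy: "x \<ge> 0" "y \<ge> 0" "x\<^sup>2 = ip w w" "y\<^sup>2 = ip w' w'" "ip w w' \<le> x * y" "ip w w' \<le> y * x"
    using H.Cauchy_Schwarz[of w w'] by (auto simp: x_def y_def H.N_sq mult.commute)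
  have "0 \<le> Q (u - u') (u - u')" by (simp add: Q.nonneg)
  also have "\<dots> = ip w (w' - w) / h - ip w' (w' - w) / h'"
    by (simp add: Q.diff_left Qu Qu' uw[symmetric])
  also have "\<dots> = ip w w' / h - x\<^sup>2 / h - y\<^sup>2 / h' + ip w w' / h'"
    by (simp add: H.bil xy H.sym[of w' w] diff_divide_distrib)
  also have "\<dots> \<le> x * y / h - x\<^sup>2 / h - y\<^sup>2 / h' + x * y / h'"
    using xy h h0 by (intro add_mono diff_mono divide_right_mono) auto
  also have "\<dots> = (y - x) * (x / h - y / h')"
    using h h0 by (simp add: field_simps power2_eq_square)
  finally have prod: "0 \<le> (y - x) * (x / h - y / h')" .
  have "y \<le> x"
  proof (rule ccontr)
    assume "\<not> y \<le> x"
    then have yx: "y > x" by simp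
    have "x / h < y / h'"
    proof -
      have "x / h < y / h" using yx h0 by (simp add: divide_strict_right_mono)
      also have "\<dots> \<le> y / h'" using h xy by (intro divide_left_mono) auto
      finally show ?thesis .
    qed
    then have "(y - x) * (x / h - y / h') < 0" using yx by (intro mult_pos_neg) auto
    then show False using prod by simp
  qed
  then have "ip w w' \<le> ip w w"
    using xy mult_left_mono[of y x x] by (simp add: power2_eq_square)
  moreover have "Q u (u' - u) = (ip w w - ip w w') / h"
  proof -
    have "Q u (u' - u) = ip w (w - w') / h" using Qu[of "u' - u"] uw by (simp add: algebra_simps w_def w'_def)
    then show ?thesis by (simp add: H.bil)
  qed
  moreover have "0 \<le> (ip w w - ip w w') / h" if "ip w w' \<le> ip w w"
    using that h0 by (intro divide_nonneg_pos) auto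
  ultimately have "Q u u \<le> Q u u'" using Q.diff_right[OF uD(2) uD(1) uD(1)] by linarith
  then have "Q (u - u') (u - u') \<le> Q u' u' - Q u u" by (simp add: Q.bil Q.sym[of u' u])
  then show ?thesis by (simp add: defs)
qed

text \<open>The energies of the resolvents \<open>J h f\<close> are bounded by the bound \<open>C\<close> for the approximating vectors, because
\<open>Q (J h f, fk)\<close> converges to \<open>ip (f - J h f) f / h\<close>. By \<open>J_form_diff\<close> they increase as \<open>h\<close> decreases, and the
energy of a difference is at most the difference of the energies; so the resolvents are a Cauchy sequence in
the form norm, with limit \<open>f\<close>.\<close>

lemma lower_semicontinuity:
  assumes fk: "\<And>k. fk k \<in> D" and f: "f \<in> H" and lim: "H.conv fk f"
    and bound: "\<And>k. Q (fk k) (fk k) \<le> c k" and c: "c \<longlonglongrightarrow> C"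
  shows "f \<in> D \<and> Q f f \<le> C"
proof -
  have C0: "C \<ge> 0"
  proof (rule LIMSEQ_le_const[OF c], intro exI allI impI)
    show "0 \<le> c k" for k using Q.nonneg[OF fk, of k] bound[of k] by linarith
  qed
  have bd: "Q (J h f) (J h f) \<le> C" if h: "h > 0" for h
  proof -
    let ?u = "J h f"
    have uD: "?u \<in> D" by (rule J_D[OF h f])
    have uf: "?u \<in> H" "f - ?u \<in> H" using h f by auto
    have Qv: "Q ?u v = ip (f - ?u) v / h" if "v \<in> D" for v
      using A_eq[OF A_J[OF h f] that] h f that by (simp add: H.bil)
    have "ip (f - ?u) f / h \<le> Q.N ?u * sqrt C"
    proof (rule LIMSEQ_le)
      show "(\<lambda>k. ip (f - ?u) (fk k) / h) \<longlonglongrightarrow> ip (f - ?u) f / h"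
        by (rule tendsto_divide[OF H.conv_tendsto_b[OF _ uf(2) H.conv_const[OF uf(2)] _ f lim] tendsto_const])
          (use h uf fk in auto)
      show "(\<lambda>k. Q.N ?u * sqrt (c k)) \<longlonglongrightarrow> Q.N ?u * sqrt C"
        by (intro tendsto_intros c)
      have "ip (f - ?u) (fk k) / h \<le> Q.N ?u * sqrt (c k)" for k
      proof -
        have "ip (f - ?u) (fk k) / h \<le> Q.N ?u * Q.N (fk k)"
          using abs_le_D1[OF Q.Cauchy_Schwarz[OF uD fk, of k]] Qv[OF fk, of k] by simp
        also have "\<dots> \<le> Q.N ?u * sqrt (c k)"
          using real_sqrt_le_mono[OF bound, of k] Q.N_nonneg[OF uD] unfolding Q.N_def by (rule mult_left_mono)
        finally show ?thesis .
      qed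
      then show "\<exists>n. \<forall>k\<ge>n. ip (f - ?u) (fk k) / h \<le> Q.N ?u * sqrt (c k)" by blast
    qed
    moreover have "Q ?u ?u = ip (f - ?u) f / h - ip (f - ?u) (f - ?u) / h"
      using Qv[OF uD] uf f by (simp add: H.diff_right diff_divide_distrib)
    moreover have "0 \<le> ip (f - ?u) (f - ?u) / h" using h H.nonneg[OF uf(2)] by simp
    ultimately have "(Q.N ?u)\<^sup>2 \<le> Q.N ?u * sqrt C" using Q.N_sq[OF uD] by simp
    then have "Q.N ?u \<le> sqrt C"
      using Q.N_nonneg[OF uD] C0 by (cases "Q.N ?u = 0") (auto simp: power2_eq_square)
    then show ?thesis by (simp add: Q.N_def)
  qed
  define u where "u k = J (1 / real (Suc k)) f" for k
  have uD: "u k \<in> D" for k unfolding u_def by (rule J_D[OF _ f]) simp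
  have diff: "Q (u k - u j) (u k - u j) \<le> Q (u j) (u j) - Q (u k) (u k)" if "k \<le> j" for j k
    unfolding u_def using that by (intro J_form_diff f) (auto simp: frac_le)
  have "incseq (\<lambda>k. Q (u k) (u k))"
  proof (rule monoI)
    show "Q (u k) (u k) \<le> Q (u j) (u j)" if "k \<le> j" for k j
      using diff[OF that] Q.nonneg[OF Q.diff_mem[OF uD uD], of k j] by linarith
  qed
  moreover have uC: "Q (u k) (u k) \<le> C" for k unfolding u_def by (rule bd) simp
  ultimately obtain L where L: "(\<lambda>k. Q (u k) (u k)) \<longlonglongrightarrow> L" "\<And>k. Q (u k) (u k) \<le> L"
    using incseq_convergent[of "\<lambda>k. Q (u k) (u k)" C] by blast
  have LC: "L \<le> C" using L(1) uC by (intro LIMSEQ_le_const2) auto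
  have Cau: "Q.Cau u"
    unfolding Q.Cau_def
  proof (intro allI impI)
    fix e :: real assume "e > 0"
    then have "\<forall>\<^sub>F k in sequentially. L - e < Q (u k) (u k)" using L(1) by (intro order_tendstoD) auto
    then obtain n where n: "\<And>k. k \<ge> n \<Longrightarrow> L - e < Q (u k) (u k)" by (auto simp: eventually_sequentially)
    have "Q (u j - u k) (u j - u k) < e" if "j \<ge> n" "k \<ge> n" for j k
    proof (cases "j \<le> k")
      case True
      then show ?thesis using diff[OF True] n[OF that(1)] L(2)[of k] by simp
    next
      case False
      have "Q (u j - u k) (u j - u k) = Q (u k - u j) (u k - u j)"
        by (simp add: Q.bil uD)
      then show ?thesis using diff[of k j] False n[OF that(2)] L(2)[of j] by simp
    qed
    then show "\<exists>n. \<forall>j\<ge>n. \<forall>k\<ge>n. Q (u j - u k) (u j - u k) < e" by blast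
  qed
  have conv: "H.conv u f"
  proof (subst H.conv_N)
    show "(\<lambda>k. H.N (u k - f)) \<longlonglongrightarrow> 0"
    proof (rule LIMSEQ_I)
      fix e :: real assume "e > 0"
      then obtain d where d: "d > 0" "\<And>h. 0 < h \<and> h < d \<Longrightarrow> H.N (J h f - f) < e"
        using J_tendsto[OF f] by blast
      obtain n where n: "inverse (real (Suc n)) < d" using reals_Archimedean[OF d(1)] by blast
      have "norm (H.N (u k - f) - 0) < e" if "k \<ge> n" for k
      proof -
        have "1 / real (Suc k) \<le> 1 / real (Suc n)" using that by (simp add: frac_le)
        then have "1 / real (Suc k) < d" using n by (simp add: inverse_eq_divide)
        then have "H.N (u k - f) < e" unfolding u_def by (intro d(2)) simp
        then show ?thesis using D_H[OF uD, of k] f by simp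
      qed
      then show "\<exists>n. \<forall>k\<ge>n. norm (H.N (u k - f) - 0) < e" by blast
    qed
  qed (use uD f in auto)
  have "H.Cau u" by (rule H.conv_imp_Cau[OF _ f conv]) (use uD in auto)
  then obtain g where g: "g \<in> D" "H.conv u g" "Q.conv u g" using D_complete[OF uD _ Cau] by blast
  have gf: "H.N (g - f) = 0" using conv g(1,2) f uD by (intro H.conv_unique[of u]) auto
  have fD: "f \<in> D" by (rule D_cong[OF g(1) f gf])
  have "(\<lambda>k. Q (u k) (u k)) \<longlonglongrightarrow> Q g g" by (intro Q.conv_tendsto_b uD g)
  then have "Q g g \<le> C" using LIMSEQ_unique[OF L(1)] LC by auto
  moreover have "Q f f = Q g g"
    using Q_null[of "g - f" g] Q_null[of "g - f" f] gf f g(1) fD by (simp add: Q.bil Q.sym[of f g])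
  ultimately show ?thesis using fD by simp
qed

end

section \<open>The closure of a closable form\<close>

locale closable_form =
  H: semi_inner H ip + Q: semi_inner D Q
  for H :: "'v::real_vector set" and ip :: "'v \<Rightarrow> 'v \<Rightarrow> real"
    and D :: "'v set" and Q :: "'v \<Rightarrow> 'v \<Rightarrow> real" +
  assumes H_complete: "H.is_complete"
    and D_sub: "D \<subseteq> H"
    and dense: "\<And>f e. f \<in> H \<Longrightarrow> e > 0 \<Longrightarrow> \<exists>g\<in>D. H.N (f - g) < e"
    and closable: "\<And>u. (\<And>k. u k \<in> D) \<Longrightarrow> Q.Cau u \<Longrightarrow> H.conv u 0
                       \<Longrightarrow> (\<lambda>k. Q (u k) (u k)) \<longlonglongrightarrow> 0"
begin

lemma D_H [simp]: "f \<in> D \<Longrightarrow> f \<in> H"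
  using D_sub by blast

definition approx :: "(nat \<Rightarrow> 'v) \<Rightarrow> 'v \<Rightarrow> bool" where
  "approx u f \<longleftrightarrow> (\<forall>k. u k \<in> D) \<and> Q.Cau u \<and> H.conv u f"

definition cdom :: "'v set" where "cdom = {f \<in> H. \<exists>u. approx u f}"

definition cform :: "'v \<Rightarrow> 'v \<Rightarrow> real" where
  "cform f g = (THE c. \<forall>u v. approx u f \<and> approx v g \<longrightarrow> (\<lambda>k. Q (u k) (v k)) \<longlonglongrightarrow> c)"

lemma approxD: assumes "approx u f" shows approx_D: "u k \<in> D" and approx_H: "u k \<in> H"
    and approx_Cau: "Q.Cau u" and approx_conv: "H.conv u f"
  using assms D_sub by (auto simp: approx_def)

lemma cdom_H [simp]: "f \<in> cdom \<Longrightarrow> f \<in> H"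
  by (simp add: cdom_def)

lemma approx_add:
  assumes f: "f \<in> H" "approx u f" and g: "g \<in> H" "approx v g"
  shows "approx (\<lambda>k. u k + v k) (f + g)"
  unfolding approx_def using approxD[OF f(2)] approxD[OF g(2)] f(1) g(1)
  by (auto intro!: Q.Cau_add H.conv_add)

lemma approx_scale:
  assumes f: "f \<in> H" "approx u f"
  shows "approx (\<lambda>k. c *\<^sub>R u k) (c *\<^sub>R f)"
  unfolding approx_def using approxD[OF f(2)] f(1)
  by (auto intro!: Q.Cau_scale H.conv_scale)

lemma approx_diff:
  assumes f: "f \<in> H" "approx u f" and g: "g \<in> H" "approx v g"
  shows "approx (\<lambda>k. u k - v k) (f - g)"
  using approx_add[OF f H.scale_mem[OF g(1)] approx_scale[OF g], of "-1"] by simp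

lemma approx_const: "f \<in> D \<Longrightarrow> approx (\<lambda>_. f) f"
  by (auto simp: approx_def Q.Cau_def H.conv_const)

lemma cdomI: "f \<in> H \<Longrightarrow> approx u f \<Longrightarrow> f \<in> cdom"
  unfolding cdom_def by blast

lemma D_cdom: "f \<in> D \<Longrightarrow> f \<in> cdom"
  by (rule cdomI[OF D_H approx_const])

lemma approx_same_limit:
  assumes f: "f \<in> H" "approx u f" "approx u' f"
  shows "(\<lambda>k. Q.N (u k - u' k)) \<longlonglongrightarrow> 0"
proof -
  have d: "approx (\<lambda>k. u k - u' k) 0" using approx_diff[OF f(1,2) f(1,3)] by simp
  have "(\<lambda>k. Q (u k - u' k) (u k - u' k)) \<longlonglongrightarrow> 0"
    by (rule closable[OF approx_D[OF d] approx_Cau[OF d] approx_conv[OF d]])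
  then show ?thesis unfolding Q.N_def using tendsto_real_sqrt by fastforce
qed

text \<open>By closability two approximating sequences of the same vector have energy distance tending to zero.\<close>

lemma cform_unique:
  assumes f: "f \<in> H" "approx u f" "approx u' f" and g: "g \<in> H" "approx v g" "approx v' g"
    and lim: "(\<lambda>k. Q (u k) (v k)) \<longlonglongrightarrow> c"
  shows "(\<lambda>k. Q (u' k) (v' k)) \<longlonglongrightarrow> c"
proof -
  obtain C where C: "C \<ge> 0" "\<And>k. Q.N (u k) \<le> C"
    by (rule Q.Cau_bounded[OF approx_D[OF f(2)] approx_Cau[OF f(2)]]) blast
  obtain C' where C': "C' \<ge> 0" "\<And>k. Q.N (v' k) \<le> C'"
    by (rule Q.Cau_bounded[OF approx_D[OF g(3)] approx_Cau[OF g(3)]]) blast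
  have le: "norm (Q (u k) (v k) - Q (u' k) (v' k)) \<le> C * Q.N (v k - v' k) + Q.N (u k - u' k) * C'" for k
  proof -
    note [simp] = approx_D[OF f(2)] approx_D[OF f(3)] approx_D[OF g(2)] approx_D[OF g(3)]
    have "Q (u k) (v k) - Q (u' k) (v' k) = Q (u k) (v k - v' k) + Q (u k - u' k) (v' k)"
      by (simp add: Q.bil)
    then have "norm (Q (u k) (v k) - Q (u' k) (v' k)) \<le> \<bar>Q (u k) (v k - v' k)\<bar> + \<bar>Q (u k - u' k) (v' k)\<bar>"
      by simp
    also have "\<dots> \<le> Q.N (u k) * Q.N (v k - v' k) + Q.N (u k - u' k) * Q.N (v' k)"
      by (intro add_mono Q.Cauchy_Schwarz) auto
    also have "\<dots> \<le> C * Q.N (v k - v' k) + Q.N (u k - u' k) * C'"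
      using C C' by (intro add_mono mult_mono) auto
    finally show ?thesis .
  qed
  have "(\<lambda>k. C * Q.N (v k - v' k) + Q.N (u k - u' k) * C') \<longlonglongrightarrow> C * 0 + 0 * C'"
    by (intro tendsto_intros approx_same_limit[OF f] approx_same_limit[OF g])
  then have lim0: "(\<lambda>k. C * Q.N (v k - v' k) + Q.N (u k - u' k) * C') \<longlonglongrightarrow> 0" by simp
  have "(\<lambda>k. Q (u k) (v k) - Q (u' k) (v' k)) \<longlonglongrightarrow> 0"
    by (rule Lim_null_comparison[OF always_eventually lim0]) (intro allI le)
  from tendsto_diff[OF lim this] show ?thesis by simp
qed

lemma cform_lim:
  assumes f: "f \<in> H" "approx u f" and g: "g \<in> H" "approx v g"
  shows "(\<lambda>k. Q (u k) (v k)) \<longlonglongrightarrow> cform f g"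
proof -
  obtain c where c: "(\<lambda>k. Q (u k) (v k)) \<longlonglongrightarrow> c"
    using Q.Cau_tendsto_b[OF approx_D[OF f(2)] approx_Cau[OF f(2)] approx_D[OF g(2)] approx_Cau[OF g(2)]]
    unfolding convergent_def by blast
  have "cform f g = c"
    unfolding cform_def
  proof (rule the_equality)
    show "\<forall>u v. approx u f \<and> approx v g \<longrightarrow> (\<lambda>k. Q (u k) (v k)) \<longlonglongrightarrow> c"
      using cform_unique[OF f _ g _ c] by blast
    show "c' = c" if "\<forall>u v. approx u f \<and> approx v g \<longrightarrow> (\<lambda>k. Q (u k) (v k)) \<longlonglongrightarrow> c'" for c'
      using that f(2) g(2) LIMSEQ_unique[OF _ c] by blast
  qed
  then show ?thesis using c by simp
qed

lemma cform_D: "f \<in> D \<Longrightarrow> g \<in> D \<Longrightarrow> cform f g = Q f g"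
  using cform_lim[OF _ approx_const _ approx_const, of f g] by (simp add: LIMSEQ_const_iff)

lemma cdomE:
  assumes "f \<in> cdom"
  obtains u where "approx u f"
  using assms unfolding cdom_def by blast

lemma subspace_cdom: "subspace cdom"
proof (rule subspaceI)
  show "0 \<in> cdom" by (intro D_cdom Q.zero_mem)
  show "f + g \<in> cdom" if fg: "f \<in> cdom" "g \<in> cdom" for f g
  proof -
    obtain u v where "approx u f" "approx v g" using cdomE[OF fg(1)] cdomE[OF fg(2)] by metis
    then show ?thesis by (intro cdomI[OF _ approx_add] H.add_mem cdom_H fg)
  qed
  show "c *\<^sub>R f \<in> cdom" if f: "f \<in> cdom" for c f
  proof -
    obtain u where "approx u f" by (rule cdomE[OF f])
    then show ?thesis by (intro cdomI[OF _ approx_scale] H.scale_mem cdom_H f)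
  qed
qed

lemma semi_inner_cform: "semi_inner cdom cform"
proof (unfold_locales, rule subspace_cdom)
  fix f g assume fg: "f \<in> cdom" "g \<in> cdom"
  obtain u where u: "approx u f" by (rule cdomE[OF fg(1)])
  obtain v where v: "approx v g" by (rule cdomE[OF fg(2)])
  note fH = fg[THEN cdom_H]
  have "(\<lambda>k. Q (v k) (u k)) = (\<lambda>k. Q (u k) (v k))"
    by (rule ext, rule Q.sym) (rule approx_D[OF v], rule approx_D[OF u])
  then show "cform f g = cform g f"
    using cform_lim[OF fH(1) u fH(2) v] cform_lim[OF fH(2) v fH(1) u] LIMSEQ_unique by auto
  show "cform (c *\<^sub>R f) g = c * cform f g" for c
  proof (rule LIMSEQ_unique)
    show "(\<lambda>k. Q (c *\<^sub>R u k) (v k)) \<longlonglongrightarrow> cform (c *\<^sub>R f) g"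
      by (intro cform_lim approx_scale H.scale_mem fH u v)
    show "(\<lambda>k. Q (c *\<^sub>R u k) (v k)) \<longlonglongrightarrow> c * cform f g"
      using tendsto_mult_left[OF cform_lim[OF fH(1) u fH(2) v], of c]
      by (simp add: Q.scale_left approx_D[OF u] approx_D[OF v])
  qed
  fix h assume h: "h \<in> cdom"
  obtain w where w: "approx w h" by (rule cdomE[OF h])
  show "cform (f + g) h = cform f h + cform g h"
  proof (rule LIMSEQ_unique)
    show "(\<lambda>k. Q (u k + v k) (w k)) \<longlonglongrightarrow> cform (f + g) h"
      by (intro cform_lim approx_add H.add_mem fH u v w cdom_H h)
    show "(\<lambda>k. Q (u k + v k) (w k)) \<longlonglongrightarrow> cform f h + cform g h"
      using tendsto_add[OF cform_lim[OF fH(1) u cdom_H[OF h] w] cform_lim[OF fH(2) v cdom_H[OF h] w]]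
      by (simp add: Q.add_left approx_D[OF u] approx_D[OF v] approx_D[OF w])
  qed
next
  fix f assume f: "f \<in> cdom"
  obtain u where u: "approx u f" by (rule cdomE[OF f])
  show "0 \<le> cform f f"
    by (rule LIMSEQ_le_const[OF cform_lim[OF cdom_H[OF f] u cdom_H[OF f] u]])
      (simp add: Q.nonneg approx_D[OF u])
qed

sublocale C: semi_inner cdom cform by (rule semi_inner_cform)

lemma approx_C_conv:
  assumes f: "f \<in> cdom" and u: "approx u f"
  shows "C.conv u f"
  unfolding C.conv_def
proof (rule LIMSEQ_I)
  fix e :: real assume e: "e > 0"
  then have "e/2 > 0" by simp
  then obtain n where n: "\<forall>j\<ge>n. \<forall>k\<ge>n. Q (u j - u k) (u j - u k) < e/2"
    using approx_Cau[OF u] unfolding Q.Cau_def by blast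
  have "norm (cform (u k - f) (u k - f) - 0) < e" if k: "k \<ge> n" for k
  proof -
    have uk: "u k \<in> H" by (rule approx_H[OF u])
    have fH: "f \<in> H" by (rule cdom_H[OF f])
    have a: "approx (\<lambda>j. u k - u j) (u k - f)"
      by (rule approx_diff[OF uk approx_const[OF approx_D[OF u]] fH u])
    have m: "u k - f \<in> H" using uk fH by simp
    have "cform (u k - f) (u k - f) \<le> e/2"
    proof (rule LIMSEQ_le_const2[OF cform_lim[OF m a m a]])
      show "\<exists>N. \<forall>j\<ge>N. Q (u k - u j) (u k - u j) \<le> e/2"
        using n k by (intro exI[of _ n]) (auto intro: less_imp_le)
    qed
    moreover have "0 \<le> cform (u k - f) (u k - f)"
      using f D_cdom[OF approx_D[OF u]] by (intro C.nonneg C.diff_mem)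
    ultimately show ?thesis using e by simp
  qed
  then show "\<exists>n. \<forall>k\<ge>n. norm (cform (u k - f) (u k - f) - 0) < e" by blast
qed

lemma cdom_approximable:
  assumes f: "f \<in> cdom" and e: "e > 0"
  obtains g where "g \<in> D" "H.N (f - g) < e" "C.N (f - g) < e"
proof -
  obtain u where u: "approx u f" by (rule cdomE[OF f])
  have "(\<lambda>k. H.N (u k - f)) \<longlonglongrightarrow> 0"
    using H.conv_N[of u f] approx_H[OF u] cdom_H[OF f] approx_conv[OF u] by blast
  moreover have "(\<lambda>k. C.N (u k - f)) \<longlonglongrightarrow> 0"
    using C.conv_N[of u f] D_cdom[OF approx_D[OF u]] f approx_C_conv[OF f u] by blast
  ultimately have "\<forall>\<^sub>F k in sequentially. H.N (u k - f) < e \<and> C.N (u k - f) < e"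
    using e by (intro eventually_conj order_tendstoD) auto
  then obtain k where k: "H.N (u k - f) < e" "C.N (u k - f) < e"
    unfolding eventually_sequentially by blast
  have "H.N (f - u k) = H.N (u k - f)" by (intro H.N_commute cdom_H[OF f] approx_H[OF u])
  moreover have "C.N (f - u k) = C.N (u k - f)" by (intro C.N_commute f D_cdom approx_D[OF u])
  ultimately show ?thesis using k by (intro that[OF approx_D[OF u, of k]]) simp_all
qed

text \<open>Completeness is the usual diagonal argument: a Cauchy sequence in the closure is replaced by one in the original
domain whose \<open>k\<close>-th member is \<open>1/k\<close>-close in both norms.\<close>

lemma closure_closed_form_space: "closed_form_space H ip cdom cform"
proof (unfold_locales)
  show "H.is_complete" by (rule H_complete)
  show "cdom \<subseteq> H" using cdom_H by blast
  show "\<exists>g\<in>cdom. H.N (f - g) < e" if "f \<in> H" "e > 0" for f e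
    using dense[OF that] D_cdom by blast
  show "f \<in> cdom \<and> cform f f = 0" if f: "f \<in> H" "ip f f = 0" for f
  proof -
    have "approx (\<lambda>_. 0) f"
      using f by (simp add: approx_def Q.Cau_def H.conv_def H.bil)
    note a = this
    have "(\<lambda>k::nat. 0) \<longlonglongrightarrow> cform f f" using cform_lim[OF f(1) a f(1) a] by simp
    then have "cform f f = 0" by (simp add: LIMSEQ_const_iff)
    then show ?thesis using cdomI[OF f(1) a] by simp
  qed
  fix u assume u: "\<And>k. u k \<in> cdom" and Hc: "H.Cau u" and Cc: "C.Cau u"
  have uH: "u k \<in> H" for k by (rule cdom_H[OF u])
  have "\<exists>g. g \<in> D \<and> H.N (u k - g) < 1 / real (Suc k) \<and> C.N (u k - g) < 1 / real (Suc k)" for k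
    by (rule cdom_approximable[OF u, of "1 / real (Suc k)" k]) auto
  then obtain v where v: "\<And>k. v k \<in> D" and vH: "\<And>k. H.N (u k - v k) < 1 / real (Suc k)"
    and vC: "\<And>k. C.N (u k - v k) < 1 / real (Suc k)" by metis
  have vc: "v k \<in> cdom" for k by (rule D_cdom[OF v])
  have vv: "v k \<in> H" for k by (rule D_H[OF v])
  have inv: "(\<lambda>k. 1 / real (Suc k)) \<longlonglongrightarrow> 0"
    using LIMSEQ_inverse_real_of_nat by (simp add: inverse_eq_divide)
  have Hz: "H.conv (\<lambda>k. v k - u k) 0"
  proof (subst H.conv_N)
    show "(\<lambda>k. H.N (v k - u k - 0)) \<longlonglongrightarrow> 0"
      using vH H.N_commute[OF uH vv] uH vv
      by (intro Lim_null_comparison[OF always_eventually inv]) (auto intro: less_imp_le)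
  qed (use uH vv in auto)
  have Cz: "C.conv (\<lambda>k. v k - u k) 0"
  proof (subst C.conv_N)
    show "(\<lambda>k. C.N (v k - u k - 0)) \<longlonglongrightarrow> 0"
      using vC C.N_commute[OF u vc] u vc
      by (intro Lim_null_comparison[OF always_eventually inv]) (auto intro: less_imp_le)
  qed (use u vc in auto)
  have "\<exists>f\<in>H. H.conv u f" by (rule H.completeD[OF H_complete uH Hc])
  then obtain f where f: "f \<in> H" and uf: "H.conv u f" by blast
  have vf: "H.conv v f"
    using H.conv_add[OF uH f uf _ _ Hz] uH vv by simp
  have "C.Cau v"
    using C.Cau_add[OF u Cc _ C.conv_imp_Cau[OF _ _ Cz]] u vc by simp
  then have Qc: "Q.Cau v" unfolding C.Cau_def Q.Cau_def by (simp add: cform_D v)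
  have av: "approx v f" unfolding approx_def using v Qc vf by blast
  have fc: "f \<in> cdom" by (rule cdomI[OF f av])
  have "C.conv u f"
    using C.conv_diff[OF vc fc approx_C_conv[OF fc av] _ _ Cz] u vc by simp
  then show "\<exists>f\<in>cdom. H.conv u f \<and> C.conv u f" using fc uf by blast
qed

lemma approx_of_form_null:
  assumes u: "\<And>k. u k \<in> D" and f: "f \<in> H" and conv: "H.conv u f"
    and null: "(\<lambda>k. Q (u k) (u k)) \<longlonglongrightarrow> 0"
  shows "f \<in> cdom \<and> cform f f = 0"
proof -
  have "Q.conv u 0" unfolding Q.conv_def using null by simp
  then have "Q.Cau u" by (rule Q.conv_imp_Cau[OF u Q.zero_mem])
  then have a: "approx u f" unfolding approx_def using u conv by blast
  then show ?thesis using cdomI[OF f a] LIMSEQ_unique[OF cform_lim[OF f a f a] null] by simp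
qed

end

section \<open>The space $L^2$\<close>

text \<open>Makes the abstract part applicable to spaces of functions.\<close>

instantiation "fun" :: (type, real_vector) real_vector
begin

definition scaleR_fun_def: "c *\<^sub>R f = (\<lambda>x. c *\<^sub>R f x)"

instance
  by standard (auto simp: scaleR_fun_def fun_eq_iff algebra_simps)

end

lemma scaleR_fun_apply [simp]: "(c *\<^sub>R f) x = c *\<^sub>R f x"
  by (simp add: scaleR_fun_def)

lemma L2_measurable: "f \<in> L2 M \<Longrightarrow> f \<in> borel_measurable M"
  and L2_square_integrable: "f \<in> L2 M \<Longrightarrow> integrable M (\<lambda>x. (f x)\<^sup>2)"
  by (auto simp: L2_def)

lemma L2_product_integrable:
  assumes "f \<in> L2 M" "g \<in> L2 M"
  shows "integrable M (\<lambda>x. f x * g x)"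
proof (rule Bochner_Integration.integrable_bound)
  show "integrable M (\<lambda>x. (f x)\<^sup>2 + (g x)\<^sup>2)"
    using assms by (intro Bochner_Integration.integrable_add L2_square_integrable)
  show "(\<lambda>x. f x * g x) \<in> borel_measurable M"
    using assms by (intro borel_measurable_times L2_measurable)
  have "\<bar>a * b\<bar> \<le> a\<^sup>2 + b\<^sup>2" for a b :: real
  proof -
    have "2 * (\<bar>a\<bar> * \<bar>b\<bar>) \<le> a\<^sup>2 + b\<^sup>2" using sum_squares_bound[of "\<bar>a\<bar>" "\<bar>b\<bar>"] by simp
    moreover have "0 \<le> a\<^sup>2 + b\<^sup>2" by simp
    ultimately show ?thesis unfolding abs_mult by linarith
  qed
  then show "AE x in M. norm (f x * g x) \<le> norm ((f x)\<^sup>2 + (g x)\<^sup>2)"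
    by simp
qed

lemma L2_dominated:
  assumes f: "f \<in> L2 M" and g: "g \<in> borel_measurable M" and le: "AE x in M. \<bar>g x\<bar> \<le> \<bar>f x\<bar>"
  shows "g \<in> L2 M"
proof -
  have "integrable M (\<lambda>x. (g x)\<^sup>2)"
  proof (rule Bochner_Integration.integrable_bound[OF L2_square_integrable[OF f]])
    show "AE x in M. norm ((g x)\<^sup>2) \<le> norm ((f x)\<^sup>2)"
      using le by eventually_elim (simp add: abs_le_square_iff)
  qed (use g in measurable)
  then show ?thesis using g by (simp add: L2_def)
qed

lemma semi_inner_L2: "semi_inner (L2 M) (L2_inner M)"
proof unfold_locales
  show "subspace (L2 M)"
  proof (rule subspaceI)
    show "0 \<in> L2 M" by (simp add: L2_def zero_fun_def)
    show "f + g \<in> L2 M" if "f \<in> L2 M" "g \<in> L2 M" for f g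
    proof -
      have "integrable M (\<lambda>x. (f x)\<^sup>2 + 2 * (f x * g x) + (g x)\<^sup>2)"
        using that by (intro Bochner_Integration.integrable_add integrable_mult_right L2_square_integrable L2_product_integrable)
      moreover have "f + g \<in> borel_measurable M"
        using that unfolding plus_fun_def by (intro borel_measurable_add L2_measurable)
      ultimately show ?thesis by (simp add: L2_def power2_sum algebra_simps)
    qed
    show "c *\<^sub>R f \<in> L2 M" if "f \<in> L2 M" for c f
      using that by (auto simp: L2_def power_mult_distrib scaleR_fun_def)
  qed
next
  fix f g h assume f: "f \<in> L2 M" and g: "g \<in> L2 M"
  show "L2_inner M f g = L2_inner M g f" by (simp add: L2_inner_def mult.commute)
  show "L2_inner M (c *\<^sub>R f) g = c * L2_inner M f g" for c
    by (simp add: L2_inner_def mult.assoc)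
  show "0 \<le> L2_inner M f f" by (simp add: L2_inner_def)
  show "L2_inner M (f + g) h = L2_inner M f h + L2_inner M g h" if "h \<in> L2 M"
    using L2_product_integrable[OF f that] L2_product_integrable[OF g that]
    by (simp add: L2_inner_def algebra_simps)
qed

interpretation L2: semi_inner "L2 M" "L2_inner M" for M by (rule semi_inner_L2)

lemma L2_norm_eq: "L2_norm M f = L2.N M f"
  by (simp add: L2_norm_def L2.N_def)

lemma L2_inner_nn: "f \<in> L2 M \<Longrightarrow> ennreal (L2_inner M f f) = (\<integral>\<^sup>+x. ennreal ((f x)\<^sup>2) \<partial>M)"
  using nn_integral_eq_integral[OF L2_square_integrable, of f M]
  by (simp add: L2_inner_def power2_eq_square)

lemma L2I_nn:
  assumes "f \<in> borel_measurable M" "(\<integral>\<^sup>+x. ennreal ((f x)\<^sup>2) \<partial>M) < \<infinity>"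
  shows "f \<in> L2 M"
  unfolding L2_def using assms by (auto intro!: integrableI_bounded)

lemma L2_null_AE:
  assumes f: "f \<in> L2 M"
  shows "L2_inner M f f = 0 \<longleftrightarrow> (AE x in M. f x = 0)"
  using integral_nonneg_eq_0_iff_AE[OF L2_square_integrable[OF f]]
  by (simp add: L2_inner_def power2_eq_square)

text \<open>Riesz--Fischer: a subsequence whose consecutive distances decay geometrically converges
  almost everywhere, and Fatou's lemma identifies the pointwise limit as the limit in norm.\<close>

lemma L2_complete: "semi_inner.is_complete (L2 M) (L2_inner M)"
  unfolding L2.is_complete_def
proof (intro allI impI, elim conjE)
  fix u assume uu: "\<forall>k. u k \<in> L2 M" and C: "L2.Cau M u"
  have u: "u k \<in> L2 M" for k using uu by blast
  have [measurable]: "u k \<in> borel_measurable M" for k by (rule L2_measurable[OF u])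
  let ?d = "\<lambda>j k. L2_inner M (u j - u k) (u j - u k)"
  have "\<exists>n. \<forall>i\<ge>n. \<forall>j\<ge>n. ?d i j < (1/8) ^ k" for k :: nat
    using C unfolding L2.Cau_def by simp
  then obtain n0 where n0: "\<And>k i j. i \<ge> n0 k \<Longrightarrow> j \<ge> n0 k \<Longrightarrow> ?d i j < (1/8) ^ k" by metis
  define r where "r k = Max (n0 ` {..k})" for k
  have r_ge: "n0 k \<le> r j" if "k \<le> j" for j k unfolding r_def using that by (intro Max_ge) auto
  have step: "?d (r (Suc k)) (r k) < (1/8) ^ k" for k by (intro n0 r_ge) auto
  define g where "g k x = u (r (Suc k)) x - u (r k) x" for k x
  have g_eq: "g k = u (r (Suc k)) - u (r k)" for k by (simp add: g_def fun_eq_iff)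
  have g_L2: "g k \<in> L2 M" for k
    unfolding g_eq by (rule L2.diff_mem[OF u u])
  have [measurable]: "g k \<in> borel_measurable M" for k by (rule L2_measurable[OF g_L2])
  \<comment> \<open>the weights \<open>4\<^sup>k\<close> are beaten by the squared distances below \<open>(1/8)\<^sup>k\<close>, yet large enough to make
    \<open>g k x\<close> summable by comparison with \<open>(1/2)\<^sup>k\<close>\<close>
  have "(\<integral>\<^sup>+x. (\<Sum>k. ennreal (4 ^ k * (g k x)\<^sup>2)) \<partial>M) = (\<Sum>k. \<integral>\<^sup>+x. ennreal (4 ^ k * (g k x)\<^sup>2) \<partial>M)"
    by (intro nn_integral_suminf) measurable
  also have "\<dots> \<le> (\<Sum>k. ennreal ((1/2) ^ k))"
  proof (intro suminf_le summableI)
    fix k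
    have "(\<integral>\<^sup>+x. ennreal (4 ^ k * (g k x)\<^sup>2) \<partial>M) = ennreal (4 ^ k) * (\<integral>\<^sup>+x. ennreal ((g k x)\<^sup>2) \<partial>M)"
      by (subst nn_integral_cmult[symmetric]) (auto simp: ennreal_mult)
    also have "\<dots> = ennreal (4 ^ k * ?d (r (Suc k)) (r k))"
      unfolding L2_inner_nn[OF g_L2, of k, symmetric] unfolding g_eq
      by (rule ennreal_mult[symmetric]) (auto intro: L2.nonneg u)
    also have "\<dots> \<le> ennreal (4 ^ k * (1/8) ^ k)"
      using step[of k] by (intro ennreal_leI mult_left_mono) auto
    also have "(4::real) ^ k * (1/8) ^ k = (1/2) ^ k"
      by (simp flip: power_mult_distrib)
    finally show "(\<integral>\<^sup>+x. ennreal (4 ^ k * (g k x)\<^sup>2) \<partial>M) \<le> ennreal ((1/2) ^ k)" .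
  qed
  also have "\<dots> = ennreal (\<Sum>k. (1/2) ^ k)"
    by (intro suminf_ennreal2) (auto intro: summable_geometric)
  also have "\<dots> < \<infinity>" by simp
  finally have fin: "(\<integral>\<^sup>+x. (\<Sum>k. ennreal (4 ^ k * (g k x)\<^sup>2)) \<partial>M) \<noteq> \<infinity>" by simp
  have "AE x in M. (\<Sum>k. ennreal (4 ^ k * (g k x)\<^sup>2)) \<noteq> \<infinity>"
    by (rule nn_integral_noteq_infinite[OF _ fin]) measurable
  then have ae: "AE x in M. convergent (\<lambda>k. u (r k) x)"
  proof eventually_elim
    case (elim x)
    have "summable (\<lambda>k. 4 ^ k * (g k x)\<^sup>2)"
      using elim by (intro summable_suminf_not_top) auto
    then have "(\<lambda>k. 4 ^ k * (g k x)\<^sup>2) \<longlonglongrightarrow> 0" by (rule summable_LIMSEQ_zero)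
    then have "Bseq (\<lambda>k. 4 ^ k * (g k x)\<^sup>2)" by (intro convergent_imp_Bseq convergentI)
    then obtain K where K: "K > 0" "\<And>k. norm (4 ^ k * (g k x)\<^sup>2) \<le> K" unfolding Bseq_def by blast
    have "norm (g k x) \<le> sqrt K * (1/2) ^ k" for k
    proof -
      have "(2 ^ k * \<bar>g k x\<bar>)\<^sup>2 = 4 ^ k * (g k x)\<^sup>2"
        by (simp add: power_mult_distrib flip: power_mult) (simp add: power_mult mult.commute[of k])
      then have "(2 ^ k * \<bar>g k x\<bar>)\<^sup>2 \<le> K" using K(2)[of k] by simp
      then have "2 ^ k * \<bar>g k x\<bar> \<le> sqrt K" by (rule real_le_rsqrt)
      then show ?thesis by (simp add: field_simps power_one_over)
    qed
    then have le: "\<exists>N. \<forall>k\<ge>N. norm (g k x) \<le> sqrt K * (1/2) ^ k" by blast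
    have "summable (\<lambda>k. g k x)"
      by (rule summable_comparison_test[OF le summable_mult[OF summable_geometric]]) simp
    then have "convergent (\<lambda>n. \<Sum>k<n. g k x)" by (auto simp: summable_iff_convergent)
    moreover have "(\<Sum>k<n. g k x) = u (r n) x - u (r 0) x" for n
      unfolding g_def using sum_lessThan_telescope[of "\<lambda>k. u (r k) x" n] by simp
    ultimately have "convergent (\<lambda>n. u (r n) x - u (r 0) x)" by simp
    then show ?case using convergent_add_const_right_iff[of "\<lambda>n. u (r n) x" "- u (r 0) x"] by simp
  qed
  define f where "f x = lim (\<lambda>k. u (r k) x)" for x
  have fm [measurable]: "f \<in> borel_measurable M" unfolding f_def by (rule borel_measurable_lim_metric) measurable
  have aelim: "AE x in M. (\<lambda>k. u (r k) x) \<longlonglongrightarrow> f x"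
    using ae by eventually_elim (simp add: f_def convergent_LIMSEQ_iff)
  have fatou: "(\<integral>\<^sup>+x. ennreal ((u m x - f x)\<^sup>2) \<partial>M) \<le> ennreal ((1/8) ^ k)" if m: "m \<ge> n0 k" for m k
  proof -
    have "(\<integral>\<^sup>+x. ennreal ((u m x - f x)\<^sup>2) \<partial>M) = (\<integral>\<^sup>+x. liminf (\<lambda>j. ennreal ((u m x - u (r j) x)\<^sup>2)) \<partial>M)"
      using aelim
    proof (intro nn_integral_cong_AE, eventually_elim)
      case (elim x)
      have "(\<lambda>j. ennreal ((u m x - u (r j) x)\<^sup>2)) \<longlonglongrightarrow> ennreal ((u m x - f x)\<^sup>2)"
        by (intro tendsto_intros elim)
      then show ?case by (intro lim_imp_Liminf[symmetric]) auto
    qed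
    also have "\<dots> \<le> liminf (\<lambda>j. \<integral>\<^sup>+x. ennreal ((u m x - u (r j) x)\<^sup>2) \<partial>M)"
      by (intro nn_integral_liminf) measurable
    also have "\<dots> \<le> liminf (\<lambda>j. ennreal ((1/8) ^ k))"
    proof (rule Liminf_mono, unfold eventually_sequentially, intro exI allI impI)
      fix j assume "j \<ge> k"
      then have "?d m (r j) < (1/8) ^ k" using m r_ge by (intro n0) auto
      moreover have "(\<integral>\<^sup>+x. ennreal ((u m x - u (r j) x)\<^sup>2) \<partial>M) = ennreal (?d m (r j))"
        using L2_inner_nn[OF L2.diff_mem[OF u u]] by simp
      ultimately show "(\<integral>\<^sup>+x. ennreal ((u m x - u (r j) x)\<^sup>2) \<partial>M) \<le> ennreal ((1/8) ^ k)"
        by (simp add: ennreal_leI)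
    qed
    also have "\<dots> = ennreal ((1/8) ^ k)" by (simp add: Liminf_const)
    finally show ?thesis .
  qed
  have dL2: "u m - f \<in> L2 M" if "m \<ge> n0 k" for m k
  proof (rule L2I_nn)
    show "u m - f \<in> borel_measurable M" unfolding fun_diff_def by measurable
    show "(\<integral>\<^sup>+x. ennreal (((u m - f) x)\<^sup>2) \<partial>M) < \<infinity>"
      using fatou[OF that] by (simp add: order_le_less_trans)
  qed
  have fL2: "f \<in> L2 M"
    using L2.diff_mem[OF u[of "n0 0"] dL2[of 0 "n0 0"]] by simp
  have "L2.conv M u f"
    unfolding L2.conv_def
  proof (rule LIMSEQ_I)
    fix e :: real assume "e > 0"
    then obtain k where k: "(1/8) ^ k < e" using real_arch_pow_inv[of e "1/8"] by auto
    have "norm (L2_inner M (u m - f) (u m - f) - 0) < e" if m: "m \<ge> n0 k" for m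
    proof -
      have "ennreal (L2_inner M (u m - f) (u m - f)) \<le> ennreal ((1/8) ^ k)"
        using fatou[OF m] L2_inner_nn[OF dL2[OF m]] by simp
      then have "L2_inner M (u m - f) (u m - f) \<le> (1/8) ^ k" by simp
      then show ?thesis using k L2.nonneg[OF dL2[OF m]] by simp
    qed
    then show "\<exists>n. \<forall>m\<ge>n. norm (L2_inner M (u m - f) (u m - f) - 0) < e" by blast
  qed
  then show "\<exists>f\<in>L2 M. L2.conv M u f" using fL2 by blast
qed

section \<open>Closed forms on $L^2$\<close>

lemma L2_inner_nonneg: "0 \<le> L2_inner M f f"
  by (simp add: L2_inner_def)

lemma L2_tendsto_iff: "L2_tendsto M u f \<longleftrightarrow> L2.conv M u f"
proof
  assume "L2_tendsto M u f"
  then have "(\<lambda>k. (sqrt (L2_inner M (u k - f) (u k - f)))\<^sup>2) \<longlonglongrightarrow> 0\<^sup>2"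
    unfolding L2_tendsto_def L2_norm_def fun_diff_def by (rule tendsto_power)
  then show "L2.conv M u f" unfolding L2.conv_def by (simp add: L2_inner_nonneg)
next
  assume "L2.conv M u f"
  then have "(\<lambda>k. sqrt (L2_inner M (u k - f) (u k - f))) \<longlonglongrightarrow> sqrt 0"
    unfolding L2.conv_def by (rule tendsto_real_sqrt)
  then show "L2_tendsto M u f" unfolding L2_tendsto_def L2_norm_def fun_diff_def by simp
qed

lemma form_Cauchy_iff: "semi_inner D Q \<Longrightarrow> form_Cauchy Q u \<longleftrightarrow> semi_inner.Cau Q u"
  by (simp add: form_Cauchy_def semi_inner.Cau_def fun_diff_def)

lemma L2_N_zero_AE:
  assumes "f \<in> L2 M" "g \<in> L2 M"
  shows "L2.N M (f - g) = 0 \<longleftrightarrow> (AE x in M. f x = g x)"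
  using L2_null_AE[of "f - g" M] L2.N_sq[of "f - g" M] assms by (auto simp: L2.N_def)

lemma
  assumes "closable_form (L2 M) (L2_inner M) D Q"
  shows closure_dom_eq: "closure_dom M D Q = closable_form.cdom (L2 M) (L2_inner M) D Q"
    and closure_form_eq: "closure_form M D Q = closable_form.cform (L2_inner M) D Q"
proof -
  interpret closable_form "L2 M" "L2_inner M" D Q by fact
  have a: "approximating M D Q = approx"
    unfolding approximating_def[abs_def] approx_def[abs_def] form_Cauchy_iff[OF Q.semi_inner_axioms] L2_tendsto_iff
    by (rule refl)
  show "closure_dom M D Q = cdom"
    unfolding closure_dom_def cdom_def a by (rule refl)
  show "closure_form M D Q = cform"
    unfolding closure_form_def[abs_def] cform_def[abs_def] a by (rule refl)
qed

text \<open>The abstract notions for the Hilbert space \<open>L\<^sup>2(M)\<close>; equality up to vectors of norm zero becomes equality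
almost everywhere.\<close>

locale closed_L2_form =
  closed_form_space "L2 M" "L2_inner M" D Q
  for M :: "'a measure" and D :: "('a \<Rightarrow> real) set" and Q
begin

lemma symmetric_bilinear: "symmetric_bilinear_form M D Q"
  unfolding symmetric_bilinear_form_def
proof (intro conjI allI ballI impI)
  show "D \<subseteq> L2 M" by (rule D_sub)
  show "(\<lambda>x. 0) \<in> D" using Q.zero_mem by (simp add: zero_fun_def)
  fix f g c assume f: "f \<in> D" and g: "g \<in> D"
  show "(\<lambda>x. f x + g x) \<in> D" using Q.add_mem[OF f g] by (simp add: plus_fun_def)
  show "(\<lambda>x. c * f x) \<in> D" using Q.scale_mem[OF f, of c] by (simp add: scaleR_fun_def)
  show "Q f g = Q g f" by (rule Q.sym[OF f g])
  show "Q (\<lambda>x. c * f x) g = c * Q f g" using Q.scale_left[OF f g, of c] by (simp add: scaleR_fun_def)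
  show "Q (\<lambda>x. f x + g x) h = Q f h + Q g h" if "h \<in> D" for h
    using Q.add_left[OF f g that] by (simp add: plus_fun_def)
  show "Q f h = Q g h" if h: "h \<in> D" and ae: "AE x in M. f x = g x" for h
  proof -
    have "L2.N M (f - g) = 0" using ae L2_N_zero_AE[OF D_H[OF f] D_H[OF g]] by simp
    then have "Q (f - g) h = 0" using Q_null[of "f - g" h] f g h by simp
    then show ?thesis using Q.diff_left[OF f g h] by simp
  qed
qed

lemma positive: "positive_definite D Q"
  by (simp add: positive_definite_def Q.nonneg)

lemma dense_L2: "densely_defined M D"
  unfolding densely_defined_def L2_norm_eq using dense by (simp add: fun_diff_def)

lemma closed: "closed_form M D Q"
  unfolding closed_form_def
proof (intro allI impI, elim conjE)
  fix u assume uu: "\<forall>k. u k \<in> D" and c: "form_Cauchy (form1 M Q) u"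
  have u: "u k \<in> D" for k using uu by blast
  have c': "\<exists>n. \<forall>j\<ge>n. \<forall>k\<ge>n. Q (u j - u k) (u j - u k) + L2_inner M (u j - u k) (u j - u k) < e" if "e > 0" for e
    using c that unfolding form_Cauchy_def form1_def fun_diff_def by blast
  have "L2.Cau M u"
    unfolding L2.Cau_def
  proof (intro allI impI)
    fix e :: real assume "e > 0"
    obtain n where n: "\<forall>j\<ge>n. \<forall>k\<ge>n. Q (u j - u k) (u j - u k) + L2_inner M (u j - u k) (u j - u k) < e"
      using c'[OF \<open>e > 0\<close>] by blast
    have "L2_inner M (u j - u k) (u j - u k) < e" if "j \<ge> n" "k \<ge> n" for j k
      using n[rule_format, OF that] Q.nonneg[OF Q.diff_mem[OF u u], of j k] by linarith
    then show "\<exists>n. \<forall>j\<ge>n. \<forall>k\<ge>n. L2_inner M (u j - u k) (u j - u k) < e" by blast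
  qed
  moreover have "Q.Cau u"
    unfolding Q.Cau_def
  proof (intro allI impI)
    fix e :: real assume "e > 0"
    obtain n where n: "\<forall>j\<ge>n. \<forall>k\<ge>n. Q (u j - u k) (u j - u k) + L2_inner M (u j - u k) (u j - u k) < e"
      using c'[OF \<open>e > 0\<close>] by blast
    have "Q (u j - u k) (u j - u k) < e" if "j \<ge> n" "k \<ge> n" for j k
      using n[rule_format, OF that] L2_inner_nonneg[of M "u j - u k"] by linarith
    then show "\<exists>n. \<forall>j\<ge>n. \<forall>k\<ge>n. Q (u j - u k) (u j - u k) < e" by blast
  qed
  ultimately have "\<exists>f\<in>D. L2.conv M u f \<and> Q.conv u f" by (rule D_complete[OF u])
  then obtain f where f: "f \<in> D" "L2.conv M u f" "Q.conv u f" by blast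
  have "(\<lambda>k. Q (u k - f) (u k - f) + L2_inner M (u k - f) (u k - f)) \<longlonglongrightarrow> 0 + 0"
    using f(2,3) unfolding L2.conv_def Q.conv_def by (intro tendsto_add)
  then show "\<exists>f\<in>D. (\<lambda>k. form1 M Q (\<lambda>x. u k x - f x) (\<lambda>x. u k x - f x)) \<longlonglongrightarrow> 0"
    using f(1) unfolding form1_def fun_diff_def by auto
qed

lemma contraction_semigroup_T: "contraction_semigroup M T"
  unfolding contraction_semigroup_def
proof (intro conjI allI impI ballI)
  fix t :: real and f assume t: "t > 0" and f: "f \<in> L2 M"
  show "T t f \<in> L2 M" by (rule T_H[OF t f])
  show "L2_norm M (T t f) \<le> L2_norm M f" unfolding L2_norm_eq by (rule T_contraction[OF t f])
  fix g a b assume g: "g \<in> L2 M"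
  have "L2.N M (T t (a *\<^sub>R f + b *\<^sub>R g) - (a *\<^sub>R T t f + b *\<^sub>R T t g)) = 0" by (rule T_lin[OF t f g])
  then have "AE x in M. T t (a *\<^sub>R f + b *\<^sub>R g) x = (a *\<^sub>R T t f + b *\<^sub>R T t g) x"
    using f g t by (subst (asm) L2_N_zero_AE) auto
  then show "AE x in M. T t (\<lambda>y. a * f y + b * g y) x = a * T t f x + b * T t g x"
    by (simp add: plus_fun_def scaleR_fun_def)
next
  fix r t :: real and f assume r: "r > 0" and t: "t > 0" and f: "f \<in> L2 M"
  show "AE x in M. T (r + t) f x = T r (T t f) x"
    using T_semigroup[OF r t f] r t f by (subst (asm) L2_N_zero_AE) auto
next
  fix f assume "f \<in> L2 M"
  then have "((\<lambda>t. L2.N M (T t f - f)) \<longlongrightarrow> 0) (at_right 0)" by (rule T_strong_continuity)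
  then show "((\<lambda>t. L2_norm M (\<lambda>x. T t f x - f x)) \<longlongrightarrow> 0) (at_right 0)"
    unfolding L2_norm_eq fun_diff_def .
qed

lemma A_form_generator: "A f (- h) \<longleftrightarrow> form_generator M D Q f h"
proof
  assume a: "A f (- h)"
  then have "h \<in> L2 M" using L2.neg_mem[OF A_H[OF a]] by simp
  then show "form_generator M D Q f h"
    using a unfolding A_def form_generator_def fun_Compl_def by blast
next
  assume g: "form_generator M D Q f h"
  then have "- h \<in> L2 M" by (intro L2.neg_mem) (simp add: form_generator_def)
  then show "A f (- h)"
    using g unfolding A_def form_generator_def fun_Compl_def by blast
qed

lemma generator_iff: "semigroup_generator M T f h \<longleftrightarrow> form_generator M D Q f h"
proof -
  have quot: "(\<lambda>x. (T t f x - f x) / t - h x) = (1/t) *\<^sub>R (T t f - f) - h" for t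
    by (simp add: fun_eq_iff)
  show ?thesis
  proof
    assume "semigroup_generator M T f h"
    then have "A f (- h)"
      unfolding semigroup_generator_def L2_norm_eq quot by (intro generator_imp_A) auto
    then show "form_generator M D Q f h" by (simp add: A_form_generator)
  next
    assume "form_generator M D Q f h"
    then have a: "A f (- h)" and h: "h \<in> L2 M" by (auto simp: A_form_generator form_generator_def)
    show "semigroup_generator M T f h"
      unfolding semigroup_generator_def L2_norm_eq quot
      using T_difference_quotient[OF a] A_HD[OF a] h by simp
  qed
qed

lemma conservativeI:
  assumes one: "(\<lambda>x. 1) \<in> D" "Q (\<lambda>x. 1) (\<lambda>x. 1) = 0"
  shows "conservative M D Q"
  unfolding conservative_def associated_semigroup_def
proof (intro exI[of _ T] conjI allI impI)
  show "contraction_semigroup M T" by (rule contraction_semigroup_T)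
  show "semigroup_generator M T f h = form_generator M D Q f h" for f h by (rule generator_iff)
  fix t :: real assume t: "t > 0"
  show "AE x in M. T t (\<lambda>y. 1) x = 1"
    using T_fixed[OF t one] one(1) t by (subst (asm) L2_N_zero_AE) auto
qed

lemma Dirichlet_formI:
  assumes "\<And>f. f \<in> D \<Longrightarrow> (\<lambda>x. min (max 0 (f x)) 1) \<in> D
        \<and> Q (\<lambda>x. min (max 0 (f x)) 1) (\<lambda>x. min (max 0 (f x)) 1) \<le> Q f f"
  shows "symmetric_Dirichlet_form M D Q"
  unfolding symmetric_Dirichlet_form_def
  by (intro conjI ballI symmetric_bilinear positive dense_L2 closed assms[THEN conjunct1] assms[THEN conjunct2])

end

section \<open>Functions of class $C^k$ on the orthant\<close>

lemma closed_orthant: "closed (orthant :: (real^'n) set)"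
proof -
  have eq: "orthant = (\<Inter>i. {x::real^'n. 0 \<le> x $ i})" by (auto simp: orthant_def)
  show ?thesis unfolding eq by (intro closed_INT ballI closed_Collect_le continuous_intros)
qed

lemma open_open_orthant: "open (open_orthant :: (real^'n) set)"
proof -
  have eq: "open_orthant = (\<Inter>i. {x::real^'n. 0 < x $ i})" by (auto simp: open_orthant_def)
  show ?thesis unfolding eq by (intro open_INT ballI open_Collect_less continuous_intros) simp
qed

lemma open_orthant_subset: "open_orthant \<subseteq> orthant"
  by (auto simp: open_orthant_def orthant_def intro: less_imp_le)

text \<open>Points of the orthant are limits of interior points along the diagonal direction.\<close>

definition shift :: "real^'n \<Rightarrow> real \<Rightarrow> real^'n" where
  "shift x e = x + e *\<^sub>R (\<chi> i. 1)"

lemma shift_open_orthant: "x \<in> orthant \<Longrightarrow> e > 0 \<Longrightarrow> shift x e \<in> open_orthant"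
  by (auto simp: shift_def orthant_def open_orthant_def add_nonneg_pos)

lemma shift_tendsto: "(shift x \<longlongrightarrow> x) (at_right 0)"
proof -
  have "((\<lambda>e. x + e *\<^sub>R (\<chi> i. 1)) \<longlongrightarrow> x + 0 *\<^sub>R (\<chi> i. 1)) (at_right 0)" by (intro tendsto_intros)
  then show ?thesis unfolding shift_def by simp
qed

lemma shift_filterlim:
  assumes "x \<in> orthant"
  shows "filterlim (shift x) (at x within open_orthant) (at_right 0)"
  unfolding filterlim_at
proof
  show "(shift x \<longlongrightarrow> x) (at_right 0)" by (rule shift_tendsto)
  show "\<forall>\<^sub>F e in at_right 0. shift x e \<in> open_orthant \<and> shift x e \<noteq> x"
    unfolding eventually_at_right_field
  proof (intro exI[of _ 1] conjI allI impI)
    fix e :: real assume "e > 0" "e < 1"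
    then show "shift x e \<in> open_orthant" by (intro shift_open_orthant assms)
    show "shift x e \<noteq> x"
    proof
      assume "shift x e = x"
      then have "shift x e $ undefined = x $ undefined" by simp
      then show False using \<open>e > 0\<close> by (simp add: shift_def)
    qed
  qed simp
qed

lemma at_within_open_orthant_neq_bot: "x \<in> orthant \<Longrightarrow> at x within open_orthant \<noteq> bot"
  using shift_filterlim[of x] filtermap_bot_iff[of "shift x" "at_right 0"]
  by (auto simp: filterlim_def bot_unique)

lemma orthant_continuous_tendsto:
  assumes "continuous_on orthant h" "x \<in> orthant"
  shows "(h \<longlongrightarrow> h x) (at x within open_orthant)"
  using assms open_orthant_subset by (auto simp: continuous_on_def intro: tendsto_within_subset)

text \<open>A description by recursion on the order, through an explicit gradient whose components are again of
this kind on the closed orthant. Sums, products and compositions are then handled by induction, without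
iterated partial derivatives.\<close>

primrec Ck :: "nat \<Rightarrow> (real^'n \<Rightarrow> real) \<Rightarrow> bool" where
  "Ck 0 f \<longleftrightarrow> continuous_on orthant f"
| "Ck (Suc k) f \<longleftrightarrow> continuous_on orthant f \<and>
     (\<exists>d. (\<forall>x\<in>open_orthant. (f has_derivative (\<lambda>v. \<Sum>i\<in>UNIV. d i x * v $ i)) (at x)) \<and> (\<forall>i. Ck k (d i)))"

lemma Ck_continuous: "Ck k f \<Longrightarrow> continuous_on orthant f"
  by (cases k) auto

lemma Ck_Suc_imp: "Ck (Suc k) f \<Longrightarrow> Ck k f"
proof (induction k arbitrary: f)
  case (Suc k)
  then obtain d where "\<forall>x\<in>open_orthant. (f has_derivative (\<lambda>v. \<Sum>i\<in>UNIV. d i x * v $ i)) (at x)" "\<forall>i. Ck (Suc k) (d i)"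
    by auto
  then show ?case using Suc.IH Suc.prems by (auto intro!: exI[of _ d])
qed simp

lemma partial_deriv_gradient:
  assumes "(f has_derivative (\<lambda>v. \<Sum>i\<in>UNIV. d i x * v $ i)) (at x)"
  shows "partial_deriv i f x = d i x"
  unfolding partial_deriv_def frechet_derivative_at[OF assms, symmetric]
  by (simp add: axis_def if_distrib cong: if_cong)

lemma partial_deriv_cong:
  assumes "\<And>y. y \<in> open_orthant \<Longrightarrow> f y = g y" "x \<in> open_orthant"
  shows "partial_deriv i f x = partial_deriv i g x"
proof -
  have "(f has_derivative f') (at x) \<longleftrightarrow> (g has_derivative f') (at x)" for f'
    using has_derivative_transform_within_open[OF _ open_open_orthant assms(2)] assms(1) by metis
  then show ?thesis by (simp add: partial_deriv_def frechet_derivative_def)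
qed

lemma iter_partial_cong:
  assumes "\<And>y. y \<in> open_orthant \<Longrightarrow> f y = g y"
  shows "x \<in> open_orthant \<Longrightarrow> iter_partial l f x = iter_partial l g x"
proof (induction l arbitrary: x)
  case (Cons i l)
  then show ?case by (simp add: partial_deriv_cong[of "iter_partial l f" "iter_partial l g"])
qed (use assms in simp)

lemma iter_partial_snoc: "iter_partial (l @ [i]) f = iter_partial l (partial_deriv i f)"
  by (induction l) auto

text \<open>In both directions the list of differentiation indices is split at its last element, the derivative that is taken
first.\<close>

lemma Ck_iff:
  "Ck k f \<longleftrightarrow> continuous_on orthant f \<and> C_k_on k open_orthant f \<and>
     (\<forall>l. length l \<le> k \<longrightarrow> (\<exists>h. continuous_on orthant h \<and> (\<forall>x\<in>open_orthant. h x = iter_partial l f x)))"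
  (is "_ \<longleftrightarrow> ?R k f")
proof
  show "Ck k f \<Longrightarrow> ?R k f"
  proof (induction k arbitrary: f)
    case 0
    then show ?case by (auto simp: C_k_on_def intro: continuous_on_subset[OF _ open_orthant_subset])
  next
    case (Suc k)
    from Suc.prems have "\<exists>d. (\<forall>x\<in>open_orthant. (f has_derivative (\<lambda>v. \<Sum>i\<in>UNIV. d i x * v $ i)) (at x)) \<and> (\<forall>i. Ck k (d i))"
      unfolding Ck.simps by (rule conjunct2)
    then obtain d where d: "\<And>x. x \<in> open_orthant \<Longrightarrow> (f has_derivative (\<lambda>v. \<Sum>i\<in>UNIV. d i x * v $ i)) (at x)"
      and dk: "\<And>i. Ck k (d i)" by blast
    have cf: "continuous_on orthant f" using Suc.prems by simp
    have IH: "?R k (d i)" for i by (rule Suc.IH[OF dk])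
    have eq: "iter_partial (l @ [i]) f x = iter_partial l (d i) x" if "x \<in> open_orthant" for l i x
      unfolding iter_partial_snoc
      by (rule iter_partial_cong[OF _ that]) (rule partial_deriv_gradient[OF d])
    have deq: "iter_partial (l @ [i]) f differentiable (at x) \<longleftrightarrow> iter_partial l (d i) differentiable (at x)"
      if "x \<in> open_orthant" for l i x
      unfolding differentiable_def
      using has_derivative_transform_within_open[OF _ open_open_orthant that] eq by metis
    have ceq: "continuous_on open_orthant (iter_partial (l @ [i]) f) \<longleftrightarrow> continuous_on open_orthant (iter_partial l (d i))" for l i
      by (rule continuous_on_cong) (auto simp: eq)
    show ?case
      unfolding C_k_on_def
    proof (intro conjI allI impI ballI)
      show "continuous_on orthant f" by (rule cf)
      fix l :: "'a list"
      show "iter_partial l f differentiable (at x)" if "length l < Suc k" "x \<in> open_orthant" for x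
      proof (cases l rule: rev_cases)
        case Nil
        then show ?thesis using d[OF that(2)] by (auto simp: differentiable_def)
      next
        case (snoc m i)
        then show ?thesis using IH[of i] that by (simp add: deq C_k_on_def)
      qed
      assume l: "length l \<le> Suc k"
      show "continuous_on open_orthant (iter_partial l f)"
      proof (cases l rule: rev_cases)
        case Nil
        then show ?thesis using cf by (auto intro: continuous_on_subset[OF _ open_orthant_subset])
      next
        case (snoc m i)
        then show ?thesis using IH[of i] l by (simp add: ceq C_k_on_def)
      qed
      show "\<exists>h. continuous_on orthant h \<and> (\<forall>x\<in>open_orthant. h x = iter_partial l f x)"
      proof (cases l rule: rev_cases)
        case Nil
        then show ?thesis using cf by auto
      next
        case (snoc m i)
        then have "\<exists>h. continuous_on orthant h \<and> (\<forall>x\<in>open_orthant. h x = iter_partial m (d i) x)"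
          using IH[of i] l by simp
        then show ?thesis using eq snoc by simp
      qed
    qed
  qed
  show "?R k f \<Longrightarrow> Ck k f"
  proof (induction k arbitrary: f)
    case (Suc k)
    have "\<exists>h. continuous_on orthant h \<and> (\<forall>x\<in>open_orthant. h x = iter_partial [i] f x)" for i
      using Suc.prems by (elim conjE allE[of _ "[i]"]) simp
    then obtain d where dd: "\<And>i. continuous_on orthant (d i) \<and> (\<forall>x\<in>open_orthant. d i x = iter_partial [i] f x)"
      by metis
    have dc: "continuous_on orthant (d i)" for i using dd by blast
    have d: "d i x = partial_deriv i f x" if "x \<in> open_orthant" for i x using dd[of i] that by simp
    have eq: "iter_partial (l @ [i]) f x = iter_partial l (d i) x" if "x \<in> open_orthant" for l i x
      unfolding iter_partial_snoc
      by (rule iter_partial_cong[OF _ that]) (simp add: d)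
    have deq: "iter_partial (l @ [i]) f differentiable (at x) \<longleftrightarrow> iter_partial l (d i) differentiable (at x)"
      if "x \<in> open_orthant" for l i x
      unfolding differentiable_def
      using has_derivative_transform_within_open[OF _ open_open_orthant that] eq by metis
    have ceq: "continuous_on open_orthant (iter_partial (l @ [i]) f) \<longleftrightarrow> continuous_on open_orthant (iter_partial l (d i))" for l i
      by (rule continuous_on_cong) (auto simp: eq)
    have "Ck k (d i)" for i
    proof (rule Suc.IH, unfold C_k_on_def, intro conjI allI impI ballI)
      show "continuous_on orthant (d i)" by (rule dc)
      fix l :: "'a list"
      show "iter_partial l (d i) differentiable (at x)" if "length l < k" "x \<in> open_orthant" for x
        unfolding deq[OF that(2), symmetric] using Suc.prems that by (simp add: C_k_on_def)
      assume l: "length l \<le> k"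
      show "continuous_on open_orthant (iter_partial l (d i))"
        unfolding ceq[symmetric] using Suc.prems l by (simp add: C_k_on_def)
      have "\<exists>h. continuous_on orthant h \<and> (\<forall>x\<in>open_orthant. h x = iter_partial (l @ [i]) f x)"
        using Suc.prems l by simp
      then show "\<exists>h. continuous_on orthant h \<and> (\<forall>x\<in>open_orthant. h x = iter_partial l (d i) x)"
        using eq by simp
    qed
    moreover have "(f has_derivative (\<lambda>v. \<Sum>i\<in>UNIV. d i x * v $ i)) (at x)" if x: "x \<in> open_orthant" for x
    proof -
      have "f differentiable (at x)"
        using Suc.prems x by (auto simp: C_k_on_def dest!: spec[of _ "[]"])
      then have D: "(f has_derivative frechet_derivative f (at x)) (at x)"
        by (simp add: frechet_derivative_works)
      have lin: "linear (frechet_derivative f (at x))" by (rule has_derivative_linear[OF D])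
      have "frechet_derivative f (at x) v = (\<Sum>i\<in>UNIV. d i x * v $ i)" for v
      proof -
        have "v = (\<Sum>i\<in>UNIV. v $ i *\<^sub>R axis i 1)" by (simp add: basis_expansion flip: scalar_mult_eq_scaleR)
        then have "frechet_derivative f (at x) v = frechet_derivative f (at x) (\<Sum>i\<in>UNIV. v $ i *\<^sub>R axis i 1)" by simp
        also have "\<dots> = (\<Sum>i\<in>UNIV. v $ i * partial_deriv i f x)"
          by (simp add: linear_sum[OF lin] linear_scale[OF lin] partial_deriv_def)
        finally show ?thesis by (simp add: d[OF x] mult.commute)
      qed
      then have "frechet_derivative f (at x) = (\<lambda>v. \<Sum>i\<in>UNIV. d i x * v $ i)" by (rule ext)
      then show ?thesis using D by simp
    qed
    ultimately show ?case using Suc.prems by auto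
  qed simp
qed

lemma Ck_SucI:
  assumes "continuous_on orthant f"
    and "\<And>x. x \<in> open_orthant \<Longrightarrow> (f has_derivative (\<lambda>v. \<Sum>i\<in>UNIV. d i x * v $ i)) (at x)"
    and "\<And>i. Ck k (d i)"
  shows "Ck (Suc k) f"
  using assms by auto

lemma Ck_SucE:
  assumes "Ck (Suc k) f"
  obtains d where "\<And>x. x \<in> open_orthant \<Longrightarrow> (f has_derivative (\<lambda>v. \<Sum>i\<in>UNIV. d i x * v $ i)) (at x)"
    and "\<And>i. Ck k (d i)"
  using assms unfolding Ck.simps by blast

lemma Ck_const: "Ck k (\<lambda>x::real^'n. c)"
proof (induction k arbitrary: c)
  case (Suc k)
  show ?case by (rule Ck_SucI[where d="\<lambda>i x. 0"]) (use Suc in auto)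
qed simp

lemma Ck_component: "Ck k (\<lambda>x::real^'n. x $ j)"
proof (cases k)
  case (Suc m)
  have eq: "(\<lambda>v::real^'n. \<Sum>i\<in>UNIV. (if i = j then 1 else 0) * v $ i) = (\<lambda>v. v $ j)"
    by (rule ext) (simp add: if_distrib[of "\<lambda>c. c * _"] cong: if_cong)
  have "Ck (Suc m) (\<lambda>x::real^'n. x $ j)"
  proof (rule Ck_SucI[where d="\<lambda>i x. if i = j then 1 else 0"], unfold eq)
    show "((\<lambda>x. x $ j) has_derivative (\<lambda>v. v $ j)) (at x)" for x :: "real^'n"
      by (intro bounded_linear_imp_has_derivative bounded_linear_vec_nth)
  qed (auto intro!: Ck_const continuous_intros)
  then show ?thesis using Suc by simp
qed (auto intro!: continuous_intros)

lemma Ck_add: "Ck k f \<Longrightarrow> Ck k g \<Longrightarrow> Ck k (\<lambda>x. f x + g x)"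
proof (induction k arbitrary: f g)
  case 0
  then show ?case by (auto intro: continuous_intros)
next
  case (Suc k)
  obtain d where d: "\<And>x. x \<in> open_orthant \<Longrightarrow> (f has_derivative (\<lambda>v. \<Sum>i\<in>UNIV. d i x * v $ i)) (at x)" "\<And>i. Ck k (d i)"
    using Suc.prems(1) by (rule Ck_SucE) blast
  obtain e where e: "\<And>x. x \<in> open_orthant \<Longrightarrow> (g has_derivative (\<lambda>v. \<Sum>i\<in>UNIV. e i x * v $ i)) (at x)" "\<And>i. Ck k (e i)"
    using Suc.prems(2) by (rule Ck_SucE) blast
  show ?case
  proof (rule Ck_SucI[where d="\<lambda>i x. d i x + e i x"])
    show "continuous_on orthant (\<lambda>x. f x + g x)"
      by (intro continuous_on_add Ck_continuous[OF Suc.prems(1)] Ck_continuous[OF Suc.prems(2)])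
    show "Ck k (\<lambda>x. d i x + e i x)" for i by (intro Suc.IH d e)
    show "((\<lambda>x. f x + g x) has_derivative (\<lambda>v. \<Sum>i\<in>UNIV. (d i x + e i x) * v $ i)) (at x)" if "x \<in> open_orthant" for x
      using has_derivative_add[OF d(1)[OF that] e(1)[OF that]] by (simp add: sum.distrib distrib_right)
  qed
qed

lemma Ck_mult: "Ck k f \<Longrightarrow> Ck k g \<Longrightarrow> Ck k (\<lambda>x. f x * g x)"
proof (induction k arbitrary: f g)
  case 0
  then show ?case by (auto intro: continuous_intros)
next
  case (Suc k)
  obtain d where d: "\<And>x. x \<in> open_orthant \<Longrightarrow> (f has_derivative (\<lambda>v. \<Sum>i\<in>UNIV. d i x * v $ i)) (at x)" "\<And>i. Ck k (d i)"
    using Suc.prems(1) by (rule Ck_SucE) blast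
  obtain e where e: "\<And>x. x \<in> open_orthant \<Longrightarrow> (g has_derivative (\<lambda>v. \<Sum>i\<in>UNIV. e i x * v $ i)) (at x)" "\<And>i. Ck k (e i)"
    using Suc.prems(2) by (rule Ck_SucE) blast
  show ?case
  proof (rule Ck_SucI[where d="\<lambda>i x. f x * e i x + d i x * g x"])
    show "continuous_on orthant (\<lambda>x. f x * g x)"
      by (intro continuous_on_mult Ck_continuous[OF Suc.prems(1)] Ck_continuous[OF Suc.prems(2)])
    show "Ck k (\<lambda>x. f x * e i x + d i x * g x)" for i
      by (rule Ck_add[OF Suc.IH[OF Ck_Suc_imp[OF Suc.prems(1)] e(2)] Suc.IH[OF d(2) Ck_Suc_imp[OF Suc.prems(2)]]])
    show "((\<lambda>x. f x * g x) has_derivative (\<lambda>v. \<Sum>i\<in>UNIV. (f x * e i x + d i x * g x) * v $ i)) (at x)" if "x \<in> open_orthant" for x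
    proof -
      have "(\<Sum>i\<in>UNIV. (f x * e i x + d i x * g x) * v $ i)
          = f x * (\<Sum>i\<in>UNIV. e i x * v $ i) + (\<Sum>i\<in>UNIV. d i x * v $ i) * g x" for v :: "real^'a"
        unfolding sum_distrib_left sum_distrib_right sum.distrib[symmetric]
        by (rule sum.cong) (simp_all add: algebra_simps)
      then show ?thesis using has_derivative_mult[OF d(1)[OF that] e(1)[OF that]] by (simp only:)
    qed
  qed
qed

lemma Ck_scale: "Ck k f \<Longrightarrow> Ck k (\<lambda>x. c * f x)"
  by (intro Ck_mult Ck_const)

text \<open>The one-dimensional analogue of \<open>Ck\<close>, for the outer functions of compositions.\<close>

primrec smooth :: "nat \<Rightarrow> (real \<Rightarrow> real) \<Rightarrow> bool" where
  "smooth 0 p \<longleftrightarrow> continuous_on UNIV p"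
| "smooth (Suc k) p \<longleftrightarrow> (\<exists>p'. (\<forall>t. (p has_real_derivative p' t) (at t)) \<and> smooth k p')"

lemma smooth_continuous: "smooth k p \<Longrightarrow> continuous_on UNIV p"
proof (cases k)
  case (Suc m)
  assume "smooth k p"
  then obtain p' where "\<And>t. (p has_real_derivative p' t) (at t)" using Suc by auto
  then show ?thesis by (intro continuous_at_imp_continuous_on ballI DERIV_isCont)
qed simp

lemma Ck_compose: "Ck k f \<Longrightarrow> smooth k p \<Longrightarrow> Ck k (\<lambda>x. p (f x))"
proof (induction k arbitrary: p)
  case 0
  then show ?case by (auto intro: continuous_on_compose2)
next
  case (Suc k)
  obtain d where d: "\<And>x. x \<in> open_orthant \<Longrightarrow> (f has_derivative (\<lambda>v. \<Sum>i\<in>UNIV. d i x * v $ i)) (at x)" "\<And>i. Ck k (d i)"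
    using Suc.prems(1) by (rule Ck_SucE) blast
  obtain p' where p': "\<And>t. (p has_real_derivative p' t) (at t)" "smooth k p'"
    using Suc.prems(2) by auto
  show ?case
  proof (rule Ck_SucI[where d="\<lambda>i x. p' (f x) * d i x"])
    show "continuous_on orthant (\<lambda>x. p (f x))"
      by (rule continuous_on_compose2[OF smooth_continuous[OF Suc.prems(2)] Ck_continuous[OF Suc.prems(1)]]) simp
    show "Ck k (\<lambda>x. p' (f x) * d i x)" for i
      by (rule Ck_mult[OF Suc.IH[OF Ck_Suc_imp[OF Suc.prems(1)] p'(2)] d(2)])
    show "((\<lambda>x. p (f x)) has_derivative (\<lambda>v. \<Sum>i\<in>UNIV. p' (f x) * d i x * v $ i)) (at x)" if "x \<in> open_orthant" for x
    proof -
      have "(\<Sum>i\<in>UNIV. p' (f x) * d i x * v $ i) = p' (f x) * (\<Sum>i\<in>UNIV. d i x * v $ i)" for v :: "real^'a"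
        unfolding sum_distrib_left by (simp only: mult.assoc)
      then show ?thesis
        using has_derivative_compose[OF d(1)[OF that] p'(1)[of "f x", unfolded has_field_derivative_def]]
        by (simp only:)
    qed
  qed
qed

lemma Ck_real_polynomial_function: "real_polynomial_function (p :: real^'n \<Rightarrow> real) \<Longrightarrow> Ck k p"
proof (induction rule: real_polynomial_function.induct)
  case (linear f)
  then have "linear f" by (rule bounded_linear.linear)
  have eq: "f = (\<lambda>x. \<Sum>i\<in>UNIV. x $ i * f (axis i 1))"
  proof (rule ext)
    fix x :: "real^'n"
    have "x = (\<Sum>i\<in>UNIV. x $ i *\<^sub>R axis i 1)" by (simp add: basis_expansion flip: scalar_mult_eq_scaleR)
    then have "f x = f (\<Sum>i\<in>UNIV. x $ i *\<^sub>R axis i 1)" by simp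
    then show "f x = (\<Sum>i\<in>UNIV. x $ i * f (axis i 1))"
      by (simp add: linear_sum[OF \<open>linear f\<close>] linear_scale[OF \<open>linear f\<close>])
  qed
  have "Ck k (\<lambda>x. \<Sum>i\<in>I. x $ i * f (axis i 1))" for I
    by (induction I rule: infinite_finite_induct) (auto intro!: Ck_const Ck_add Ck_mult Ck_component)
  then show ?case by (subst eq)
qed (auto intro: Ck_const Ck_add Ck_mult)

lemma Cc_orthant_iff:
  "f \<in> Cc orthant \<longleftrightarrow> continuous_on orthant f \<and> (\<exists>R. \<forall>x\<in>orthant. f x \<noteq> 0 \<longrightarrow> norm x \<le> R)"
proof -
  let ?S = "{x \<in> orthant. f x \<noteq> 0}"
  have "closure ?S \<subseteq> orthant" by (rule closure_minimal[OF _ closed_orthant]) auto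
  then have "orthant \<inter> closure ?S = closure ?S" by auto
  then have "compact (orthant \<inter> closure ?S) \<longleftrightarrow> bounded ?S"
    using bounded_closure bounded_subset[OF _ closure_subset] by (auto simp: compact_eq_bounded_closed)
  then show ?thesis by (auto simp: Cc_def bounded_iff)
qed

lemma Cck_iff: "f \<in> Cck k \<longleftrightarrow> Ck k f \<and> (\<exists>R. \<forall>x\<in>orthant. f x \<noteq> 0 \<longrightarrow> norm x \<le> R)"
  unfolding Cck_def Ck_iff[of k f] using Cc_orthant_iff[of f] by blast

subsection \<open>The extended partial derivatives\<close>

text \<open>A continuous function on the closed orthant is determined by its values in the interior, so every continuous
extension of the partial derivative is the extended partial derivative.\<close>

lemma ext_partial_eq:
  assumes h: "continuous_on orthant h" and d: "\<And>x. x \<in> open_orthant \<Longrightarrow> partial_deriv i f x = h x" and x: "x \<in> orthant"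
  shows "ext_partial i f x = h x"
  unfolding ext_partial_def
proof (rule tendsto_Lim[OF at_within_open_orthant_neq_bot[OF x]])
  show "(partial_deriv i f \<longlongrightarrow> h x) (at x within open_orthant)"
    by (rule Lim_transform_eventually[OF orthant_continuous_tendsto[OF h x]])
      (simp add: d eventually_at_filter)
qed

lemma
  assumes "Ck (Suc k) f"
  shows ext_partial_continuous: "continuous_on orthant (ext_partial i f)"
    and ext_partial_derivative: "x \<in> open_orthant \<Longrightarrow> (f has_derivative (\<lambda>v. \<Sum>i\<in>UNIV. ext_partial i f x * v $ i)) (at x)"
proof -
  obtain d where d: "\<And>x. x \<in> open_orthant \<Longrightarrow> (f has_derivative (\<lambda>v. \<Sum>i\<in>UNIV. d i x * v $ i)) (at x)" "\<And>i. Ck k (d i)"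
    using assms by (rule Ck_SucE) blast
  have eq: "ext_partial i f x = d i x" if "x \<in> orthant" for i x
  proof (rule ext_partial_eq[OF Ck_continuous[OF d(2)[of i]] _ that])
    show "partial_deriv i f y = d i y" if "y \<in> open_orthant" for y
      using partial_deriv_gradient[of f d y i] d(1)[OF that] by simp
  qed
  show "continuous_on orthant (ext_partial i f)"
    using Ck_continuous[OF d(2)[of i]] eq by (subst continuous_on_cong[OF refl]) auto
  show "(f has_derivative (\<lambda>v. \<Sum>i\<in>UNIV. ext_partial i f x * v $ i)) (at x)" if x: "x \<in> open_orthant"
    using d(1)[OF x] by (simp only: eq[OF subsetD[OF open_orthant_subset x]])
qed

lemma ext_partial_eqI:
  assumes "continuous_on orthant h"
    and "\<And>x. x \<in> open_orthant \<Longrightarrow> (f has_derivative (\<lambda>v. \<Sum>i\<in>UNIV. d i x * v $ i)) (at x)"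
    and "\<And>x. x \<in> orthant \<Longrightarrow> d i x = h x" and "x \<in> orthant"
  shows "ext_partial i f x = d i x"
proof -
  have "ext_partial i f x = h x"
  proof (rule ext_partial_eq[OF assms(1) _ assms(4)])
    show "partial_deriv i f y = h y" if y: "y \<in> open_orthant" for y
    proof -
      have "y \<in> orthant" using y open_orthant_subset by blast
      then show ?thesis using partial_deriv_gradient[of f d y i] assms(2)[OF y] assms(3)[of y] by simp
    qed
  qed
  then show ?thesis using assms(3)[OF assms(4)] by simp
qed

lemma ext_partial_add:
  assumes f: "Ck (Suc k) f" and g: "Ck (Suc k) g" and x: "x \<in> orthant"
  shows "ext_partial i (\<lambda>x. f x + g x) x = ext_partial i f x + ext_partial i g x"
proof (rule ext_partial_eqI[where d="\<lambda>i x. ext_partial i f x + ext_partial i g x", OF _ _ refl x])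
  show "continuous_on orthant (\<lambda>x. ext_partial i f x + ext_partial i g x)"
    by (intro continuous_on_add ext_partial_continuous[OF f] ext_partial_continuous[OF g])
  show "((\<lambda>x. f x + g x) has_derivative (\<lambda>v. \<Sum>i\<in>UNIV. (ext_partial i f x + ext_partial i g x) * v $ i)) (at x)"
    if "x \<in> open_orthant" for x
    using has_derivative_add[OF ext_partial_derivative[OF f that] ext_partial_derivative[OF g that]]
    by (simp add: sum.distrib distrib_right)
qed

lemma ext_partial_compose:
  assumes f: "Ck (Suc k) f" and p: "\<And>t. (p has_real_derivative p' t) (at t)" "continuous_on UNIV p'" and x: "x \<in> orthant"
  shows "ext_partial i (\<lambda>x. p (f x)) x = p' (f x) * ext_partial i f x"
proof (rule ext_partial_eqI[where d="\<lambda>i x. p' (f x) * ext_partial i f x", OF _ _ refl x])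
  show "continuous_on orthant (\<lambda>x. p' (f x) * ext_partial i f x)"
    by (intro continuous_on_mult ext_partial_continuous[OF f] continuous_on_compose2[OF p(2) Ck_continuous[OF f]]) simp
  show "((\<lambda>x. p (f x)) has_derivative (\<lambda>v. \<Sum>i\<in>UNIV. p' (f x) * ext_partial i f x * v $ i)) (at x)"
    if "x \<in> open_orthant" for x
  proof -
    have "(\<Sum>i\<in>UNIV. p' (f x) * ext_partial i f x * v $ i) = p' (f x) * (\<Sum>i\<in>UNIV. ext_partial i f x * v $ i)"
      for v :: "real^'a"
      unfolding sum_distrib_left by (simp only: mult.assoc)
    then show ?thesis
      using has_derivative_compose[OF ext_partial_derivative[OF f that] p(1)[of "f x", unfolded has_field_derivative_def]]
      by (simp only:)
  qed
qed

lemma ext_partial_scale: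
  assumes f: "Ck (Suc k) f" and x: "x \<in> orthant"
  shows "ext_partial i (\<lambda>x. c * f x) x = c * ext_partial i f x"
  by (rule ext_partial_compose[OF f _ _ x]) (auto intro!: derivative_eq_intros)

lemma ext_partial_support:
  assumes R: "\<And>x. x \<in> orthant \<Longrightarrow> f x \<noteq> 0 \<Longrightarrow> norm x \<le> R" and x: "x \<in> orthant" "norm x > R"
  shows "ext_partial i f x = 0"
  unfolding ext_partial_def
proof (rule tendsto_Lim[OF at_within_open_orthant_neq_bot[OF x(1)]])
  have pd: "partial_deriv i f y = 0" if y: "y \<in> open_orthant" "norm y > R" for y
  proof -
    let ?U = "open_orthant \<inter> {y. norm y > R}"
    have "open ?U" by (intro open_Int open_open_orthant open_Collect_less continuous_intros)
    have "f z = 0" if "z \<in> ?U" for z using R[of z] that open_orthant_subset by force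
    then have "(f has_derivative (\<lambda>v. 0)) (at y)"
      using \<open>open ?U\<close> y
      by (intro has_derivative_transform_within_open[OF has_derivative_const[of 0], of ?U]) simp_all
    then have "(f has_derivative (\<lambda>v. \<Sum>i\<in>UNIV. (\<lambda>i x. 0) i y * v $ i)) (at y)" by simp
    then show ?thesis by (rule partial_deriv_gradient)
  qed
  have "\<forall>\<^sub>F y in at x within open_orthant. y \<in> open_orthant \<and> norm y > R"
  proof (intro eventually_conj)
    show "\<forall>\<^sub>F y in at x within open_orthant. y \<in> open_orthant" by (simp add: eventually_at_filter)
    show "\<forall>\<^sub>F y in at x within open_orthant. norm y > R"
      using x(2) by (intro order_tendstoD(1)[of norm "norm x"] tendsto_norm) (auto intro: tendsto_ident_at)
  qed
  then have "\<forall>\<^sub>F y in at x within open_orthant. 0 = partial_deriv i f y"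
    by eventually_elim (simp add: pd)
  from Lim_transform_eventually[OF tendsto_const this]
  show "(partial_deriv i f \<longlongrightarrow> 0) (at x within open_orthant)" .
qed

lemma bounded_of_support:
  fixes h :: "real^'n \<Rightarrow> real"
  assumes h: "continuous_on orthant h" and R: "\<And>x. x \<in> orthant \<Longrightarrow> norm x > R \<Longrightarrow> h x = 0"
  shows "\<exists>C. \<forall>x\<in>orthant. \<bar>h x\<bar> \<le> C"
proof -
  have "compact (h ` (orthant \<inter> cball 0 R))"
    by (intro compact_continuous_image continuous_on_subset[OF h] closed_Int_compact closed_orthant) auto
  then obtain C where C: "\<forall>y\<in>h ` (orthant \<inter> cball 0 R). norm y \<le> C"
    using compact_imp_bounded bounded_iff by blast
  have "\<bar>h x\<bar> \<le> max C 0" if "x \<in> orthant" for x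
  proof (cases "norm x \<le> R")
    case True
    then have "norm (h x) \<le> C" using C that by auto
    then show ?thesis by simp
  qed (use R[OF that] in simp)
  then show ?thesis by blast
qed

lemma Cc_bounded: "f \<in> Cc orthant \<Longrightarrow> \<exists>C. \<forall>x\<in>orthant. \<bar>f x\<bar> \<le> C"
proof -
  assume "f \<in> Cc orthant"
  then obtain R where c: "continuous_on orthant f" and R: "\<And>x. x \<in> orthant \<Longrightarrow> f x \<noteq> 0 \<Longrightarrow> norm x \<le> R"
    unfolding Cc_orthant_iff by blast
  show ?thesis
  proof (rule bounded_of_support[OF c])
    show "f x = 0" if "x \<in> orthant" "norm x > R" for x
      using R[OF that(1)] that(2) by force
  qed
qed

lemma Cck_imp_Ck: "f \<in> Cck k \<Longrightarrow> Ck k f"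
  by (simp add: Cck_iff)

lemma Cck_imp_Cc: "f \<in> Cck k \<Longrightarrow> f \<in> Cc orthant"
  by (simp add: Cck_def)

lemma ext_partial_bounded:
  assumes "f \<in> Cck (Suc k)"
  shows "\<exists>C. \<forall>x\<in>orthant. \<bar>ext_partial i f x\<bar> \<le> C"
proof -
  obtain R where R: "\<And>x. x \<in> orthant \<Longrightarrow> f x \<noteq> 0 \<Longrightarrow> norm x \<le> R" using assms by (auto simp: Cck_iff)
  show ?thesis
    by (rule bounded_of_support[OF ext_partial_continuous[OF Cck_imp_Ck[OF assms]]])
      (rule ext_partial_support[OF R])
qed

definition upd :: "real^'n \<Rightarrow> 'n \<Rightarrow> real \<Rightarrow> real^'n" where
  "upd x i t = (\<chi> j. if j = i then t else x $ j)"

lemma upd_nth [simp]: "upd x i t $ j = (if j = i then t else x $ j)"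
  by (simp add: upd_def)

lemma upd_orthant: "x \<in> orthant \<Longrightarrow> t \<ge> 0 \<Longrightarrow> upd x i t \<in> orthant"
  by (simp add: orthant_def)

lemma upd_derivative: "((\<lambda>t. upd x i t) has_derivative (\<lambda>h. h *\<^sub>R axis i 1)) (at t)"
proof -
  have eq: "upd x i = (\<lambda>t. upd x i 0 + t *\<^sub>R axis i 1)"
    by (auto simp: fun_eq_iff vec_eq_iff axis_def)
  show ?thesis by (subst eq) (auto intro!: derivative_eq_intros)
qed

text \<open>On a face, the extended partial derivative in a direction tangential to the face is the derivative of the
restriction, although \<open>f\<close> is only known to be differentiable in the interior: the mean value theorem is applied on
parallel segments in the interior, shifted by \<open>\<epsilon>\<close>, and gives an estimate that persists as \<open>\<epsilon>\<close> tends to zero.\<close>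

lemma face_derivative:
  assumes f: "Ck (Suc k) f" and x: "x \<in> orthant" and t: "t > 0"
  shows "((\<lambda>t. f (upd x i t)) has_real_derivative ext_partial i f (upd x i t)) (at t)"
  unfolding DERIV_def
proof (rule LIM_I)
  let ?d = "ext_partial i f" and ?z = "upd x i t"
  fix e :: real assume "e > 0"
  then have e2: "e/2 > 0" by simp
  have z: "?z \<in> orthant" using x t by (intro upd_orthant) auto
  obtain \<delta> where \<delta>: "\<delta> > 0" "\<And>y. y \<in> orthant \<Longrightarrow> dist y ?z < \<delta> \<Longrightarrow> dist (?d y) (?d ?z) < e/2"
    using ext_partial_continuous[OF f, of i] z e2 unfolding continuous_on_iff by metis
  define r where "r = min (\<delta>/2) t"
  have r: "r > 0" using \<delta> t by (simp add: r_def)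
  have "norm ((f (upd x i (t + h)) - f ?z) / h - ?d ?z) < e" if h: "h \<noteq> 0" "norm (h - 0) < r" for h
  proof -
    have th: "t + h > 0" "\<bar>h\<bar> < \<delta>/2" using h by (auto simp: r_def)
    have bound: "\<bar>f (shift (upd x i (t + h)) \<epsilon>) - f (shift ?z \<epsilon>) - h * ?d ?z\<bar> \<le> e/2 * \<bar>h\<bar>"
      if \<epsilon>: "\<epsilon> > 0" "norm (\<epsilon> *\<^sub>R ((\<chi> i. 1)::real^'a)) < \<delta>/2" for \<epsilon>
    proof -
      define g where "g \<tau> = f (shift (upd x i \<tau>) \<epsilon>) - \<tau> * ?d ?z" for \<tau>
      have "norm (g (t + h) - g t) \<le> e/2 * norm ((t + h) - t)"
      proof (rule field_differentiable_bound[where S="closed_segment t (t + h)"])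
        fix \<tau> assume \<tau>: "\<tau> \<in> closed_segment t (t + h)"
        then have \<tau>t: "\<bar>\<tau> - t\<bar> \<le> \<bar>h\<bar>" "\<tau> > 0"
          using th(1) t by (auto simp: closed_segment_eq_real_ivl split: if_splits)
        let ?y = "shift (upd x i \<tau>) \<epsilon>"
        have y: "?y \<in> open_orthant" using x \<tau>t \<epsilon> by (intro shift_open_orthant upd_orthant) auto
        have shd: "((\<lambda>\<tau>. shift (upd x i \<tau>) \<epsilon>) has_derivative (\<lambda>h. h *\<^sub>R axis i 1)) (at \<tau>)"
          unfolding shift_def by (auto intro!: derivative_eq_intros upd_derivative)
        have "((\<lambda>\<tau>. f (shift (upd x i \<tau>) \<epsilon>)) has_derivative
            (\<lambda>h. \<Sum>j\<in>UNIV. ext_partial j f ?y * (h *\<^sub>R axis i 1 :: real^'a) $ j)) (at \<tau>)"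
          by (rule has_derivative_compose[OF shd ext_partial_derivative[OF f y]])
        moreover have "(\<Sum>j\<in>UNIV. ext_partial j f ?y * (h *\<^sub>R axis i 1 :: real^'a) $ j) = ?d ?y * h" for h
          by (simp add: axis_def if_distrib[of "\<lambda>c. _ * (_ * c)"] cong: if_cong)
        ultimately have "((\<lambda>\<tau>. f (shift (upd x i \<tau>) \<epsilon>)) has_real_derivative ?d ?y) (at \<tau>)"
          by (simp add: has_field_derivative_def)
        then have "(g has_real_derivative ?d ?y - ?d ?z) (at \<tau>)"
          unfolding g_def by (auto intro!: derivative_eq_intros)
        then show "(g has_field_derivative ?d ?y - ?d ?z) (at \<tau> within closed_segment t (t + h))"
          by (rule has_field_derivative_at_within)
        have "?y - ?z = (\<tau> - t) *\<^sub>R axis i 1 + \<epsilon> *\<^sub>R ((\<chi> i. 1)::real^'a)"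
          by (auto simp: shift_def vec_eq_iff axis_def)
        then have "dist ?y ?z \<le> \<bar>\<tau> - t\<bar> + norm (\<epsilon> *\<^sub>R ((\<chi> i. 1)::real^'a))"
          using norm_triangle_ineq[of "(\<tau> - t) *\<^sub>R axis i 1" "\<epsilon> *\<^sub>R ((\<chi> i. 1)::real^'a)"]
          by (simp add: dist_norm)
        also have "\<dots> < \<delta>" using \<tau>t th \<epsilon> by simp
        finally have "dist (?d ?y) (?d ?z) < e/2" using y open_orthant_subset by (intro \<delta>) auto
        then show "norm (?d ?y - ?d ?z) \<le> e/2" by (simp add: dist_norm)
      qed auto
      then show ?thesis by (simp add: g_def algebra_simps)
    qed
    have "((\<lambda>\<epsilon>. \<bar>f (shift (upd x i (t + h)) \<epsilon>) - f (shift ?z \<epsilon>) - h * ?d ?z\<bar>) \<longlongrightarrow>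
        \<bar>f (upd x i (t + h)) - f ?z - h * ?d ?z\<bar>) (at_right 0)"
    proof (intro tendsto_intros)
      have z': "upd x i (t + h) \<in> orthant" using x th by (intro upd_orthant) auto
      show "((\<lambda>\<epsilon>. f (shift (upd x i (t + h)) \<epsilon>)) \<longlongrightarrow> f (upd x i (t + h))) (at_right 0)"
        by (rule filterlim_compose[OF orthant_continuous_tendsto[OF Ck_continuous[OF f] z'] shift_filterlim[OF z']])
      show "((\<lambda>\<epsilon>. f (shift ?z \<epsilon>)) \<longlongrightarrow> f ?z) (at_right 0)"
        by (rule filterlim_compose[OF orthant_continuous_tendsto[OF Ck_continuous[OF f] z] shift_filterlim[OF z]])
    qed
    moreover have "\<forall>\<^sub>F \<epsilon> in at_right 0. \<bar>f (shift (upd x i (t + h)) \<epsilon>) - f (shift ?z \<epsilon>) - h * ?d ?z\<bar> \<le> e/2 * \<bar>h\<bar>"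
    proof -
      have "((\<lambda>\<epsilon>. norm (\<epsilon> *\<^sub>R ((\<chi> i. 1)::real^'a))) \<longlongrightarrow> norm (0 *\<^sub>R ((\<chi> i. 1)::real^'a))) (at_right 0)"
        by (intro tendsto_intros)
      then have "\<forall>\<^sub>F \<epsilon> in at_right 0. norm (\<epsilon> *\<^sub>R ((\<chi> i. 1)::real^'a)) < \<delta>/2"
        using \<delta>(1) by (intro order_tendstoD) auto
      moreover have "\<forall>\<^sub>F \<epsilon> in at_right (0::real). \<epsilon> > 0" by (simp add: eventually_at_filter)
      ultimately show ?thesis by eventually_elim (rule bound)
    qed
    ultimately have "\<bar>f (upd x i (t + h)) - f ?z - h * ?d ?z\<bar> \<le> e/2 * \<bar>h\<bar>"
      by (rule tendsto_upperbound) simp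
    moreover have "(f (upd x i (t + h)) - f ?z) / h - ?d ?z = (f (upd x i (t + h)) - f ?z - h * ?d ?z) / h"
      using h by (simp add: diff_divide_distrib)
    ultimately have "norm ((f (upd x i (t + h)) - f ?z) / h - ?d ?z) \<le> e/2"
      using h by (simp add: abs_divide field_simps)
    then show ?thesis using \<open>e > 0\<close> by simp
  qed
  then show "\<exists>s>0. \<forall>h. h \<noteq> 0 \<and> norm (h - 0) < s \<longrightarrow> norm ((f (upd x i (t + h)) - f ?z) / h - ?d ?z) < e"
    using r by blast
qed

section \<open>The measures on the faces\<close>

text \<open>The one-dimensional factors of the product measure \<open>lam B\<close>.\<close>

definition face_factor :: "'n set \<Rightarrow> 'n \<Rightarrow> real measure" where
  "face_factor B i = (if i \<in> B then restrict_space lborel {0..} else return (restrict_space borel {0..}) 0)"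

lemma sets_face_factor [measurable_cong, simp]: "sets (face_factor B i) = sets (restrict_space borel {0..})"
  by (simp add: face_factor_def sets_restrict_space)

lemma space_face_factor [simp]: "space (face_factor B i) = {0..}"
  by (simp add: face_factor_def space_restrict_space)

lemma sigma_finite_face_factor: "sigma_finite_measure (face_factor B i)"
proof (cases "i \<in> B")
  case True
  then show ?thesis
    by (auto simp: face_factor_def intro!: sigma_finite_measure_restrict_space sigma_finite_lborel)
next
  case False
  then show ?thesis
    by (auto simp: face_factor_def space_restrict_space
        intro!: prob_space_imp_sigma_finite prob_space_return)
qed

interpretation face_product: product_sigma_finite "face_factor B" for B
  by (rule product_sigma_finite.intro, rule sigma_finite_face_factor)

lemma sets_lam [measurable_cong, simp]: "sets (lam B) = sets (restrict_space borel orthant)"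
  by (simp add: lam_def)

lemma space_lam [simp]: "space (lam B) = orthant"
  by (simp add: lam_def space_restrict_space)

lemma sets_lam_s [measurable_cong, simp]: "sets (lam_s s B) = sets (restrict_space borel orthant)"
  by (simp add: lam_s_def)

lemma space_lam_s [simp]: "space (lam_s s B) = orthant"
  by (simp add: lam_s_def space_scale_measure)

lemma orthant_borel [measurable]: "orthant \<in> sets borel"
  by (intro borel_closed closed_orthant)

lemma measurable_orthant: "f \<in> borel_measurable borel \<Longrightarrow> f \<in> borel_measurable (restrict_space borel orthant)"
  by (rule measurable_restrict_space1)

lemma continuous_measurable_orthant:
  fixes f :: "real^'n \<Rightarrow> real"
  shows "continuous_on orthant f \<Longrightarrow> f \<in> borel_measurable (restrict_space borel orthant)"
  by (rule borel_measurable_continuous_on_restrict)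

lemma vec_measurable:
  "(\<lambda>\<omega>. \<chi> i. \<omega> i) \<in> measurable (Pi\<^sub>M UNIV (face_factor B)) (restrict_space borel (orthant :: (real^'n) set))"
proof (rule measurable_restrict_space2)
  show "(\<lambda>\<omega>. \<chi> i. \<omega> i) \<in> space (Pi\<^sub>M UNIV (face_factor B)) \<rightarrow> (orthant :: (real^'n) set)"
    by (auto simp: space_PiM orthant_def PiE_def Pi_def)
  have comp: "(\<lambda>\<omega>. \<omega> i) \<in> borel_measurable (Pi\<^sub>M UNIV (face_factor B))" for i :: 'n
  proof -
    have "(\<lambda>\<omega>. \<omega> i) \<in> measurable (Pi\<^sub>M UNIV (face_factor B)) (restrict_space borel {0..})"
      using measurable_component_singleton[of i UNIV "face_factor B"]
      by (simp add: measurable_cong_sets[OF refl sets_face_factor])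
    then show ?thesis by (simp add: measurable_restrict_space2_iff)
  qed
  show "(\<lambda>\<omega>. (\<chi> i. \<omega> i) :: real^'n) \<in> borel_measurable (Pi\<^sub>M UNIV (face_factor B))"
  proof (rule borel_measurable_euclidean_space[THEN iffD2], rule ballI)
    fix v :: "real^'n" assume "v \<in> Basis"
    then obtain i where "v = axis i 1" by (auto simp: Basis_vec_def)
    then have "(\<lambda>\<omega>. (\<chi> i. \<omega> i) \<bullet> v) = (\<lambda>\<omega>. \<omega> i)" by (simp add: inner_axis fun_eq_iff)
    then show "(\<lambda>\<omega>. (\<chi> i. \<omega> i) \<bullet> v) \<in> borel_measurable (Pi\<^sub>M UNIV (face_factor B))"
      by (simp only: comp)
  qed
qed

lemma lam_eq_distr: "lam B = distr (Pi\<^sub>M UNIV (face_factor B)) (restrict_space borel orthant) (\<lambda>\<omega>. \<chi> i. \<omega> i)"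
  unfolding lam_def face_factor_def[abs_def] by (rule refl)

lemma lam_s_density: "lam_s s (B :: 'n::finite set) = density (lam B) (\<lambda>_. ennreal (s ^ (CARD('n) - card B)))"
  by (rule measure_eqI) (auto simp: lam_s_def emeasure_density_const)

lemma sets_m_s [measurable_cong, simp]: "sets (m_s s) = sets (restrict_space borel orthant)"
  using sets.sets_measure_of_eq[of "restrict_space borel orthant"]
  by (simp add: m_s_def space_restrict_space)

lemma space_m_s [simp]: "space (m_s s) = orthant"
  using sets_eq_imp_space_eq[OF sets_m_s[of s]] by (simp add: space_restrict_space)

lemma emeasure_m_s:
  assumes "A \<in> sets (restrict_space borel (orthant :: (real^'n) set))"
  shows "emeasure (m_s s) A = (\<Sum>B\<in>UNIV. emeasure (lam_s s B) A)"
proof -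
  have "countably_additive (sets (restrict_space borel (orthant :: (real^'n) set)))
      (\<lambda>A. \<Sum>B\<in>UNIV. emeasure (lam_s s B) A)"
  proof (rule countably_additiveI)
    fix A :: "nat \<Rightarrow> (real^'n) set"
    assume A: "range A \<subseteq> sets (restrict_space borel orthant)" "disjoint_family A"
    have "(\<Sum>k. \<Sum>B\<in>UNIV. emeasure (lam_s s B) (A k)) = (\<Sum>B\<in>UNIV. \<Sum>k. emeasure (lam_s s B) (A k))"
      by (rule suminf_sum) (rule summableI)
    also have "\<dots> = (\<Sum>B\<in>UNIV. emeasure (lam_s s B) (\<Union>k. A k))"
      using A by (intro sum.cong refl suminf_emeasure) simp_all
    finally show "(\<Sum>k. \<Sum>B\<in>UNIV. emeasure (lam_s s B) (A k)) = (\<Sum>B\<in>UNIV. emeasure (lam_s s B) (\<Union>k. A k))" .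
  qed
  moreover have "positive (sets (restrict_space borel (orthant :: (real^'n) set))) (\<lambda>A. \<Sum>B\<in>UNIV. emeasure (lam_s s B) A)"
    by (simp add: positive_def)
  moreover have "sigma_algebra (orthant :: (real^'n) set) (sets (restrict_space borel orthant))"
    using sets.sigma_algebra_axioms[of "restrict_space borel (orthant :: (real^'n) set)"] by (simp add: space_restrict_space)
  ultimately show ?thesis
    unfolding m_s_def using assms by (intro emeasure_measure_of_sigma)
qed

lemma lam_s_le: "lam_s s B \<le> m_s s"
proof -
  have "emeasure (lam_s s B) A \<le> emeasure (m_s s) A" for A
  proof (cases "A \<in> sets (restrict_space borel orthant)")
    case True
    then show ?thesis unfolding emeasure_m_s[OF True] by (intro member_le_sum) auto
  qed (simp add: emeasure_notin_sets)
  then show ?thesis by (simp add: le_measure_iff le_fun_def)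
qed

lemma AE_lam_s:
  assumes "AE x in m_s s. P x"
  shows "AE x in lam_s s B. P x"
proof -
  obtain N where N: "N \<in> sets (m_s s)" "emeasure (m_s s) N = 0" "{x \<in> space (m_s s). \<not> P x} \<subseteq> N"
    using assms by (auto elim: AE_E)
  have "emeasure (lam_s s B) N \<le> emeasure (m_s s) N" by (rule le_measureD3[OF lam_s_le]) simp
  then show ?thesis using N by (intro AE_I[of _ _ N]) auto
qed

lemma nn_integral_lam_s_le: "(\<integral>\<^sup>+x. f x \<partial>lam_s s B) \<le> (\<integral>\<^sup>+x. f x \<partial>m_s s)"
  by (rule nn_integral_mono_measure[OF _ lam_s_le]) simp

lemma sets_mu [measurable_cong, simp]: "sets (mu s \<rho>) = sets (restrict_space borel orthant)"
  and space_mu [simp]: "space (mu s \<rho>) = orthant"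
  by (simp_all add: mu_def)

lemma sets_mu_face [measurable_cong, simp]: "sets (mu_face s \<rho> B) = sets (restrict_space borel orthant)"
  and space_mu_face [simp]: "space (mu_face s \<rho> B) = orthant"
  by (simp_all add: mu_face_def)

lemma measurable_mu_iff: "borel_measurable (mu s \<rho>) = borel_measurable (restrict_space borel orthant)"
  and measurable_mu_face_iff: "borel_measurable (mu_face s \<rho> B) = borel_measurable (restrict_space borel orthant)"
  and measurable_lam_s_iff: "borel_measurable (lam_s s B) = borel_measurable (restrict_space borel orthant)"
  and measurable_lam_iff: "borel_measurable (lam B) = borel_measurable (restrict_space borel orthant)"
  and measurable_m_s_iff: "borel_measurable (m_s s) = borel_measurable (restrict_space borel orthant)"
  by (intro measurable_cong_sets; simp)+

subsection \<open>Integration by parts on a face\<close>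

lemma upd_upd [simp]: "upd (upd x i t) i t' = upd x i t'"
  by (simp add: vec_eq_iff)

lemma upd_continuous: "continuous_on S (\<lambda>t. upd x i t)"
  using has_derivative_continuous[OF upd_derivative] continuous_at_imp_continuous_on by blast

lemma integral_derivative_zero:
  fixes G g :: "real \<Rightarrow> real"
  assumes "a < b" and "\<And>t. a \<le> t \<Longrightarrow> t \<le> b \<Longrightarrow> (G has_real_derivative g t) (at t)"
    and "\<And>t. a \<le> t \<Longrightarrow> t \<le> b \<Longrightarrow> isCont g t" and "G a = 0" "G b = 0"
  shows "(\<integral>t. indicator {a<..<b} t * g t \<partial>lborel) = 0"
proof -
  have "(\<integral>t. indicator {a<..<b} t * g t \<partial>lborel) = (\<integral>t. g t * indicator {a..b} t \<partial>lborel)"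
  proof (rule integral_cong_AE)
    have "(\<lambda>t. indicator {a..b} t *\<^sub>R g t) \<in> borel_measurable borel"
      by (rule borel_measurable_continuous_on_indicator)
        (auto intro!: continuous_at_imp_continuous_on assms(3))
    then show gm: "(\<lambda>t. g t * indicator {a..b} t) \<in> borel_measurable lborel"
      by (simp add: mult.commute)
    have "(\<lambda>t. indicator {a<..<b} t * (g t * indicator {a..b} t)) \<in> borel_measurable lborel"
      by (rule borel_measurable_times[OF _ gm]) simp
    moreover have "indicator {a<..<b} t * (g t * indicator {a..b} t) = indicator {a<..<b} t * g t" for t
      by (auto simp: indicator_def)
    ultimately show "(\<lambda>t. indicator {a<..<b} t * g t) \<in> borel_measurable lborel" by simp
    have "AE t in lborel. t \<noteq> a" "AE t in lborel. t \<noteq> b" by (rule AE_lborel_singleton)+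
    then show "AE t in lborel. indicator {a<..<b} t * g t = g t * indicator {a..b} t"
      by eventually_elim (auto simp: indicator_def)
  qed
  also have "\<dots> = G b - G a"
    using assms by (intro integral_FTC_Icc_real) auto
  finally show ?thesis using assms by simp
qed

text \<open>The integrand is the derivative of \<open>u p\<close> in the direction \<open>i\<close>, and \<open>p\<close> vanishes at the end points \<open>a\<close> and \<open>b\<close>. The set
\<open>A\<close> is a cylinder in this direction, so for fixed other coordinates the inner integral of Fubini's theorem
runs over all of \<open>(a, b)\<close> or is empty.\<close>

lemma lam_integral_by_parts:
  fixes u d :: "real^'n \<Rightarrow> real"
  assumes iB: "i \<in> B" and a: "0 < a" "a < b"
    and A: "A \<in> sets borel" "A \<subseteq> orthant" "emeasure (lam B) A < \<infinity>"
    and cyl: "\<And>x. x \<in> A \<Longrightarrow> a < x $ i \<and> x $ i < b" "\<And>x t. x \<in> A \<Longrightarrow> a < t \<Longrightarrow> t < b \<Longrightarrow> upd x i t \<in> A"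
    and u: "continuous_on orthant u" "\<And>x. x \<in> orthant \<Longrightarrow> \<bar>u x\<bar> \<le> C"
    and d: "continuous_on orthant d" "\<And>x. x \<in> orthant \<Longrightarrow> \<bar>d x\<bar> \<le> C'"
    and der: "\<And>x t. x \<in> orthant \<Longrightarrow> t > 0 \<Longrightarrow> ((\<lambda>t. u (upd x i t)) has_real_derivative d (upd x i t)) (at t)"
    and p: "\<And>t. (p has_real_derivative p' t) (at t)" "continuous_on UNIV p'" "p a = 0" "p b = 0"
  shows "(\<integral>x. indicator A x * (d x * p (x $ i) + u x * p' (x $ i)) \<partial>lam B) = 0"
proof -
  define F where "F x = indicator A x * (d x * p (x $ i) + u x * p' (x $ i))" for x
  have pc: "continuous_on UNIV p" using p(1) by (intro continuous_at_imp_continuous_on ballI DERIV_isCont)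
  have Fc: "continuous_on orthant (\<lambda>x. d x * p (x $ i) + u x * p' (x $ i))"
    by (intro continuous_intros u d continuous_on_compose2[OF pc] continuous_on_compose2[OF p(2)]) auto
  have Fm: "F \<in> borel_measurable (restrict_space borel orthant)"
    unfolding F_def
    by (intro borel_measurable_times continuous_measurable_orthant[OF Fc] measurable_orthant borel_measurable_indicator A)
  have "bounded (p ` {a..b})"
    by (intro compact_imp_bounded compact_continuous_image continuous_on_subset[OF pc]) auto
  then obtain K1 where "\<forall>y\<in>p ` {a..b}. norm y \<le> K1" unfolding bounded_iff by blast
  then have K1: "\<bar>p t\<bar> \<le> K1" if "t \<in> {a..b}" for t using that by simp
  have "bounded (p' ` {a..b})"
    by (intro compact_imp_bounded compact_continuous_image continuous_on_subset[OF p(2)]) auto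
  then obtain K2 where "\<forall>y\<in>p' ` {a..b}. norm y \<le> K2" unfolding bounded_iff by blast
  then have K2: "\<bar>p' t\<bar> \<le> K2" if "t \<in> {a..b}" for t using that by simp
  have bound: "\<bar>F x\<bar> \<le> (C' * K1 + C * K2) * indicator A x" for x
  proof (cases "x \<in> A")
    case True
    have x: "x \<in> orthant" "x $ i \<in> {a..b}" using True A cyl(1)[OF True] by auto
    have "\<bar>d x * p (x $ i) + u x * p' (x $ i)\<bar> \<le> \<bar>d x\<bar> * \<bar>p (x $ i)\<bar> + \<bar>u x\<bar> * \<bar>p' (x $ i)\<bar>"
      by (rule order_trans[OF abs_triangle_ineq]) (simp add: abs_mult)
    also have "\<dots> \<le> C' * K1 + C * K2"
      using u(2)[OF x(1)] d(2)[OF x(1)] K1[OF x(2)] K2[OF x(2)] by (intro add_mono mult_mono) auto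
    finally show ?thesis using True by (simp add: F_def)
  qed (simp add: F_def)
  have A': "A \<in> sets (lam B)" using A by (simp add: sets_restrict_space_iff)
  have Fint: "integrable (lam B) F"
  proof (rule Bochner_Integration.integrable_bound)
    show "integrable (lam B) (\<lambda>x. (C' * K1 + C * K2) * indicator A x)"
      using A A' by (intro integrable_mult_right integrable_real_indicator) auto
    show "F \<in> borel_measurable (lam B)" using Fm by (simp add: measurable_lam_iff)
    show "AE x in lam B. norm (F x) \<le> norm ((C' * K1 + C * K2) * indicator A x)"
      using bound by (intro AE_I2) (metis abs_ge_self order_trans real_norm_def)
  qed
  let ?\<Phi> = "\<lambda>\<omega>. F (\<chi> j. \<omega> j)"
  have ins: "insert i (UNIV - {i}) = UNIV" by auto
  have "integral\<^sup>L (lam B) F = (\<integral>\<omega>. ?\<Phi> \<omega> \<partial>Pi\<^sub>M UNIV (face_factor B))"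
    unfolding lam_eq_distr by (rule integral_distr[OF vec_measurable Fm])
  also have "\<dots> = (\<integral>\<omega>. (\<integral>t. ?\<Phi> (fun_upd \<omega> i t) \<partial>face_factor B i) \<partial>Pi\<^sub>M (UNIV - {i}) (face_factor B))"
  proof -
    have "integrable (Pi\<^sub>M UNIV (face_factor B)) ?\<Phi>"
      using Fint unfolding lam_eq_distr by (subst (asm) integrable_distr_eq[OF vec_measurable Fm])
    then show ?thesis
      using face_product.product_integral_insert[of "UNIV - {i}" i B ?\<Phi>] unfolding ins by simp
  qed
  also have "\<dots> = (\<integral>\<omega>. 0 \<partial>Pi\<^sub>M (UNIV - {i}) (face_factor B))"
  proof (rule Bochner_Integration.integral_cong[OF refl])
    fix \<omega> assume w: "\<omega> \<in> space (Pi\<^sub>M (UNIV - {i}) (face_factor B))"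
    define x0 where "x0 = upd (\<chi> j. \<omega> j) i 0"
    have x0: "x0 \<in> orthant" using w by (auto simp: x0_def orthant_def space_PiM PiE_def Pi_def)
    have eq: "(\<chi> j. (fun_upd \<omega> i t) j) = upd x0 i t" for t by (auto simp: x0_def vec_eq_iff)
    have "(\<integral>t. ?\<Phi> (fun_upd \<omega> i t) \<partial>face_factor B i) = (\<integral>t. indicator {0..} t * F (upd x0 i t) \<partial>lborel)"
      unfolding eq using iB by (simp add: face_factor_def integral_restrict_space)
    also have "\<dots> = 0"
    proof (cases "\<exists>t. upd x0 i t \<in> A")
      case True
      then obtain t0 where t0: "upd x0 i t0 \<in> A" by blast
      have iff: "upd x0 i t \<in> A \<longleftrightarrow> t \<in> {a<..<b}" for t
        using cyl(1)[of "upd x0 i t"] cyl(2)[OF t0, of t] by auto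
      have "indicator {0..} t * F (upd x0 i t)
          = indicator {a<..<b} t * (d (upd x0 i t) * p t + u (upd x0 i t) * p' t)" for t
        using iff[of t] a by (auto simp: F_def indicator_def)
      then have "(\<integral>t. indicator {0..} t * F (upd x0 i t) \<partial>lborel)
          = (\<integral>t. indicator {a<..<b} t * (d (upd x0 i t) * p t + u (upd x0 i t) * p' t) \<partial>lborel)" by simp
      also have "\<dots> = 0"
      proof (rule integral_derivative_zero[OF a(2), where G="\<lambda>t. u (upd x0 i t) * p t"])
        fix t assume t: "a \<le> t" "t \<le> b"
        have t0: "t > 0" using t a by simp
        show "((\<lambda>t. u (upd x0 i t) * p t) has_real_derivative d (upd x0 i t) * p t + u (upd x0 i t) * p' t) (at t)"
          using DERIV_mult[OF der[OF x0 t0] p(1)[of t]] by (simp add: mult.commute)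
        have "continuous_on {0<..} (\<lambda>t. d (upd x0 i t) * p t + u (upd x0 i t) * p' t)"
          by (intro continuous_intros continuous_on_subset[OF pc] continuous_on_subset[OF p(2)]
              continuous_on_compose2[OF d(1) upd_continuous] continuous_on_compose2[OF u(1) upd_continuous])
            (auto intro!: upd_orthant x0)
        then show "isCont (\<lambda>t. d (upd x0 i t) * p t + u (upd x0 i t) * p' t) t"
          using t0 by (simp add: continuous_on_eq_continuous_at)
      qed (simp_all add: p)
      finally show ?thesis .
    next
      case False
      then show ?thesis by (simp add: F_def)
    qed
    finally show "(\<integral>t. ?\<Phi> (fun_upd \<omega> i t) \<partial>face_factor B i) = 0" .
  qed
  also have "\<dots> = 0" by simp
  finally show ?thesis unfolding F_def[abs_def] .
qed

subsection \<open>Functions with vanishing integrals over boxes\<close>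

text \<open>Boxes form a generator of the Borel sets that is stable under intersections, so the integrals over all
Borel sets vanish.\<close>

lemma AE_zero_of_box_integrals:
  fixes f :: "'a::euclidean_space \<Rightarrow> real"
  assumes sets: "sets N = sets borel" and f: "integrable N f"
    and box: "\<And>a b. (\<integral>x. indicator (box a b) x * f x \<partial>N) = 0"
  shows "AE x in N. f x = 0"
proof (rule density_unique_real[OF f integrable_zero])
  have si: "set_integrable N A f" if "A \<in> sets borel" for A
    unfolding set_integrable_def using that f sets by (intro integrable_mult_indicator) auto
  let ?G = "range (\<lambda>(a, b). box a b :: 'a set)"
  have "Int_stable ?G"
    unfolding Int_stable_def by (auto simp: box_Int_box)
  have "?G \<subseteq> Pow UNIV" by simp
  have gen: "sets borel = sigma_sets UNIV ?G"
    by (subst borel_eq_box) (simp add: sets_measure_of)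
  have whole: "set_lebesgue_integral N UNIV f = 0"
  proof -
    let ?B = "\<lambda>n::nat. box (- (real n *\<^sub>R One)) (real n *\<^sub>R One) :: 'a set"
    have "(\<lambda>n. set_lebesgue_integral N (?B n) f) \<longlonglongrightarrow> set_lebesgue_integral N (\<Union>n. ?B n) f"
    proof (rule set_integral_cont_up)
      show "incseq ?B" by (auto simp: incseq_def mem_box inner_Basis) (meson of_nat_le_iff order_less_le_trans order_le_less_trans neg_le_iff_le)+
      show "set_integrable N (\<Union>n. ?B n) f" by (rule si) auto
    qed (use sets in auto)
    moreover have "(\<Union>n. ?B n) = UNIV"
      by (rule UN_box_eq_UNIV)
    moreover have "set_lebesgue_integral N (?B n) f = 0" for n
      using box by (simp add: set_lebesgue_integral_def)
    ultimately show ?thesis by (simp add: LIMSEQ_const_iff)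
  qed
  fix A assume "A \<in> sets N"
  then have "A \<in> sigma_sets UNIV ?G" using sets gen by simp
  with \<open>Int_stable ?G\<close> \<open>?G \<subseteq> Pow UNIV\<close>
  have "set_lebesgue_integral N A f = 0"
  proof (induction rule: sigma_sets_induct_disjoint)
    case (basic A)
    then show ?case using box by (auto simp: set_lebesgue_integral_def)
  next
    case (compl A)
    then have A: "A \<in> sets borel" using gen by simp
    have "set_lebesgue_integral N UNIV f = set_lebesgue_integral N (A \<union> (UNIV - A)) f" by simp
    also have "\<dots> = set_lebesgue_integral N A f + set_lebesgue_integral N (UNIV - A) f"
      using A by (intro set_integral_Un si) auto
    finally show ?case using whole compl by simp
  next
    case (union A)
    then have A: "A n \<in> sets borel" for n using gen by auto
    have "set_lebesgue_integral N (\<Union>n. A n) f = (\<Sum>n. set_lebesgue_integral N (A n) f)"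
      using union A sets by (intro lebesgue_integral_countable_add si) (auto simp: disjoint_family_on_def)
    then show ?case using union by simp
  qed (auto simp: set_lebesgue_integral_def)
  then show "set_lebesgue_integral N A f = set_lebesgue_integral N A (\<lambda>x. 0)"
    by (simp add: set_lebesgue_integral_def)
qed

lemma AE_zero_of_box_integrals_orthant:
  fixes f :: "real^'n \<Rightarrow> real"
  assumes sets: "sets N = sets (restrict_space borel orthant)" and f: "integrable N f"
    and box: "\<And>a b. (\<integral>x. indicator (box a b) x * f x \<partial>N) = 0"
  shows "AE x in N. f x = 0"
proof -
  have sp: "space N = orthant" using sets_eq_imp_space_eq[OF sets] by (simp add: space_restrict_space)
  let ?N = "distr N borel (\<lambda>x. x)"
  have id: "(\<lambda>x. x) \<in> measurable N borel"
    using measurable_cong_sets[OF sets refl] measurable_restrict_space1[of "\<lambda>x. x" borel borel] by auto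
  define g where "g x = indicator orthant x * f x" for x
  have fm: "f \<in> borel_measurable (restrict_space borel orthant)"
    using borel_measurable_integrable[OF f] measurable_cong_sets[OF sets refl] by auto
  have gm: "g \<in> borel_measurable borel"
    using fm unfolding g_def by (subst (asm) borel_measurable_restrict_space_iff) (auto simp: mult.commute)
  have gf: "g x = f x" if "x \<in> space N" for x using that sp by (simp add: g_def)
  have "AE x in ?N. g x = 0"
  proof (rule AE_zero_of_box_integrals)
    show "integrable ?N g"
      using f by (subst integrable_distr_eq[OF id gm]) (simp only: Bochner_Integration.integrable_cong[OF refl gf])
    show "(\<integral>x. indicator (box a b) x * g x \<partial>?N) = 0" for a b
    proof -
      have "(\<integral>x. indicator (box a b) x * g x \<partial>?N) = (\<integral>x. indicator (box a b) x * g x \<partial>N)"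
        by (rule integral_distr[OF id]) (use gm in measurable)
      also have "\<dots> = (\<integral>x. indicator (box a b) x * f x \<partial>N)"
        by (rule Bochner_Integration.integral_cong[OF refl]) (simp add: gf)
      finally show ?thesis using box by simp
    qed
  qed simp
  then have "AE x in N. g x = 0"
    using gm by (subst (asm) AE_distr_iff[OF id]) auto
  then show ?thesis using AE_space[of N] by eventually_elim (simp add: gf)
qed

section \<open>Weak derivatives on the faces\<close>

lemma Eplus_iff: "x \<in> Eplus B \<longleftrightarrow> (\<forall>j. if j \<in> B then 0 < x $ j else x $ j = 0)"
proof
  assume "x \<in> Eplus B"
  then have *: "0 \<le> x $ j" "0 < x $ j \<longleftrightarrow> j \<in> B" for j
    by (auto simp: Eplus_def orthant_def)
  show "\<forall>j. if j \<in> B then 0 < x $ j else x $ j = 0"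
  proof
    fix j show "if j \<in> B then 0 < x $ j else x $ j = 0" using *[of j] by (cases "j \<in> B") auto
  qed
next
  assume *: "\<forall>j. if j \<in> B then 0 < x $ j else x $ j = 0"
  have "0 \<le> x $ j" "0 < x $ j \<longleftrightarrow> j \<in> B" for j using *[rule_format, of j] by (auto split: if_splits)
  then show "x \<in> Eplus B" by (simp add: Eplus_def orthant_def)
qed

lemma Eplus_orthant: "Eplus B \<subseteq> orthant"
  by (auto simp: Eplus_def)

lemma Eplus_borel [measurable]: "Eplus (B :: 'n::finite set) \<in> sets borel"
proof -
  have "Eplus B = (\<Inter>j. {x. if j \<in> B then 0 < x $ j else x $ j = 0})" by (auto simp: Eplus_iff)
  also have "\<dots> \<in> sets borel"
  proof (rule sets.finite_INT)
    show "{x::real^'n. if j \<in> B then 0 < x $ j else x $ j = 0} \<in> sets borel" for j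
    proof (cases "j \<in> B")
      case True
      have "open {x::real^'n. 0 < x $ j}" by (intro open_Collect_less continuous_intros)
      from borel_open[OF this] show ?thesis by (simp only: True if_True)
    next
      case False
      have "closed {x::real^'n. x $ j = 0}" by (intro closed_Collect_eq continuous_intros)
      from borel_closed[OF this] show ?thesis by (simp only: False if_False)
    qed
  qed auto
  finally show ?thesis .
qed

text \<open>The norm of \<open>h\<close> off \<open>S\<close> is bounded by the distance of \<open>h\<close> to the functions \<open>g k\<close>, which vanish there.\<close>

lemma L2_conv_zero_outside:
  assumes g: "\<And>k. g k \<in> L2 M" and h: "h \<in> L2 M" and conv: "L2.conv M g h"
    and S: "S \<in> sets M" and zero: "\<And>k x. x \<in> space M \<Longrightarrow> x \<notin> S \<Longrightarrow> g k x = 0"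
  shows "AE x in M. x \<notin> S \<longrightarrow> h x = 0"
proof -
  define w where "w x = indicator (space M - S) x * h x" for x
  have wm: "w \<in> borel_measurable M"
    unfolding w_def using S by (intro borel_measurable_times L2_measurable[OF h]) auto
  have w: "w \<in> L2 M"
    by (rule L2_dominated[OF h wm]) (auto simp: w_def indicator_def)
  have "L2_inner M w w \<le> L2_inner M (g k - h) (g k - h)" for k
    unfolding L2_inner_def
  proof (rule integral_mono[OF L2_product_integrable[OF w w]
        L2_product_integrable[OF L2.diff_mem[OF g h] L2.diff_mem[OF g h]]])
    show "w x * w x \<le> (g k - h) x * (g k - h) x" if "x \<in> space M" for x
      using zero[OF that] that by (cases "x \<in> S") (auto simp: w_def)
  qed
  then have "L2_inner M w w \<le> 0"
    using conv unfolding L2.conv_def by (intro LIMSEQ_le_const) auto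
  then have "AE x in M. w x = 0" using L2_null_AE[OF w] L2_inner_nonneg[of M w] by simp
  then show ?thesis using AE_space[of M] by eventually_elim (auto simp: w_def indicator_def)
qed

locale face_data =
  fixes s :: real and \<rho> :: "real^'n \<Rightarrow> real"
  assumes s_pos: "0 < s"
    and rho_pos: "AE x in m_s s. 0 < \<rho> x"
    and rho_integrable: "integrable (m_s s) \<rho>"
    and rho_singular: "\<And>B. B \<noteq> {} \<Longrightarrow>
           AE x in lam_s s B. x \<in> closure (Eplus B) - R_set s \<rho> B \<longrightarrow> \<rho> x = 0"
begin

abbreviation "\<mu> \<equiv> mu s \<rho>"
abbreviation "\<mu>F \<equiv> mu_face s \<rho>"

lemma rho_measurable: "\<rho> \<in> borel_measurable (restrict_space borel orthant)"
  using borel_measurable_integrable[OF rho_integrable] by (simp only: measurable_m_s_iff)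

lemma rho_measurable_m [measurable]: "\<rho> \<in> borel_measurable (m_s s)"
  and rho_measurable_lam [measurable]: "\<rho> \<in> borel_measurable (lam_s s B)"
  using rho_measurable by (simp_all only: measurable_m_s_iff measurable_lam_s_iff)

lemma rho_pos_face: "AE x in lam_s s B. 0 < \<rho> x"
  by (rule AE_lam_s[OF rho_pos])

text \<open>Since the density is positive, null sets of \<open>\<mu>\<close> are null sets of the reference measure on each face.\<close>

lemma AE_mu_face:
  assumes "AE x in \<mu>. P x"
  shows "AE x in \<mu>F B. P x" "AE x in lam_s s B. P x"
proof -
  have "AE x in m_s s. 0 < ennreal (\<rho> x) \<longrightarrow> P x"
    using assms unfolding mu_def by (subst (asm) AE_density) measurable
  then have a: "AE x in lam_s s B. 0 < ennreal (\<rho> x) \<longrightarrow> P x" by (rule AE_lam_s)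
  then show "AE x in \<mu>F B. P x"
    unfolding mu_face_def by (subst AE_density) measurable
  show "AE x in lam_s s B. P x" using a rho_pos_face by eventually_elim simp
qed

lemma nn_integral_mu_face_le:
  assumes f: "f \<in> borel_measurable (restrict_space borel orthant)"
  shows "(\<integral>\<^sup>+x. f x \<partial>\<mu>F B) \<le> (\<integral>\<^sup>+x. f x \<partial>\<mu>)"
proof -
  have "f \<in> borel_measurable (m_s s)" "f \<in> borel_measurable (lam_s s B)"
    using f by (simp_all only: measurable_m_s_iff measurable_lam_s_iff)
  then show ?thesis
    unfolding mu_def mu_face_def by (simp add: nn_integral_density nn_integral_lam_s_le)
qed

lemma nn_integral_rho_finite: "(\<integral>\<^sup>+x. ennreal (\<rho> x) \<partial>m_s s) < \<infinity>"
proof -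
  have "(\<integral>\<^sup>+x. ennreal (\<rho> x) \<partial>m_s s) \<le> (\<integral>\<^sup>+x. ennreal (norm (\<rho> x)) \<partial>m_s s)"
    by (intro nn_integral_mono ennreal_leI) simp
  also have "\<dots> < \<infinity>" using rho_integrable by (simp add: integrable_iff_bounded)
  finally show ?thesis .
qed

lemma finite_mu: "finite_measure \<mu>"
proof (rule finite_measureI)
  have "emeasure \<mu> orthant = (\<integral>\<^sup>+x. ennreal (\<rho> x) \<partial>m_s s)"
    unfolding mu_def by (subst emeasure_density) (auto intro!: nn_integral_cong simp: indicator_def sets_restrict_space_iff)
  then show "emeasure \<mu> (space \<mu>) \<noteq> \<infinity>" using nn_integral_rho_finite by simp
qed

lemma finite_mu_face: "finite_measure (\<mu>F B)"
proof (rule finite_measureI)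
  have "emeasure (\<mu>F B) orthant = (\<integral>\<^sup>+x. 1 \<partial>\<mu>F B)" by simp
  also have "\<dots> \<le> (\<integral>\<^sup>+x. 1 \<partial>\<mu>)" by (rule nn_integral_mu_face_le) simp
  also have "\<dots> = emeasure \<mu> (space \<mu>)" by simp
  also have "\<dots> < \<infinity>" using finite_measure.emeasure_finite[OF finite_mu] by (simp add: top.not_eq_extremum)
  finally show "emeasure (\<mu>F B) (space (\<mu>F B)) \<noteq> \<infinity>" by simp
qed

lemma
  assumes f: "f \<in> L2 \<mu>"
  shows L2_mu_face: "f \<in> L2 (\<mu>F B)" and L2_mu_face_inner_le: "L2_inner (\<mu>F B) f f \<le> L2_inner \<mu> f f"
proof -
  have fm: "f \<in> borel_measurable (restrict_space borel orthant)"
    using L2_measurable[OF f] by (simp only: measurable_mu_iff)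
  have le: "(\<integral>\<^sup>+x. ennreal ((f x)\<^sup>2) \<partial>\<mu>F B) \<le> (\<integral>\<^sup>+x. ennreal ((f x)\<^sup>2) \<partial>\<mu>)"
    by (rule nn_integral_mu_face_le) (use fm in measurable)
  show f': "f \<in> L2 (\<mu>F B)"
  proof (rule L2I_nn)
    show "f \<in> borel_measurable (\<mu>F B)" using fm by (simp only: measurable_mu_face_iff)
    show "(\<integral>\<^sup>+x. ennreal ((f x)\<^sup>2) \<partial>\<mu>F B) < \<infinity>"
      using le L2_inner_nn[OF f, symmetric] by (simp add: le_less_trans)
  qed
  show "L2_inner (\<mu>F B) f f \<le> L2_inner \<mu> f f"
    using le unfolding L2_inner_nn[OF f, symmetric] L2_inner_nn[OF f', symmetric]
    by (simp add: L2_inner_nonneg)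
qed

lemma L2_mu_face_conv:
  assumes u: "\<And>k. u k \<in> L2 \<mu>" and f: "f \<in> L2 \<mu>" and conv: "L2.conv \<mu> u f"
  shows "L2.conv (\<mu>F B) u f"
  unfolding L2.conv_def
proof (rule tendsto_sandwich[OF _ _ tendsto_const])
  show "(\<lambda>k. L2_inner \<mu> (u k - f) (u k - f)) \<longlonglongrightarrow> 0" using conv by (simp add: L2.conv_def)
  show "\<forall>\<^sub>F k in sequentially. L2_inner (\<mu>F B) (u k - f) (u k - f) \<le> L2_inner \<mu> (u k - f) (u k - f)"
    by (intro always_eventually allI L2_mu_face_inner_le L2.diff_mem u f)
qed (simp add: L2_inner_nonneg)

lemma bounded_L2:
  assumes "finite_measure M" and "f \<in> borel_measurable M" and "\<And>x. x \<in> space M \<Longrightarrow> \<bar>f x\<bar> \<le> C"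
  shows "f \<in> L2 M"
proof (rule L2_dominated[OF _ assms(2)])
  show "(\<lambda>x. C) \<in> L2 M" using assms(1) by (simp add: L2_def finite_measure.integrable_const)
  show "AE x in M. \<bar>f x\<bar> \<le> \<bar>C\<bar>" using assms(3) by (intro AE_I2) force
qed

lemma Cc_L2:
  assumes "f \<in> Cc orthant"
  shows "f \<in> L2 \<mu>"
proof -
  obtain C where "\<forall>x\<in>orthant. \<bar>f x\<bar> \<le> C" using Cc_bounded[OF assms] by blast
  moreover have "f \<in> borel_measurable \<mu>"
    using assms by (simp add: measurable_mu_iff Cc_def continuous_measurable_orthant)
  ultimately show ?thesis by (intro bounded_L2[OF finite_mu]) auto
qed

text \<open>The partial derivative on the face, extended by zero off the face: as a map into
  \<open>L\<^sup>2\<close> of the face measure.\<close>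

definition face_deriv :: "'n set \<Rightarrow> 'n \<Rightarrow> (real^'n \<Rightarrow> real) \<Rightarrow> real^'n \<Rightarrow> real" where
  "face_deriv B i f x = indicator (Eplus B) x * ext_partial i f x"

lemma face_deriv_L2:
  assumes "f \<in> Cck 2"
  shows "face_deriv B i f \<in> L2 (\<mu>F B)"
proof -
  have f: "f \<in> Cck (Suc 1)" using assms by (simp add: numeral_2_eq_2)
  obtain C where C: "\<forall>x\<in>orthant. \<bar>ext_partial i f x\<bar> \<le> C" using ext_partial_bounded[OF f] by blast
  show ?thesis
  proof (rule bounded_L2[OF finite_mu_face])
    show "face_deriv B i f \<in> borel_measurable (\<mu>F B)"
      unfolding measurable_mu_face_iff face_deriv_def[abs_def]
      by (intro borel_measurable_times measurable_orthant borel_measurable_indicator Eplus_borel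
          continuous_measurable_orthant ext_partial_continuous[OF Cck_imp_Ck[OF f]])
    show "\<bar>face_deriv B i f x\<bar> \<le> \<bar>C\<bar>" if "x \<in> space (\<mu>F B)" for x
      using C that by (force simp: face_deriv_def indicator_def)
  qed
qed

lemma form_face_eq:
  "form_face s \<rho> B f g = (\<Sum>i\<in>B. L2_inner (\<mu>F B) (face_deriv B i f) (face_deriv B i g))"
proof -
  have eq: "indicator (Eplus B) x *\<^sub>R (ext_partial i f x * ext_partial i g x)
      = face_deriv B i f x * face_deriv B i g x" for i x
    by (simp add: face_deriv_def indicator_def)
  show ?thesis
    unfolding form_face_def set_lebesgue_integral_def L2_inner_def eq by (rule refl)
qed

subsection \<open>Integrability against the inverse weight\<close>

text \<open>The Cauchy--Schwarz inequality for \<open>|g| = (|g| \<rho>\<^bsup>1/2\<^esup>) \<rho>\<^bsup>-1/2\<^esup>\<close> on a set over which \<open>1/\<rho>\<close> is integrable.\<close>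

lemma weighted_integral:
  assumes g: "g \<in> L2 (\<mu>F B)" and K: "K \<in> sets borel"
    and w: "(\<integral>\<^sup>+y. inverse (ennreal (\<rho> y)) * indicator K y \<partial>lam_s s B) \<le> ennreal w" "w \<ge> 0"
    and \<phi>: "\<phi> \<in> borel_measurable (restrict_space borel orthant)" "\<And>x. x \<in> K \<Longrightarrow> \<bar>\<phi> x\<bar> \<le> C"
  shows "integrable (lam_s s B) (\<lambda>x. indicator K x * (\<phi> x * g x))"
    and "\<bar>\<integral>x. indicator K x * (\<phi> x * g x) \<partial>lam_s s B\<bar> \<le> \<bar>C\<bar> * (sqrt w * L2.N (\<mu>F B) g)"
proof -
  let ?\<nu> = "lam_s s B"
  have gm [measurable]: "g \<in> borel_measurable ?\<nu>"
    using L2_measurable[OF g] by (simp only: measurable_mu_face_iff measurable_lam_s_iff)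
  have \<phi>m [measurable]: "\<phi> \<in> borel_measurable ?\<nu>" using \<phi>(1) by (simp only: measurable_lam_s_iff)
  have KS: "K \<inter> space ?\<nu> \<in> sets ?\<nu>" using K by (auto simp: sets_restrict_space)
  have Km [measurable]: "(\<lambda>x. indicator K x :: real) \<in> borel_measurable ?\<nu>"
    using KS by (simp add: borel_measurable_indicator_iff)
  have Km' [measurable]: "(\<lambda>x. indicator K x :: ennreal) \<in> borel_measurable ?\<nu>"
    using KS by (simp add: borel_measurable_indicator_iff)
  define I where "I = (\<integral>\<^sup>+x. ennreal \<bar>indicator K x * g x\<bar> \<partial>?\<nu>)"
  have Ieq: "I = (\<integral>\<^sup>+x. ennreal (\<bar>g x\<bar> * sqrt (\<rho> x)) * (indicator K x * ennreal (1 / sqrt (\<rho> x))) \<partial>?\<nu>)"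
    unfolding I_def
  proof (rule nn_integral_cong_AE, use rho_pos_face[of B] in eventually_elim)
    case (elim x)
    then show ?case
      by (cases "x \<in> K") (simp_all add: ennreal_mult[symmetric] abs_mult)
  qed
  have "I\<^sup>2 \<le> (\<integral>\<^sup>+x. (ennreal (\<bar>g x\<bar> * sqrt (\<rho> x)))\<^sup>2 \<partial>?\<nu>)
      * (\<integral>\<^sup>+x. (indicator K x * ennreal (1 / sqrt (\<rho> x)))\<^sup>2 \<partial>?\<nu>)"
    unfolding Ieq by (rule Cauchy_Schwarz_nn_integral) measurable
  also have "(\<integral>\<^sup>+x. (ennreal (\<bar>g x\<bar> * sqrt (\<rho> x)))\<^sup>2 \<partial>?\<nu>) = ennreal ((L2.N (\<mu>F B) g)\<^sup>2)"
  proof -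
    have "(\<integral>\<^sup>+x. (ennreal (\<bar>g x\<bar> * sqrt (\<rho> x)))\<^sup>2 \<partial>?\<nu>) = (\<integral>\<^sup>+x. ennreal (\<rho> x) * ennreal ((g x)\<^sup>2) \<partial>?\<nu>)"
    proof (rule nn_integral_cong_AE, use rho_pos_face[of B] in eventually_elim)
      case (elim x)
      then show ?case
        by (simp add: ennreal_mult[symmetric] ennreal_power power_mult_distrib mult.commute)
    qed
    also have "\<dots> = (\<integral>\<^sup>+x. ennreal ((g x)\<^sup>2) \<partial>\<mu>F B)"
      unfolding mu_face_def by (rule nn_integral_density[symmetric]) measurable
    also have "\<dots> = ennreal ((L2.N (\<mu>F B) g)\<^sup>2)"
      by (simp only: L2_inner_nn[OF g, symmetric] L2.N_sq[OF g])
    finally show ?thesis .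
  qed
  also have "(\<integral>\<^sup>+x. (indicator K x * ennreal (1 / sqrt (\<rho> x)))\<^sup>2 \<partial>?\<nu>)
      = (\<integral>\<^sup>+y. inverse (ennreal (\<rho> y)) * indicator K y \<partial>?\<nu>)"
  proof (rule nn_integral_cong_AE, use rho_pos_face[of B] in eventually_elim)
    case (elim x)
    then show ?case
      by (cases "x \<in> K") (simp_all add: ennreal_power power_divide inverse_ennreal inverse_eq_divide)
  qed
  also have "\<dots> \<le> ennreal w" by (rule w)
  finally have I2: "I\<^sup>2 \<le> ennreal ((L2.N (\<mu>F B) g)\<^sup>2 * w)"
    by (simp add: ennreal_mult w mult_left_mono)
  have "I \<noteq> \<infinity>"
  proof
    assume "I = \<infinity>"
    then have "I\<^sup>2 = \<infinity>" by (simp add: power2_eq_square ennreal_mult_eq_top_iff)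
    then show False using I2 by (simp add: top_unique)
  qed
  then obtain r where r: "I = ennreal r" "r \<ge> 0" by (cases I) auto
  have "r\<^sup>2 \<le> (L2.N (\<mu>F B) g)\<^sup>2 * w" using I2 r w by (simp add: ennreal_power)
  then have "r \<le> sqrt ((L2.N (\<mu>F B) g)\<^sup>2 * w)" by (rule real_le_rsqrt)
  then have rle: "r \<le> sqrt w * L2.N (\<mu>F B) g"
    using L2.N_nonneg[OF g] by (simp add: real_sqrt_mult mult.commute)
  have int: "integrable ?\<nu> (\<lambda>x. indicator K x * g x)"
    by (rule integrableI_bounded) (use r I_def in \<open>simp_all add: ennreal_less_top\<close>)
  have le: "\<bar>indicator K x * (\<phi> x * g x)\<bar> \<le> \<bar>C\<bar> * \<bar>indicator K x * g x\<bar>" for x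
    using mult_right_mono[OF order_trans[OF \<phi>(2) abs_ge_self], of x "\<bar>g x\<bar>"]
    by (cases "x \<in> K") (auto simp: abs_mult)
  show int\<phi>: "integrable ?\<nu> (\<lambda>x. indicator K x * (\<phi> x * g x))"
  proof (rule Bochner_Integration.integrable_bound)
    show "integrable ?\<nu> (\<lambda>x. \<bar>C\<bar> * \<bar>indicator K x * g x\<bar>)" using int by (intro integrable_mult_right integrable_abs)
    show "AE x in ?\<nu>. norm (indicator K x * (\<phi> x * g x)) \<le> norm (\<bar>C\<bar> * \<bar>indicator K x * g x\<bar>)"
      using le by (intro AE_I2) (simp add: abs_mult)
  qed measurable
  have "\<bar>\<integral>x. indicator K x * (\<phi> x * g x) \<partial>?\<nu>\<bar> \<le> (\<integral>x. \<bar>indicator K x * (\<phi> x * g x)\<bar> \<partial>?\<nu>)"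
    using integral_norm_bound[of ?\<nu> "\<lambda>x. indicator K x * (\<phi> x * g x)"] by simp
  also have "\<dots> \<le> (\<integral>x. \<bar>C\<bar> * \<bar>indicator K x * g x\<bar> \<partial>?\<nu>)"
    using int int\<phi> le by (intro integral_mono integrable_mult_right integrable_abs)
  also have "\<dots> = \<bar>C\<bar> * r"
  proof -
    have "ennreal (\<integral>x. \<bar>indicator K x * g x\<bar> \<partial>?\<nu>) = ennreal r"
      using nn_integral_eq_integral[OF integrable_abs[OF int]] r I_def by simp
    then show ?thesis using r by simp
  qed
  also have "\<dots> \<le> \<bar>C\<bar> * (sqrt w * L2.N (\<mu>F B) g)" using rle by (intro mult_left_mono) auto
  finally show "\<bar>\<integral>x. indicator K x * (\<phi> x * g x) \<partial>?\<nu>\<bar> \<le> \<bar>C\<bar> * (sqrt w * L2.N (\<mu>F B) g)" .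
qed

lemma weighted_integral_tendsto:
  assumes u: "\<And>k. u k \<in> L2 (\<mu>F B)" and g: "g \<in> L2 (\<mu>F B)" and conv: "L2.conv (\<mu>F B) u g" and K: "K \<in> sets borel"
    and w: "(\<integral>\<^sup>+y. inverse (ennreal (\<rho> y)) * indicator K y \<partial>lam_s s B) \<le> ennreal w" "w \<ge> 0"
    and \<phi>: "\<phi> \<in> borel_measurable (restrict_space borel orthant)" "\<And>x. x \<in> K \<Longrightarrow> \<bar>\<phi> x\<bar> \<le> C"
  shows "(\<lambda>k. \<integral>x. indicator K x * (\<phi> x * u k x) \<partial>lam_s s B) \<longlonglongrightarrow> (\<integral>x. indicator K x * (\<phi> x * g x) \<partial>lam_s s B)"
proof (rule LIM_zero_cancel, rule Lim_null_comparison[OF always_eventually])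
  have "(\<integral>x. indicator K x * (\<phi> x * u k x) \<partial>lam_s s B) - (\<integral>x. indicator K x * (\<phi> x * g x) \<partial>lam_s s B)
      = (\<integral>x. indicator K x * (\<phi> x * (u k - g) x) \<partial>lam_s s B)" for k
    by (subst Bochner_Integration.integral_diff[symmetric])
      (simp_all add: weighted_integral(1)[OF u K w \<phi>] weighted_integral(1)[OF g K w \<phi>] right_diff_distrib)
  then show "\<forall>k. norm ((\<integral>x. indicator K x * (\<phi> x * u k x) \<partial>lam_s s B) - (\<integral>x. indicator K x * (\<phi> x * g x) \<partial>lam_s s B))
      \<le> \<bar>C\<bar> * (sqrt w * L2.N (\<mu>F B) (u k - g))"
    using weighted_integral(2)[OF L2.diff_mem[OF u g] K w \<phi>] by simp
  have "(\<lambda>k. L2.N (\<mu>F B) (u k - g)) \<longlonglongrightarrow> 0"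
    using conv L2.conv_N[of u "\<mu>F B" g] u g by blast
  then show "(\<lambda>k. \<bar>C\<bar> * (sqrt w * L2.N (\<mu>F B) (u k - g))) \<longlonglongrightarrow> 0"
    by (intro tendsto_mult_right_zero)
qed

text \<open>As \<open>1 \<le> \<rho> + 1/\<rho>\<close>, integrability of \<open>\<rho>\<close> and of \<open>1/\<rho>\<close> over \<open>K\<close> bounds the measure of \<open>K\<close>.\<close>

lemma finite_of_inverse_weight:
  assumes K: "K \<in> sets borel" "K \<subseteq> orthant"
    and w: "(\<integral>\<^sup>+y. inverse (ennreal (\<rho> y)) * indicator K y \<partial>lam_s s B) \<le> ennreal w"
  shows "emeasure (lam B) K < \<infinity>"
proof -
  have KS [measurable]: "K \<in> sets (lam_s s B)" using K by (simp add: sets_restrict_space_iff)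
  have "emeasure (lam_s s B) K = (\<integral>\<^sup>+y. indicator K y \<partial>lam_s s B)" using KS by simp
  also have "\<dots> \<le> (\<integral>\<^sup>+y. ennreal (\<rho> y) + inverse (ennreal (\<rho> y)) * indicator K y \<partial>lam_s s B)"
  proof (rule nn_integral_mono_AE, use rho_pos_face[of B] in eventually_elim)
    case (elim y)
    have "1 \<le> \<rho> y + inverse (\<rho> y)"
    proof (cases "\<rho> y \<ge> 1")
      case False
      then have "1 \<le> inverse (\<rho> y)" using elim by (simp add: one_le_inverse_iff)
      then show ?thesis using elim by simp
    qed (use elim in \<open>simp add: add_increasing2\<close>)
    then have "ennreal 1 \<le> ennreal (\<rho> y) + inverse (ennreal (\<rho> y))"
      using elim by (simp add: inverse_ennreal ennreal_plus[symmetric] del: ennreal_plus ennreal_1)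
    then show ?case by (cases "y \<in> K") simp_all
  qed
  also have "\<dots> = (\<integral>\<^sup>+y. ennreal (\<rho> y) \<partial>lam_s s B) + (\<integral>\<^sup>+y. inverse (ennreal (\<rho> y)) * indicator K y \<partial>lam_s s B)"
    by (intro nn_integral_add) measurable
  also have "\<dots> < \<infinity>"
    using nn_integral_rho_finite nn_integral_lam_s_le[where f="\<lambda>y. ennreal (\<rho> y)" and s=s and B=B] w
    by (auto simp: top_unique less_top[symmetric] neq_top_trans)
  finally have "emeasure (lam_s s B) K < \<infinity>" .
  moreover have "emeasure (lam_s s B) K = ennreal (s ^ (CARD('n) - card B)) * emeasure (lam B) K"
    by (simp add: lam_s_def)
  ultimately show ?thesis
    using s_pos by (auto simp: ennreal_mult_less_top)
qed

lemma lam_s_integral_zero: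
  assumes F: "F \<in> borel_measurable (restrict_space borel orthant)" and zero: "(\<integral>x. F x \<partial>lam B) = (0::real)"
  shows "(\<integral>x. F x \<partial>lam_s s B) = 0"
  unfolding lam_s_density using s_pos F zero
  by (subst integral_density) (auto simp: measurable_lam_iff)

text \<open>Test functions that vanish at the end points and increase to \<open>1\<close> on \<open>(a, b)\<close> as \<open>m\<close> grows. The integration
by parts is carried out on the box itself, so boundary value zero suffices and polynomials can be taken.\<close>

definition bump :: "real \<Rightarrow> real \<Rightarrow> nat \<Rightarrow> real \<Rightarrow> real" where
  "bump a b m t = 1 - (1 - (t - a) * (b - t) / (b - a)\<^sup>2) ^ m"

definition bump' :: "real \<Rightarrow> real \<Rightarrow> nat \<Rightarrow> real \<Rightarrow> real" where
  "bump' a b m t = real m * (1 - (t - a) * (b - t) / (b - a)\<^sup>2) ^ (m - 1) * ((a + b - 2 * t) / (b - a)\<^sup>2)"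

lemma bump_derivative: "(bump a b m has_real_derivative bump' a b m t) (at t)"
proof -
  define c where "c = (b - a)\<^sup>2"
  have "((\<lambda>t. (t - a) * (b - t) / c) has_real_derivative (a + b - 2 * t) / c) (at t)"
    by (rule DERIV_cdivide) (auto intro!: derivative_eq_intros)
  from DERIV_diff[OF DERIV_const[of 1] this]
  have "((\<lambda>t. 1 - (t - a) * (b - t) / c) has_real_derivative 0 - (a + b - 2 * t) / c) (at t)" .
  from DERIV_diff[OF DERIV_const[of 1] DERIV_power[OF this, of m]]
  show ?thesis unfolding bump_def[abs_def] bump'_def c_def by (simp add: mult_ac)
qed

lemma bump_continuous: "continuous_on UNIV (bump a b m)"
  unfolding bump_def[abs_def] by (cases "b = a") (auto intro!: continuous_intros)

lemma bump'_continuous: "continuous_on UNIV (bump' a b m)"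
  unfolding bump'_def[abs_def] by (cases "b = a") (auto intro!: continuous_intros)

lemma bump_ends: "bump a b m a = 0" "bump a b m b = 0"
  by (simp_all add: bump_def)

lemma bump_factor:
  fixes a b t :: real
  assumes "a < t" "t < b"
  shows "0 \<le> 1 - (t - a) * (b - t) / (b - a)\<^sup>2" "1 - (t - a) * (b - t) / (b - a)\<^sup>2 < 1"
proof -
  have "(t - a) * (b - t) \<le> (b - a) * (b - a)" using assms by (intro mult_mono) auto
  then have "(t - a) * (b - t) / (b - a)\<^sup>2 \<le> 1" using assms by (simp add: divide_le_eq_1 power2_eq_square)
  then show "0 \<le> 1 - (t - a) * (b - t) / (b - a)\<^sup>2" by simp
  show "1 - (t - a) * (b - t) / (b - a)\<^sup>2 < 1" using assms by simp
qed

lemma bump_bound: "a < t \<Longrightarrow> t < b \<Longrightarrow> \<bar>bump a b m t\<bar> \<le> 1"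
  using zero_le_power[OF bump_factor(1)[of a t b], of m] power_le_one[OF bump_factor(1)[of a t b], of m] bump_factor(2)[of a t b]
  unfolding bump_def by (simp add: abs_le_iff)

lemma bump_tendsto:
  assumes "a < t" "t < b"
  shows "(\<lambda>m. bump a b m t) \<longlonglongrightarrow> 1"
proof -
  have "(\<lambda>m. (1 - (t - a) * (b - t) / (b - a)\<^sup>2) ^ m) \<longlonglongrightarrow> 0"
    by (rule LIMSEQ_power_zero) (use bump_factor[OF assms] in simp)
  then have "(\<lambda>m. 1 - (1 - (t - a) * (b - t) / (b - a)\<^sup>2) ^ m) \<longlonglongrightarrow> 1 - 0"
    by (intro tendsto_diff tendsto_const)
  then show ?thesis by (simp add: bump_def)
qed

text \<open>For the part \<open>K\<close> of the face in a smaller box and a test function \<open>\<psi>\<close> of \<open>x\<^sub>i\<close> vanishing at the ends of \<open>K\<close>, the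
integral of \<open>\<psi> \<partial>\<^sub>i u\<^sub>k + \<psi>' u\<^sub>k\<close> over \<open>K\<close> is zero. In the limit the integral of \<open>\<psi> h + \<psi>' c\<close> is zero, and the second term
vanishes by the integration by parts for constants. Letting \<open>\<psi>\<close> increase to \<open>1\<close>, the integral of \<open>h\<close> over \<open>K\<close>
is zero; since the smaller box is arbitrary, \<open>h = 0\<close>.\<close>

lemma weak_derivative_box:
  assumes iB: "i \<in> B" and u: "\<And>k. u k \<in> Cck 2" and f: "f \<in> L2 \<mu>" and uf: "L2.conv \<mu> u f"
    and h: "h \<in> L2 (\<mu>F B)" and uh: "L2.conv (\<mu>F B) (\<lambda>k. face_deriv B i (u k)) h"
    and fc: "AE x in \<mu>. x \<in> box p q \<longrightarrow> f x = c" and p: "\<And>j. j \<in> B \<Longrightarrow> 0 < p $ j"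
    and w: "(\<integral>\<^sup>+y. inverse (ennreal (\<rho> y)) * indicator (box p q \<inter> Eplus B) y \<partial>lam_s s B) < \<infinity>"
  shows "AE x in lam_s s B. x \<in> box p q \<inter> Eplus B \<longrightarrow> h x = 0"
proof -
  let ?\<nu> = "lam_s s B"
  obtain W where W: "(\<integral>\<^sup>+y. inverse (ennreal (\<rho> y)) * indicator (box p q \<inter> Eplus B) y \<partial>?\<nu>) \<le> ennreal W" "W \<ge> 0"
    using w by (cases "\<integral>\<^sup>+y. inverse (ennreal (\<rho> y)) * indicator (box p q \<inter> Eplus B) y \<partial>?\<nu>") auto
  have u1: "u k \<in> Cck (Suc 1)" for k using u[of k] by (simp add: numeral_2_eq_2)
  have uCc: "u k \<in> Cc orthant" for k by (rule Cck_imp_Cc[OF u])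
  have uL2: "u k \<in> L2 \<mu>" for k by (rule Cc_L2[OF uCc])
  have fF: "f \<in> L2 (\<mu>F B)" by (rule L2_mu_face[OF f])
  have ufF: "L2.conv (\<mu>F B) u f" by (rule L2_mu_face_conv[OF uL2 f uf])
  have fcF: "AE x in ?\<nu>. x \<in> box p q \<longrightarrow> f x = c" by (rule AE_mu_face(2)[OF fc])
  have one: "(\<lambda>x. 1) \<in> borel_measurable (restrict_space borel (orthant :: (real^'n) set))" by simp
  have KB: "box p q \<inter> Eplus B \<in> sets borel" by measurable
  have sub: "(\<integral>x. indicator (box a b \<inter> box p q \<inter> Eplus B) x * h x \<partial>?\<nu>) = 0" for a b
  proof -
    define \<alpha> \<beta> where "\<alpha> = max (a $ i) (p $ i)" and "\<beta> = min (b $ i) (q $ i)"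
    define K where "K = box a b \<inter> box p q \<inter> Eplus B"
    have K: "K \<in> sets borel" "K \<subseteq> orthant" "K \<subseteq> box p q \<inter> Eplus B"
      using Eplus_orthant by (auto simp: K_def)
    have cyl1: "\<alpha> < x $ i \<and> x $ i < \<beta>" if "x \<in> K" for x
      using that by (auto simp: K_def mem_box_cart \<alpha>_def \<beta>_def)
    have \<alpha>0: "0 < \<alpha>" using p[OF iB] by (simp add: \<alpha>_def)
    have cyl2: "upd x i t \<in> K" if "x \<in> K" "\<alpha> < t" "t < \<beta>" for x t
      using that \<alpha>0 iB by (auto simp: K_def mem_box_cart Eplus_iff \<alpha>_def \<beta>_def)
    have WK: "(\<integral>\<^sup>+y. inverse (ennreal (\<rho> y)) * indicator K y \<partial>?\<nu>) \<le> ennreal W"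
    proof (rule order_trans[OF nn_integral_mono W(1)])
      show "inverse (ennreal (\<rho> y)) * indicator K y \<le> inverse (ennreal (\<rho> y)) * indicator (box p q \<inter> Eplus B) y" for y
        using K(3) by (intro mult_left_mono) (auto simp: indicator_def)
    qed
    have finK: "emeasure (lam B) K < \<infinity>" by (rule finite_of_inverse_weight[OF K(1,2) WK])
    show ?thesis
    proof (cases "\<alpha> < \<beta>")
      case False
      then have "K = {}" using cyl1 by fastforce
      then show ?thesis by (simp add: K_def[symmetric])
    next
      case ab: True
      have bm: "(\<lambda>x. bump \<alpha> \<beta> m (x $ i)) \<in> borel_measurable (restrict_space borel (orthant :: (real^'n) set))" for m
        by (intro continuous_measurable_orthant continuous_on_compose2[OF bump_continuous] continuous_intros) auto
      have bm': "(\<lambda>x. bump' \<alpha> \<beta> m (x $ i)) \<in> borel_measurable (restrict_space borel (orthant :: (real^'n) set))" for m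
        by (intro continuous_measurable_orthant continuous_on_compose2[OF bump'_continuous] continuous_intros) auto
      have bb: "\<bar>bump \<alpha> \<beta> m (x $ i)\<bar> \<le> 1" if "x \<in> K" for m x
        using cyl1[OF that] by (intro bump_bound) auto
      have "\<exists>C. \<forall>x\<in>K. \<bar>bump' \<alpha> \<beta> m (x $ i)\<bar> \<le> C" for m
      proof -
        have "bounded (bump' \<alpha> \<beta> m ` {\<alpha>..\<beta>})"
          by (intro compact_imp_bounded compact_continuous_image continuous_on_subset[OF bump'_continuous]) auto
        then obtain C where "\<forall>y\<in>bump' \<alpha> \<beta> m ` {\<alpha>..\<beta>}. norm y \<le> C" unfolding bounded_iff by blast
        then show ?thesis using cyl1 by (intro exI[of _ C]) force
      qed
      then obtain C where C: "\<And>m x. x \<in> K \<Longrightarrow> \<bar>bump' \<alpha> \<beta> m (x $ i)\<bar> \<le> C m" by metis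
      have parts: "(\<integral>x. indicator K x * (v' x * bump \<alpha> \<beta> m (x $ i) + v x * bump' \<alpha> \<beta> m (x $ i)) \<partial>?\<nu>) = 0"
        if "continuous_on orthant v" "\<And>x. x \<in> orthant \<Longrightarrow> \<bar>v x\<bar> \<le> C1"
          "continuous_on orthant v'" "\<And>x. x \<in> orthant \<Longrightarrow> \<bar>v' x\<bar> \<le> C2"
          "\<And>x t. x \<in> orthant \<Longrightarrow> t > 0 \<Longrightarrow> ((\<lambda>t. v (upd x i t)) has_real_derivative v' (upd x i t)) (at t)"
        for v v' C1 C2 m
      proof (rule lam_s_integral_zero)
        have vm: "v \<in> borel_measurable (restrict_space borel orthant)" "v' \<in> borel_measurable (restrict_space borel orthant)"
          using that by (auto intro: continuous_measurable_orthant)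
        show "(\<lambda>x. indicator K x * (v' x * bump \<alpha> \<beta> m (x $ i) + v x * bump' \<alpha> \<beta> m (x $ i))) \<in> borel_measurable (restrict_space borel orthant)"
          by (intro borel_measurable_times borel_measurable_add vm bm bm' measurable_orthant borel_measurable_indicator K(1))
        show "(\<integral>x. indicator K x * (v' x * bump \<alpha> \<beta> m (x $ i) + v x * bump' \<alpha> \<beta> m (x $ i)) \<partial>lam B) = 0"
          by (rule lam_integral_by_parts[OF iB \<alpha>0 ab K(1,2) finK cyl1 cyl2 that bump_derivative bump'_continuous bump_ends])
      qed
      have zero: "(\<integral>x. indicator K x * (bump \<alpha> \<beta> m (x $ i) * h x) \<partial>?\<nu>) = 0" for m
      proof -
        have l1: "(\<lambda>k. \<integral>x. indicator K x * (bump \<alpha> \<beta> m (x $ i) * face_deriv B i (u k) x) \<partial>?\<nu>)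
            \<longlonglongrightarrow> (\<integral>x. indicator K x * (bump \<alpha> \<beta> m (x $ i) * h x) \<partial>?\<nu>)"
          by (rule weighted_integral_tendsto[OF face_deriv_L2[OF u] h uh K(1) WK W(2) bm bb])
        have l2: "(\<lambda>k. \<integral>x. indicator K x * (bump' \<alpha> \<beta> m (x $ i) * u k x) \<partial>?\<nu>)
            \<longlonglongrightarrow> (\<integral>x. indicator K x * (bump' \<alpha> \<beta> m (x $ i) * f x) \<partial>?\<nu>)"
          by (rule weighted_integral_tendsto[OF L2_mu_face[OF uL2] fF ufF K(1) WK W(2) bm' C])
        have l3: "(\<integral>x. indicator K x * (bump' \<alpha> \<beta> m (x $ i) * f x) \<partial>?\<nu>) = 0"
        proof -
          have "(\<integral>x. indicator K x * (bump' \<alpha> \<beta> m (x $ i) * f x) \<partial>?\<nu>)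
              = (\<integral>x. indicator K x * (0 * bump \<alpha> \<beta> m (x $ i) + c * bump' \<alpha> \<beta> m (x $ i)) \<partial>?\<nu>)"
          proof (rule integral_cong_AE)
            show "(\<lambda>x. indicator K x * (bump' \<alpha> \<beta> m (x $ i) * f x)) \<in> borel_measurable ?\<nu>"
              by (rule borel_measurable_integrable[OF weighted_integral(1)[OF fF K(1) WK W(2) bm' C]])
            show "(\<lambda>x. indicator K x * (0 * bump \<alpha> \<beta> m (x $ i) + c * bump' \<alpha> \<beta> m (x $ i))) \<in> borel_measurable ?\<nu>"
              unfolding measurable_lam_s_iff
              by (intro borel_measurable_times borel_measurable_add borel_measurable_const bm bm' measurable_orthant borel_measurable_indicator K(1))
            show "AE x in ?\<nu>. indicator K x * (bump' \<alpha> \<beta> m (x $ i) * f x)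
                = indicator K x * (0 * bump \<alpha> \<beta> m (x $ i) + c * bump' \<alpha> \<beta> m (x $ i))"
              using fcF by eventually_elim (use K(3) in \<open>auto simp: indicator_def\<close>)
          qed
          also have "\<dots> = 0" by (rule parts[of "\<lambda>x. c" "\<bar>c\<bar>" "\<lambda>x. 0" 0]) auto
          finally show ?thesis .
        qed
        have l4: "(\<integral>x. indicator K x * (bump \<alpha> \<beta> m (x $ i) * face_deriv B i (u k) x) \<partial>?\<nu>)
            + (\<integral>x. indicator K x * (bump' \<alpha> \<beta> m (x $ i) * u k x) \<partial>?\<nu>) = 0" for k
        proof -
          obtain C1 where C1: "\<forall>x\<in>orthant. \<bar>u k x\<bar> \<le> C1" using Cc_bounded[OF uCc] by blast
          obtain C2 where C2: "\<forall>x\<in>orthant. \<bar>ext_partial i (u k) x\<bar> \<le> C2" using ext_partial_bounded[OF u1] by blast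
          have ck: "Ck (Suc 1) (u k)" by (rule Cck_imp_Ck[OF u1])
          have "(\<integral>x. indicator K x * (bump \<alpha> \<beta> m (x $ i) * face_deriv B i (u k) x) \<partial>?\<nu>)
            + (\<integral>x. indicator K x * (bump' \<alpha> \<beta> m (x $ i) * u k x) \<partial>?\<nu>)
            = (\<integral>x. indicator K x * (bump \<alpha> \<beta> m (x $ i) * face_deriv B i (u k) x)
                + indicator K x * (bump' \<alpha> \<beta> m (x $ i) * u k x) \<partial>?\<nu>)"
            by (rule Bochner_Integration.integral_add[symmetric, OF
                  weighted_integral(1)[OF face_deriv_L2[OF u[of k]] K(1) WK W(2) bm[of m] bb[of _ m]]
                  weighted_integral(1)[OF L2_mu_face[OF uL2[of k]] K(1) WK W(2) bm'[of m] C[of _ m]]])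
          also have "\<dots> = (\<integral>x. indicator K x * (ext_partial i (u k) x * bump \<alpha> \<beta> m (x $ i) + u k x * bump' \<alpha> \<beta> m (x $ i)) \<partial>?\<nu>)"
            by (rule Bochner_Integration.integral_cong[OF refl])
              (use K(3) in \<open>auto simp: indicator_def face_deriv_def\<close>)
          also have "\<dots> = 0"
            by (rule parts[OF Ck_continuous[OF ck] _ ext_partial_continuous[OF ck] _ face_derivative[OF ck], of C1 C2])
              (use C1 C2 in auto)
          finally show ?thesis .
        qed
        have "(\<lambda>k. 0) \<longlonglongrightarrow> (\<integral>x. indicator K x * (bump \<alpha> \<beta> m (x $ i) * h x) \<partial>?\<nu>) + 0"
          using tendsto_add[OF l1 l2] unfolding l3 l4 .
        then show ?thesis by (simp add: LIMSEQ_const_iff)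
      qed
      have hK: "integrable ?\<nu> (\<lambda>x. indicator K x * (1 * h x))"
        by (rule weighted_integral(1)[OF h K(1) WK W(2) one, of 1]) simp
      have "(\<lambda>m. \<integral>x. indicator K x * (bump \<alpha> \<beta> m (x $ i) * h x) \<partial>?\<nu>) \<longlonglongrightarrow> (\<integral>x. indicator K x * (1 * h x) \<partial>?\<nu>)"
      proof (rule integral_dominated_convergence)
        show "(\<lambda>x. indicator K x * (1 * h x)) \<in> borel_measurable ?\<nu>" by (rule borel_measurable_integrable[OF hK])
        show "(\<lambda>x. indicator K x * (bump \<alpha> \<beta> m (x $ i) * h x)) \<in> borel_measurable ?\<nu>" for m
          by (rule borel_measurable_integrable[OF weighted_integral(1)[OF h K(1) WK W(2) bm bb]])
        show "integrable ?\<nu> (\<lambda>x. norm (indicator K x * (1 * h x)))" using hK by (rule integrable_norm)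
        show "AE x in ?\<nu>. (\<lambda>m. indicator K x * (bump \<alpha> \<beta> m (x $ i) * h x)) \<longlonglongrightarrow> indicator K x * (1 * h x)"
        proof (rule AE_I2)
          fix x show "(\<lambda>m. indicator K x * (bump \<alpha> \<beta> m (x $ i) * h x)) \<longlonglongrightarrow> indicator K x * (1 * h x)"
          proof (cases "x \<in> K")
            case True
            then have "(\<lambda>m. bump \<alpha> \<beta> m (x $ i)) \<longlonglongrightarrow> 1" using cyl1 by (intro bump_tendsto) auto
            then have "(\<lambda>m. bump \<alpha> \<beta> m (x $ i) * h x) \<longlonglongrightarrow> 1 * h x" by (intro tendsto_mult tendsto_const)
            then show ?thesis using True by simp
          qed simp
        qed
        show "AE x in ?\<nu>. norm (indicator K x * (bump \<alpha> \<beta> m (x $ i) * h x)) \<le> norm (indicator K x * (1 * h x))" for m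
        proof (rule AE_I2)
          fix x show "norm (indicator K x * (bump \<alpha> \<beta> m (x $ i) * h x)) \<le> norm (indicator K x * (1 * h x))"
            using mult_right_mono[OF bb, of x "\<bar>h x\<bar>" m] by (cases "x \<in> K") (auto simp: abs_mult)
        qed
      qed
      then have "(\<integral>x. indicator K x * (1 * h x) \<partial>?\<nu>) = 0" unfolding zero by (simp add: LIMSEQ_const_iff)
      then show ?thesis by (simp add: K_def)
    qed
  qed
  have "AE x in ?\<nu>. indicator (box p q \<inter> Eplus B) x * (1 * h x) = 0"
  proof (rule AE_zero_of_box_integrals_orthant)
    show "integrable ?\<nu> (\<lambda>x. indicator (box p q \<inter> Eplus B) x * (1 * h x))"
      by (rule weighted_integral(1)[OF h KB W one, of 1]) simp
    show "(\<integral>x. indicator (box a b) x * (indicator (box p q \<inter> Eplus B) x * (1 * h x)) \<partial>?\<nu>) = 0" for a b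
    proof -
      have "indicator (box a b) x * (indicator (box p q \<inter> Eplus B) x * (1 * h x))
          = indicator (box a b \<inter> box p q \<inter> Eplus B) x * h x" for x
        by (auto simp: indicator_def)
      then show ?thesis using sub[of a b] by (simp only:)
    qed
  qed simp
  then show ?thesis by eventually_elim auto
qed

text \<open>Every point of \<open>V\<close> on the face that belongs to \<open>R\<^sub>\<rho>\<close> lies in a box to which \<open>weak_derivative_box\<close> applies. By the
Lindelof property countably many of these boxes suffice, and by hypothesis (b) together with the positivity of \<open>\<rho>\<close> the
points of the face outside \<open>R\<^sub>\<rho>\<close> form a null set.\<close>

lemma weak_derivative_zero:
  assumes iB: "i \<in> B" and u: "\<And>k. u k \<in> Cck 2" and f: "f \<in> L2 \<mu>" and uf: "L2.conv \<mu> u f"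
    and h: "h \<in> L2 (\<mu>F B)" and uh: "L2.conv (\<mu>F B) (\<lambda>k. face_deriv B i (u k)) h"
    and V: "open V" and fc: "AE x in \<mu>. x \<in> V \<longrightarrow> f x = c"
  shows "AE x in \<mu>F B. x \<in> V \<longrightarrow> h x = 0"
proof -
  let ?\<nu> = "lam_s s B"
  define good where "good Q \<longleftrightarrow> (\<exists>p q. Q = box p q \<and> (\<forall>j\<in>B. 0 < p $ j) \<and> box p q \<subseteq> V \<and>
    (\<integral>\<^sup>+y. inverse (ennreal (\<rho> y)) * indicator (box p q \<inter> Eplus B) y \<partial>?\<nu>) < \<infinity>)" for Q
  have box0: "AE x in ?\<nu>. x \<in> Q \<inter> Eplus B \<longrightarrow> h x = 0" if good: "good Q" for Q
  proof -
    obtain p q where Q: "Q = box p q" "\<forall>j\<in>B. 0 < p $ j" "box p q \<subseteq> V"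
      "(\<integral>\<^sup>+y. inverse (ennreal (\<rho> y)) * indicator (box p q \<inter> Eplus B) y \<partial>?\<nu>) < \<infinity>"
      using good unfolding good_def by blast
    have "AE x in \<mu>. x \<in> box p q \<longrightarrow> f x = c" using fc by eventually_elim (use Q(3) in auto)
    from weak_derivative_box[OF iB u f uf h uh this bspec[OF Q(2)] Q(4)] show ?thesis by (simp add: Q(1))
  qed
  have "\<And>Q. Q \<in> Collect good \<Longrightarrow> open Q" by (auto simp: good_def)
  from Lindelof[OF this] obtain F' where F': "F' \<subseteq> Collect good" "countable F'" "\<Union>F' = \<Union>(Collect good)" by blast
  have "AE x in ?\<nu>. \<forall>Q\<in>F'. x \<in> Q \<inter> Eplus B \<longrightarrow> h x = 0"
    using F' box0 by (subst AE_ball_countable[OF F'(2)]) auto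
  then have on_good: "AE x in ?\<nu>. x \<in> \<Union>(Collect good) \<inter> Eplus B \<longrightarrow> h x = 0"
    unfolding F'(3)[symmetric] by eventually_elim auto
  have cover: "x \<in> \<Union>(Collect good)" if x: "x \<in> V" "x \<in> Eplus B" "x \<in> R_set s \<rho> B" for x
  proof -
    obtain \<epsilon> where \<epsilon>: "\<epsilon> > 0" "(\<integral>\<^sup>+y\<in>{y \<in> closure (Eplus B). norm (x - y) \<le> \<epsilon>}. inverse (ennreal (\<rho> y)) \<partial>?\<nu>) < \<infinity>"
      using x(3) by (auto simp: R_set_def)
    obtain r where r: "r > 0" "ball x r \<subseteq> V" using V x(1) open_contains_ball by blast
    define m where "m = Min ((\<lambda>j. x $ j) ` B)"
    have ne: "(\<lambda>j. x $ j) ` B \<noteq> {}" using iB by auto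
    have mpos: "m > 0" "\<And>j. j \<in> B \<Longrightarrow> m \<le> x $ j"
    proof -
      show "m > 0" unfolding m_def using x(2) ne by (subst Min_gr_iff) (auto simp: Eplus_iff)
      show "m \<le> x $ j" if "j \<in> B" for j unfolding m_def using that by (intro Min_le) auto
    qed
    define n where "n = real CARD('n)"
    have n: "n \<ge> 1" unfolding n_def using zero_less_card_finite[where 'a='n] by linarith
    \<comment> \<open>half the side length of a box around \<open>x\<close> that lies in the ball of radius \<open>min \<epsilon> r\<close> and stays
      away from the smaller faces\<close>
    define \<delta> where "\<delta> = min (min \<epsilon> r / (2 * n)) (m / 2)"
    have \<delta>: "\<delta> > 0" "\<delta> < m" "n * \<delta> \<le> min \<epsilon> r / 2"
    proof -
      show "\<delta> > 0" "\<delta> < m" using \<epsilon> r mpos n by (auto simp: \<delta>_def)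
      have "n * \<delta> \<le> n * (min \<epsilon> r / (2 * n))" using n by (intro mult_left_mono) (auto simp: \<delta>_def)
      then show "n * \<delta> \<le> min \<epsilon> r / 2" using n by simp
    qed
    define p q where "p = (\<chi> j. x $ j - \<delta>)" and "q = (\<chi> j. x $ j + \<delta>)"
    have near: "norm (x - y) < min \<epsilon> r" if "y \<in> box p q" for y
    proof -
      have "norm (x - y) \<le> (\<Sum>j\<in>UNIV. \<bar>(x - y) $ j\<bar>)" by (rule norm_le_l1_cart)
      also have "\<dots> \<le> (\<Sum>j\<in>(UNIV::'n set). \<delta>)"
      proof (rule sum_mono)
        fix j show "\<bar>(x - y) $ j\<bar> \<le> \<delta>"
          using that by (auto simp: mem_box_cart p_def q_def abs_le_iff dest!: spec[of _ j])
      qed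
      also have "\<dots> = n * \<delta>" by (simp add: n_def)
      also have "\<dots> < min \<epsilon> r" using \<delta>(3) \<epsilon>(1) r(1) by linarith
      finally show ?thesis .
    qed
    have "good (box p q)"
      unfolding good_def
    proof (intro exI conjI ballI)
      show "box p q = box p q" ..
      show "0 < p $ j" if "j \<in> B" for j using mpos(2)[OF that] \<delta> by (simp add: p_def)
      show "box p q \<subseteq> V" using near r(2) by (force simp: dist_norm)
      have "(\<integral>\<^sup>+y. inverse (ennreal (\<rho> y)) * indicator (box p q \<inter> Eplus B) y \<partial>?\<nu>)
          \<le> (\<integral>\<^sup>+y\<in>{y \<in> closure (Eplus B). norm (x - y) \<le> \<epsilon>}. inverse (ennreal (\<rho> y)) \<partial>?\<nu>)"
        using near closure_subset[of "Eplus B"]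
        by (intro nn_integral_mono mult_left_mono) (auto simp: indicator_def intro: less_imp_le)
      also have "\<dots> < \<infinity>" by (rule \<epsilon>)
      finally show "(\<integral>\<^sup>+y. inverse (ennreal (\<rho> y)) * indicator (box p q \<inter> Eplus B) y \<partial>?\<nu>) < \<infinity>" .
    qed
    moreover have "x \<in> box p q" using \<delta> by (simp add: mem_box_cart p_def q_def)
    ultimately show ?thesis by blast
  qed
  have "B \<noteq> {}" using iB by auto
  from on_good rho_singular[OF this] rho_pos_face[of B]
  have "AE x in ?\<nu>. x \<in> V \<inter> Eplus B \<longrightarrow> h x = 0"
  proof eventually_elim
    case (elim x)
    show ?case
    proof
      assume x: "x \<in> V \<inter> Eplus B"
      then have "x \<in> R_set s \<rho> B" using elim closure_subset[of "Eplus B"] by auto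
      then show "h x = 0" using cover x elim(1) by blast
    qed
  qed
  then have "AE x in ?\<nu>. 0 < ennreal (\<rho> x) \<longrightarrow> x \<in> V \<inter> Eplus B \<longrightarrow> h x = 0"
    by eventually_elim simp
  then have on_face: "AE x in \<mu>F B. x \<in> V \<inter> Eplus B \<longrightarrow> h x = 0"
    unfolding mu_face_def by (subst AE_density) measurable
  have "AE x in \<mu>F B. x \<notin> Eplus B \<longrightarrow> h x = 0"
  proof (rule L2_conv_zero_outside[OF face_deriv_L2[OF u] h uh])
    show "Eplus B \<in> sets (\<mu>F B)" using Eplus_orthant by (simp add: sets_restrict_space_iff)
    show "face_deriv B i (u k) x = 0" if "x \<notin> Eplus B" for k x using that by (simp add: face_deriv_def)
  qed
  with on_face show ?thesis by eventually_elim auto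
qed

end

section \<open>Approximation by twice differentiable functions of compact support\<close>

lemma Ck_norm_square: "Ck k (\<lambda>x::real^'n. x \<bullet> x)"
proof -
  have "Ck k (\<lambda>x::real^'n. \<Sum>i\<in>I. x $ i * x $ i)" for I
    by (induction I rule: infinite_finite_induct) (auto intro!: Ck_const Ck_add Ck_mult Ck_component)
  then show ?thesis by (simp add: inner_vec_def)
qed

text \<open>\<open>t\<^sup>3\<close> for \<open>t \<ge> 0\<close> and \<open>0\<close> for \<open>t \<le> 0\<close>; the formula avoids a case distinction in the differentiation.\<close>

definition pos3 :: "real \<Rightarrow> real" where "pos3 t = (t * t * t + t * (t * \<bar>t\<bar>)) / 2"

lemma abs_square_derivative: "((\<lambda>t. t * \<bar>t\<bar>) has_real_derivative 2 * \<bar>t\<bar>) (at (t::real))"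
proof -
  consider "t > 0" | "t < 0" | "t = 0" by linarith
  then show ?thesis
  proof cases
    case 1
    have "((\<lambda>t. t * t) has_real_derivative 2 * \<bar>t\<bar>) (at t)"
      using 1 by (auto intro!: derivative_eq_intros)
    then show ?thesis
      by (rule has_field_derivative_transform_within_open[OF _ open_greaterThan[of 0]]) (use 1 in auto)
  next
    case 2
    have "((\<lambda>t. - (t * t)) has_real_derivative 2 * \<bar>t\<bar>) (at t)"
      using 2 by (auto intro!: derivative_eq_intros)
    then show ?thesis
      by (rule has_field_derivative_transform_within_open[OF _ open_lessThan[of 0]]) (use 2 in auto)
  next
    case 3
    have "((\<lambda>h::real. \<bar>h\<bar>) \<longlongrightarrow> \<bar>0\<bar>) (at 0)" by (intro tendsto_intros)
    moreover have "\<forall>\<^sub>F h::real in at 0. \<bar>h\<bar> = ((0 + h) * \<bar>0 + h\<bar> - 0 * \<bar>0\<bar>) / h"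
      by (simp add: eventually_at_filter)
    ultimately have "((\<lambda>h::real. ((0 + h) * \<bar>0 + h\<bar> - 0 * \<bar>0\<bar>) / h) \<longlongrightarrow> \<bar>0\<bar>) (at 0)"
      by (rule Lim_transform_eventually)
    then show ?thesis unfolding 3 DERIV_def by simp
  qed
qed

definition pos3' :: "real \<Rightarrow> real" where "pos3' t = (3 * (t * t) + 3 * (t * \<bar>t\<bar>)) / 2"

lemma pos3_derivative: "(pos3 has_real_derivative pos3' t) (at t)"
proof -
  have "((\<lambda>t. t * (t * \<bar>t\<bar>)) has_real_derivative 1 * (t * \<bar>t\<bar>) + 2 * \<bar>t\<bar> * t) (at t)"
    by (rule DERIV_mult[OF DERIV_ident abs_square_derivative])
  moreover have "((\<lambda>t. t * t * t) has_real_derivative 3 * (t * t)) (at t)"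
    by (auto intro!: derivative_eq_intros)
  ultimately have "((\<lambda>t. (t * t * t + t * (t * \<bar>t\<bar>)) / 2) has_real_derivative
      (3 * (t * t) + (1 * (t * \<bar>t\<bar>) + 2 * \<bar>t\<bar> * t)) / 2) (at t)"
    by (intro DERIV_cdivide DERIV_add)
  then show ?thesis unfolding pos3_def[abs_def] pos3'_def by (simp add: mult_ac)
qed

lemma pos3'_derivative: "(pos3' has_real_derivative 3 * t + 3 * \<bar>t\<bar>) (at t)"
proof -
  have "((\<lambda>t. (3 * (t * t) + 3 * (t * \<bar>t\<bar>)) / 2) has_real_derivative (3 * (2 * t) + 3 * (2 * \<bar>t\<bar>)) / 2) (at t)"
    by (intro DERIV_cdivide DERIV_add DERIV_cmult abs_square_derivative) (auto intro!: derivative_eq_intros)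
  moreover have "(3 * (2 * t) + 3 * (2 * \<bar>t\<bar>)) / 2 = 3 * t + 3 * \<bar>t\<bar>" by simp
  ultimately show ?thesis unfolding pos3'_def[abs_def] by (simp only:)
qed

lemma smooth_pos3: "smooth 2 pos3"
  unfolding numeral_2_eq_2 smooth.simps
  using pos3_derivative pos3'_derivative
  by (intro exI[of _ pos3'] exI[of _ "\<lambda>t. 3 * t + 3 * \<bar>t\<bar>"] conjI allI) (auto intro!: continuous_intros)

lemma pos3'_continuous: "continuous_on UNIV pos3'"
  using pos3'_derivative by (intro continuous_at_imp_continuous_on ballI DERIV_isCont)

lemma pos3_continuous: "continuous_on UNIV pos3"
  using pos3_derivative by (intro continuous_at_imp_continuous_on ballI DERIV_isCont)

lemma pos3_nonpos: "t \<le> 0 \<Longrightarrow> pos3 t = 0" and pos3_pos: "t \<ge> 0 \<Longrightarrow> pos3 t = t ^ 3"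
  by (auto simp: pos3_def power3_eq_cube)

lemma pos3_nonneg: "0 \<le> pos3 t"
  by (cases "t \<le> 0") (auto simp: pos3_nonpos pos3_pos)

lemma pos3_mono: "a \<le> b \<Longrightarrow> pos3 a \<le> pos3 b"
  by (cases "a \<le> 0") (auto simp: pos3_nonpos pos3_pos pos3_nonneg intro: power_mono)

lemma cutoff_Cck:
  assumes "a > 0" and p: "Ck 2 p"
  shows "(\<lambda>x::real^'n. pos3 (r - a * (x \<bullet> x)) * p x) \<in> Cck 2"
proof -
  have "Ck 2 (\<lambda>x::real^'n. r + (- a) * (x \<bullet> x))"
    by (intro Ck_add Ck_scale Ck_const Ck_norm_square)
  then have "Ck 2 (\<lambda>x::real^'n. pos3 (r - a * (x \<bullet> x)) * p x)"
    using Ck_mult[OF Ck_compose[OF _ smooth_pos3] p] by simp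
  moreover have "norm x \<le> sqrt (r / a)" if "pos3 (r - a * (x \<bullet> x)) * p x \<noteq> 0" for x :: "real^'n"
  proof -
    have "r - a * (x \<bullet> x) > 0" using that pos3_nonpos[of "r - a * (x \<bullet> x)"] by force
    then have "(norm x)\<^sup>2 \<le> r / a" using assms by (simp add: field_simps power2_norm_eq_inner)
    then show ?thesis by (rule real_le_rsqrt)
  qed
  ultimately show ?thesis by (auto simp: Cck_iff)
qed

text \<open>After division by a cut-off function the Weierstrass theorem applies on a compact set; outside of
  it both functions vanish.\<close>

lemma Cck_uniformly_dense:
  fixes f :: "real^'n \<Rightarrow> real"
  assumes f: "f \<in> Cc orthant" and e: "e > 0"
  obtains g where "g \<in> Cck 2" "\<And>x. x \<in> orthant \<Longrightarrow> \<bar>f x - g x\<bar> < e"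
proof -
  obtain R0 where fc: "continuous_on orthant f" and R0: "\<And>x. x \<in> orthant \<Longrightarrow> f x \<noteq> 0 \<Longrightarrow> norm x \<le> R0"
    using f unfolding Cc_orthant_iff by blast
  define R where "R = \<bar>R0\<bar> + 1"
  define cut where "cut x = pos3 (R\<^sup>2 - 1 * (x \<bullet> x))" for x :: "real^'n"
  define \<delta> where "\<delta> = pos3 (R\<^sup>2 - R0\<^sup>2)"
  have RR: "R\<^sup>2 - R0\<^sup>2 > 0" by (simp add: R_def power2_sum)
  have \<delta>: "\<delta> > 0" unfolding \<delta>_def using RR by (simp add: pos3_pos)
  have cut_continuous: "continuous_on S cut" for S
    unfolding cut_def by (intro continuous_on_compose2[OF pos3_continuous] continuous_intros) auto
  have cut_ge: "cut x \<ge> \<delta>" if "norm x \<le> R0" for x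
  proof -
    have "(norm x)\<^sup>2 \<le> R0\<^sup>2" using that by (intro power_mono) auto
    then show ?thesis unfolding cut_def \<delta>_def by (intro pos3_mono) (simp add: power2_norm_eq_inner)
  qed
  have cut_zero: "cut x = 0" if "norm x > R" for x
  proof -
    have "R\<^sup>2 \<le> (norm x)\<^sup>2" using that by (intro power_mono) (auto simp: R_def)
    then show ?thesis unfolding cut_def by (intro pos3_nonpos) (simp add: power2_norm_eq_inner)
  qed
  define C where "C = pos3 (R\<^sup>2) + 1"
  have C: "C > 0" "0 \<le> cut x" "cut x < C" for x
  proof -
    show "C > 0" using pos3_nonneg[of "R\<^sup>2"] by (simp add: C_def)
    show "0 \<le> cut x" by (simp add: cut_def pos3_nonneg)
    have "cut x \<le> pos3 (R\<^sup>2)" unfolding cut_def by (intro pos3_mono) simp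
    then show "cut x < C" by (simp add: C_def)
  qed
  define q where "q x = f x / max (cut x) \<delta>" for x
  have max_nz: "max (cut x) \<delta> \<noteq> 0" for x using \<delta> by linarith
  have "continuous_on orthant q"
    unfolding q_def using max_nz by (intro continuous_on_divide fc continuous_on_max cut_continuous continuous_on_const) auto
  then have "continuous_on (orthant \<inter> cball 0 R) q" by (rule continuous_on_subset) auto
  moreover have "compact (orthant \<inter> cball (0::real^'n) R)"
    by (intro closed_Int_compact closed_orthant) auto
  moreover have "e / C > 0" using e C(1) by simp
  ultimately obtain p where p: "real_polynomial_function p" "\<And>x. x \<in> orthant \<inter> cball 0 R \<Longrightarrow> \<bar>q x - p x\<bar> < e / C"
    using Stone_Weierstrass_real_polynomial_function by blast
  have fq: "f x = cut x * q x" if "x \<in> orthant" for x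
  proof (cases "f x = 0")
    case False
    then have "max (cut x) \<delta> = cut x" using cut_ge[OF R0[OF that]] by simp
    then show ?thesis using max_nz[of x] by (simp add: q_def)
  qed (simp add: q_def)
  have "(\<lambda>x. cut x * p x) \<in> Cck 2"
    unfolding cut_def by (rule cutoff_Cck[OF _ Ck_real_polynomial_function[OF p(1)]]) simp
  moreover have "\<bar>f x - cut x * p x\<bar> < e" if x: "x \<in> orthant" for x
  proof (cases "norm x \<le> R")
    case True
    have "\<bar>f x - cut x * p x\<bar> = cut x * \<bar>q x - p x\<bar>"
      using C(2)[of x] by (simp add: fq[OF x] abs_mult flip: right_diff_distrib)
    also have "\<dots> \<le> cut x * (e / C)"
      using p(2)[of x] True x C(2)[of x] by (intro mult_left_mono) auto
    also have "\<dots> < C * (e / C)" using C(3)[of x] \<open>e / C > 0\<close> by (intro mult_strict_right_mono)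
    finally show ?thesis using C(1) by simp
  next
    case False
    then show ?thesis using cut_zero[of x] fq[OF x] e by simp
  qed
  ultimately show ?thesis using that by blast
qed

lemma L2_N_mono:
  assumes "f \<in> L2 M" "g \<in> L2 M" and le: "\<And>x. x \<in> space M \<Longrightarrow> \<bar>g x\<bar> \<le> \<bar>f x\<bar>"
  shows "L2.N M g \<le> L2.N M f"
  unfolding L2.N_def L2_inner_def
proof (rule real_sqrt_le_mono, rule integral_mono[OF L2_product_integrable[OF assms(2,2)] L2_product_integrable[OF assms(1,1)]])
  show "g x * g x \<le> f x * f x" if "x \<in> space M" for x
    using le[OF that] by (simp add: abs_le_square_iff flip: power2_eq_square)
qed

lemma box_indicator_approx:
  fixes a b :: "real^'n"
  obtains g :: "nat \<Rightarrow> real^'n \<Rightarrow> real" where "\<And>k. g k \<in> Cc orthant" "\<And>k x. \<bar>g k x\<bar> \<le> 1"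
    "\<And>x. (\<lambda>k. g k x) \<longlonglongrightarrow> indicator (box a b) x"
proof -
  define S where "S = - box a b"
  have S: "closed S" "S \<noteq> {}"
  proof -
    show "closed S" unfolding S_def by (intro closed_Compl open_box)
    have "box a b \<noteq> UNIV" using bounded_box[of a b] not_bounded_UNIV by metis
    then show "S \<noteq> {}" unfolding S_def by (metis Compl_UNIV_eq double_complement)
  qed
  define g where "g k x = min 1 (real k * infdist x S)" for k x
  show ?thesis
  proof (rule that[of g])
    show "\<bar>g k x\<bar> \<le> 1" for k x using infdist_nonneg[of x S] by (auto simp: g_def abs_le_iff)
    obtain R where R: "\<forall>x\<in>box a b. norm x \<le> R" using bounded_box[of a b] unfolding bounded_iff by blast
    show "g k \<in> Cc orthant" for k
      unfolding Cc_orthant_iff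
    proof
      show "continuous_on orthant (g k)"
        unfolding g_def by (intro continuous_on_min continuous_intros continuous_on_infdist)
      show "\<exists>R. \<forall>x\<in>orthant. g k x \<noteq> 0 \<longrightarrow> norm x \<le> R"
        using R by (intro exI[of _ R]) (auto simp: g_def S_def)
    qed
    show "(\<lambda>k. g k x) \<longlonglongrightarrow> indicator (box a b) x" for x
    proof (cases "x \<in> box a b")
      case True
      then have "infdist x S \<noteq> 0" using in_closed_iff_infdist_zero[OF S, of x] by (auto simp: S_def)
      then have pos: "infdist x S > 0" using infdist_nonneg[of x S] by simp
      obtain n :: nat where n: "1 < real n * infdist x S" using reals_Archimedean3[OF pos] by blast
      have "g k x = 1" if "k \<ge> n" for k
      proof -
        have "real n * infdist x S \<le> real k * infdist x S" using that pos by (intro mult_right_mono) auto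
        then show ?thesis using n by (simp add: g_def)
      qed
      then have "\<forall>\<^sub>F k in sequentially. g k x = 1" unfolding eventually_sequentially by blast
      then show ?thesis using True by (simp add: tendsto_eventually)
    next
      case False
      then have "infdist x S = 0" by (simp add: S_def)
      then show ?thesis using False by (simp add: g_def)
    qed
  qed
qed

context face_data begin

lemma Cck_L2: "f \<in> Cck k \<Longrightarrow> f \<in> L2 \<mu>"
  by (rule Cc_L2[OF Cck_imp_Cc])

lemma const_L2: "(\<lambda>x. c) \<in> L2 \<mu>" "(\<lambda>x. c) \<in> L2 (\<mu>F B)"
  by (auto intro: bounded_L2[OF finite_mu] bounded_L2[OF finite_mu_face])

lemma const_N: "L2.N \<mu> (\<lambda>x. c) = \<bar>c\<bar> * sqrt (measure \<mu> orthant)"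
  by (simp add: L2.N_def L2_inner_def real_sqrt_mult)

text \<open>Orthogonality extends to continuous functions of compact support by uniform approximation, and to indicators of
boxes by dominated convergence.\<close>

lemma orthogonal_imp_zero:
  assumes w: "w \<in> L2 \<mu>" and orth: "\<And>v. v \<in> Cck 2 \<Longrightarrow> L2_inner \<mu> w v = 0"
  shows "AE x in \<mu>. w x = 0"
proof -
  have Cc: "L2_inner \<mu> w g = 0" if g: "g \<in> Cc orthant" for g
  proof (rule ccontr)
    assume ne: "L2_inner \<mu> w g \<noteq> 0"
    define K where "K = L2.N \<mu> w * sqrt (measure \<mu> orthant) + 1"
    have K: "K > 0" using L2.N_nonneg[OF w] by (simp add: K_def add_nonneg_pos)
    define e where "e = \<bar>L2_inner \<mu> w g\<bar> / K"
    have e: "e > 0" using ne K by (simp add: e_def)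
    obtain v where v: "v \<in> Cck 2" "\<And>x. x \<in> orthant \<Longrightarrow> \<bar>g x - v x\<bar> < e"
      by (rule Cck_uniformly_dense[OF g e]) blast
    have L: "g \<in> L2 \<mu>" "v \<in> L2 \<mu>" by (rule Cc_L2[OF g], rule Cck_L2[OF v(1)])
    have "\<bar>L2_inner \<mu> w g\<bar> = \<bar>L2_inner \<mu> w (g - v)\<bar>"
      using orth[OF v(1)] L w by (simp add: L2.diff_right)
    also have "\<dots> \<le> L2.N \<mu> w * L2.N \<mu> (g - v)" using w L by (intro L2.Cauchy_Schwarz) auto
    also have "\<dots> \<le> L2.N \<mu> w * L2.N \<mu> (\<lambda>x. e)"
      using v(2) e by (intro mult_left_mono L2_N_mono const_L2 L2.diff_mem L L2.N_nonneg[OF w]) (force intro: less_imp_le)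
    also have "\<dots> = e * (L2.N \<mu> w * sqrt (measure \<mu> orthant))" using e by (simp add: const_N)
    also have "\<dots> < e * K" using e by (simp add: K_def)
    also have "\<dots> = \<bar>L2_inner \<mu> w g\<bar>" using K by (simp add: e_def)
    finally show False by simp
  qed
  have wint: "integrable \<mu> w" using L2_product_integrable[OF w const_L2(1)[of 1]] by simp
  show ?thesis
  proof (rule AE_zero_of_box_integrals_orthant[OF _ wint])
    fix a b :: "real^'n"
    obtain g :: "nat \<Rightarrow> real^'n \<Rightarrow> real" where g: "\<And>k. g k \<in> Cc orthant" "\<And>k x. \<bar>g k x\<bar> \<le> 1"
      and lim: "\<And>x. (\<lambda>k. g k x) \<longlonglongrightarrow> indicator (box a b) x"
      by (rule box_indicator_approx[of a b]) blast
    have "(\<lambda>k. \<integral>x. w x * g k x \<partial>\<mu>) \<longlonglongrightarrow> (\<integral>x. w x * indicator (box a b) x \<partial>\<mu>)"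
    proof (rule integral_dominated_convergence)
      show "integrable \<mu> (\<lambda>x. norm (w x))" using wint by (rule integrable_norm)
      have wm: "w \<in> borel_measurable (restrict_space borel orthant)"
        using borel_measurable_integrable[OF wint] by (simp only: measurable_mu_iff)
      show "(\<lambda>x. w x * g k x) \<in> borel_measurable \<mu>" for k
        by (rule borel_measurable_integrable[OF L2_product_integrable[OF w Cc_L2[OF g(1)]]])
      show "(\<lambda>x. w x * indicator (box a b) x) \<in> borel_measurable \<mu>"
        unfolding measurable_mu_iff by (intro borel_measurable_times wm measurable_orthant borel_measurable_indicator) auto
      show "AE x in \<mu>. (\<lambda>k. w x * g k x) \<longlonglongrightarrow> w x * indicator (box a b) x"
        by (intro AE_I2 tendsto_mult tendsto_const lim)
      show "AE x in \<mu>. norm (w x * g k x) \<le> norm (w x)" for k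
        using mult_left_mono[OF g(2)] by (intro AE_I2) (force simp: abs_mult)
    qed
    moreover have "(\<integral>x. w x * g k x \<partial>\<mu>) = 0" for k using Cc[OF g(1)] by (simp add: L2_inner_def)
    ultimately show "(\<integral>x. indicator (box a b) x * w x \<partial>\<mu>) = 0" by (simp add: LIMSEQ_const_iff mult.commute)
  qed simp
qed

lemma subspace_Cck: "subspace (Cck 2 :: (real^'n \<Rightarrow> real) set)"
proof (rule subspaceI)
  show "0 \<in> Cck 2" using Ck_const[of 2 0] by (auto simp: Cck_iff zero_fun_def)
  show "f + g \<in> Cck 2" if fg: "f \<in> Cck 2" "g \<in> Cck 2" for f g :: "real^'n \<Rightarrow> real"
  proof -
    obtain R R' where R: "\<And>x. x \<in> orthant \<Longrightarrow> f x \<noteq> 0 \<Longrightarrow> norm x \<le> R" "\<And>x. x \<in> orthant \<Longrightarrow> g x \<noteq> 0 \<Longrightarrow> norm x \<le> R'"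
      using fg unfolding Cck_iff by blast
    have "\<forall>x\<in>orthant. f x + g x \<noteq> 0 \<longrightarrow> norm x \<le> max R R'"
    proof (intro ballI impI)
      fix x assume x: "x \<in> orthant" "f x + g x \<noteq> 0"
      then have "f x \<noteq> 0 \<or> g x \<noteq> 0" by auto
      then show "norm x \<le> max R R'" using R x(1) by (metis max.coboundedI1 max.coboundedI2)
    qed
    then show ?thesis using fg Ck_add[of 2 f g] unfolding Cck_iff plus_fun_def by blast
  qed
  show "c *\<^sub>R f \<in> Cck 2" if fc: "f \<in> Cck 2" for c and f :: "real^'n \<Rightarrow> real"
  proof -
    obtain R where "\<And>x. x \<in> orthant \<Longrightarrow> f x \<noteq> 0 \<Longrightarrow> norm x \<le> R" using fc unfolding Cck_iff by blast
    then have "\<forall>x\<in>orthant. c * f x \<noteq> 0 \<longrightarrow> norm x \<le> R" by auto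
    then show ?thesis using fc Ck_scale[of 2 f c] unfolding Cck_iff scaleR_fun_def real_scaleR_def by blast
  qed
qed

text \<open>The orthogonal projection onto the closure of the test functions differs from the
  identity only by functions orthogonal to all test functions.\<close>

lemma Cck_dense:
  assumes f: "f \<in> L2 \<mu>" and e: "e > 0"
  shows "\<exists>g\<in>Cck 2. L2.N \<mu> (f - g) < e"
proof -
  define V where "V = {g \<in> L2 \<mu>. \<forall>e>0. \<exists>v\<in>Cck 2. L2.N \<mu> (g - v) < e}"
  have VL: "g \<in> L2 \<mu>" if "g \<in> V" for g using that by (simp add: V_def)
  have VI: "g \<in> V" if "g \<in> L2 \<mu>" "\<And>e. e > 0 \<Longrightarrow> \<exists>v\<in>Cck 2. L2.N \<mu> (g - v) < e" for g
    using that by (simp add: V_def)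
  have CV: "v \<in> V" if "v \<in> Cck 2" for v
    by (rule VI[OF Cck_L2[OF that]]) (use that in \<open>auto intro!: bexI[of _ v]\<close>)
  have "subspace V"
  proof (rule subspaceI)
    show "0 \<in> V" by (rule CV[OF subspace_0[OF subspace_Cck]])
    show "g + h \<in> V" if g: "g \<in> V" and h: "h \<in> V" for g h
    proof (rule VI)
      show "g + h \<in> L2 \<mu>" using VL[OF g] VL[OF h] by simp
      fix e :: real assume "e > 0"
      then have "e/2 > 0" by simp
      then obtain v v' where v: "v \<in> Cck 2" "L2.N \<mu> (g - v) < e/2" "v' \<in> Cck 2" "L2.N \<mu> (h - v') < e/2"
        using g h unfolding V_def by blast
      have "L2.N \<mu> ((g - v) + (h - v')) \<le> L2.N \<mu> (g - v) + L2.N \<mu> (h - v')"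
        using VL[OF g] VL[OF h] Cck_L2[OF v(1)] Cck_L2[OF v(3)] by (intro L2.N_triangle) auto
      moreover have "(g - v) + (h - v') = g + h - (v + v')" by simp
      ultimately have "L2.N \<mu> (g + h - (v + v')) < e" using v by simp
      then show "\<exists>v\<in>Cck 2. L2.N \<mu> (g + h - v) < e" using subspace_add[OF subspace_Cck v(1,3)] by blast
    qed
    show "c *\<^sub>R g \<in> V" if g: "g \<in> V" for c g
    proof (rule VI)
      show "c *\<^sub>R g \<in> L2 \<mu>" using VL[OF g] by simp
      fix e :: real assume "e > 0"
      then have "e / (\<bar>c\<bar> + 1) > 0" by simp
      then obtain v where v: "v \<in> Cck 2" "L2.N \<mu> (g - v) < e / (\<bar>c\<bar> + 1)"
        using g unfolding V_def by blast
      have "L2.N \<mu> (c *\<^sub>R g - c *\<^sub>R v) = \<bar>c\<bar> * L2.N \<mu> (g - v)"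
        using VL[OF g] Cck_L2[OF v(1)] by (simp flip: scaleR_diff_right add: L2.N_scale)
      also have "\<dots> \<le> \<bar>c\<bar> * (e / (\<bar>c\<bar> + 1))" using v by (intro mult_left_mono) auto
      also have "\<dots> < e" using \<open>e > 0\<close> by (simp add: field_simps)
      finally show "\<exists>v\<in>Cck 2. L2.N \<mu> (c *\<^sub>R g - v) < e" using subspace_scale[OF subspace_Cck v(1)] by blast
    qed
  qed
  then interpret V: semi_inner V "L2_inner \<mu>"
  proof (rule semi_inner.intro)
    show "L2_inner \<mu> u v = L2_inner \<mu> v u" if "u \<in> V" "v \<in> V" for u v
      by (rule L2.sym[OF VL[OF that(1)] VL[OF that(2)]])
  qed (auto simp: VL L2.add_left L2.scale_left L2_inner_nonneg)
  have "V.is_complete"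
    unfolding V.is_complete_def
  proof (intro allI impI, elim conjE)
    fix u assume u: "\<forall>k. u k \<in> V" and Cau: "L2.Cau \<mu> u"
    have uL: "u k \<in> L2 \<mu>" for k using u VL by blast
    obtain g where g: "g \<in> L2 \<mu>" "L2.conv \<mu> u g" using L2.completeD[OF L2_complete uL Cau] by blast
    have "g \<in> V"
    proof (rule VI[OF g(1)])
      fix e :: real assume "e > 0"
      have "(\<lambda>k. L2.N \<mu> (u k - g)) \<longlonglongrightarrow> 0" using g L2.conv_N[of u \<mu> g] uL by blast
      then have "\<forall>\<^sub>F k in sequentially. L2.N \<mu> (u k - g) < e/2" using \<open>e > 0\<close> by (intro order_tendstoD) auto
      then obtain k where k: "L2.N \<mu> (u k - g) < e/2" by (auto simp: eventually_sequentially)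
      obtain v where v: "v \<in> Cck 2" "L2.N \<mu> (u k - v) < e/2"
      proof -
        have "u k \<in> V" "e/2 > 0" using u \<open>e > 0\<close> by auto
        then have "\<exists>v\<in>Cck 2. L2.N \<mu> (u k - v) < e/2" unfolding V_def by blast
        then show ?thesis using that by blast
      qed
      have "L2.N \<mu> (g - v) \<le> L2.N \<mu> (g - u k) + L2.N \<mu> (u k - v)"
        by (rule L2.N_triangle_diff[OF g(1) uL Cck_L2[OF v(1)]])
      also have "L2.N \<mu> (g - u k) = L2.N \<mu> (u k - g)" by (rule L2.N_commute[OF g(1) uL])
      finally have "L2.N \<mu> (g - v) < e" using k v(2) by linarith
      then show "\<exists>v\<in>Cck 2. L2.N \<mu> (g - v) < e" using v(1) by blast
    qed
    then show "\<exists>f\<in>V. L2.conv \<mu> u f" using g(2) by blast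
  qed
  then obtain p where p: "p \<in> V" "\<And>v. v \<in> V \<Longrightarrow> L2_inner \<mu> p v = L2_inner \<mu> f v"
  proof (rule V.Riesz_representation[of "L2_inner \<mu> f" "L2.N \<mu> f"])
    show "\<bar>L2_inner \<mu> f u\<bar> \<le> L2.N \<mu> f * L2.N \<mu> u" if "u \<in> V" for u
      by (rule L2.Cauchy_Schwarz[OF f VL[OF that]])
  qed (use f VL in \<open>auto simp: L2.add_right L2.scale_right\<close>)
  have pL: "p \<in> L2 \<mu>" by (rule VL[OF p(1)])
  have "AE x in \<mu>. (f - p) x = 0"
  proof (rule orthogonal_imp_zero)
    show "L2_inner \<mu> (f - p) v = 0" if "v \<in> Cck 2" for v
      using p(2)[OF CV[OF that]] by (simp add: L2.diff_left f pL Cck_L2[OF that])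
  qed (rule L2.diff_mem[OF f pL])
  then have "L2.N \<mu> (f - p) = 0" by (subst L2_N_zero_AE[OF f pL]) simp
  moreover obtain v where v: "v \<in> Cck 2" "L2.N \<mu> (p - v) < e" using p(1) e unfolding V_def by blast
  ultimately have "L2.N \<mu> (f - v) < e"
    using L2.N_triangle_diff[OF f pL Cck_L2[OF v(1)]] by simp
  then show ?thesis using v(1) by blast
qed

end

section \<open>The form and its closure\<close>

context face_data begin

text \<open>Indexing by pairs of a face and a direction tangential to it turns the double sum of the form into a single
one.\<close>

definition dirs :: "('n set \<times> 'n) set" where "dirs = (SIGMA B:{B. B \<noteq> {}}. B)"

abbreviation "M\<^sub>p p \<equiv> \<mu>F (fst p)"
abbreviation "D\<^sub>p p \<equiv> face_deriv (fst p) (snd p)"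

lemma finite_dirs [simp]: "finite dirs"
  by (simp add: dirs_def)

lemma dirs_mem: "p \<in> dirs \<Longrightarrow> snd p \<in> fst p"
  by (auto simp: dirs_def)

lemma form_eq: "form s \<rho> f g = (\<Sum>p\<in>dirs. L2_inner (M\<^sub>p p) (D\<^sub>p p f) (D\<^sub>p p g))"
proof -
  have "form s \<rho> f g = (\<Sum>B\<in>{B. B \<noteq> {}}. \<Sum>i\<in>B. L2_inner (\<mu>F B) (face_deriv B i f) (face_deriv B i g))"
    unfolding form_def form_face_eq by (rule refl)
  also have "\<dots> = (\<Sum>(B, i)\<in>dirs. L2_inner (\<mu>F B) (face_deriv B i f) (face_deriv B i g))"
    unfolding dirs_def by (rule sum.Sigma) auto
  finally show ?thesis by (simp add: case_prod_beta)
qed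

lemma Cck_2_Ck: "f \<in> Cck 2 \<Longrightarrow> Ck (Suc 1) f"
  using Cck_imp_Ck[of f 2] by (simp add: numeral_2_eq_2)

lemma face_deriv_add: "f \<in> Cck 2 \<Longrightarrow> g \<in> Cck 2 \<Longrightarrow> face_deriv B i (f + g) = face_deriv B i f + face_deriv B i g"
  using ext_partial_add[OF Cck_2_Ck Cck_2_Ck, of f g] subsetD[OF Eplus_orthant]
  by (auto simp: fun_eq_iff face_deriv_def indicator_def plus_fun_def)

lemma face_deriv_scale: "f \<in> Cck 2 \<Longrightarrow> face_deriv B i (c *\<^sub>R f) = c *\<^sub>R face_deriv B i f"
proof (rule ext)
  fix x assume f: "f \<in> Cck 2"
  show "face_deriv B i (c *\<^sub>R f) x = (c *\<^sub>R face_deriv B i f) x"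
  proof (cases "x \<in> Eplus B")
    case True
    then have "x \<in> orthant" using Eplus_orthant by blast
    from ext_partial_scale[OF Cck_2_Ck[OF f] this, of i c] show ?thesis
      by (simp add: face_deriv_def scaleR_fun_def)
  qed (simp add: face_deriv_def scaleR_fun_def)
qed

lemma face_deriv_diff:
  assumes "f \<in> Cck 2" "g \<in> Cck 2"
  shows "face_deriv B i (f - g) = face_deriv B i f - face_deriv B i g"
  using face_deriv_add[OF assms(1) subspace_scale[OF subspace_Cck assms(2)], of B i "-1"]
    face_deriv_scale[OF assms(2), of B i "-1"] by simp

lemma D_L2: "f \<in> Cck 2 \<Longrightarrow> D\<^sub>p p f \<in> L2 (M\<^sub>p p)"
  by (rule face_deriv_L2)

lemma semi_inner_form: "semi_inner (Cck 2) (form s \<rho>)"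
proof (rule semi_inner.intro)
  fix f g h :: "real^'n \<Rightarrow> real" and c assume f: "f \<in> Cck 2" and g: "g \<in> Cck 2"
  show "form s \<rho> f g = form s \<rho> g f"
    unfolding form_eq by (intro sum.cong refl L2.sym[OF D_L2[OF f] D_L2[OF g]])
  show "form s \<rho> (c *\<^sub>R f) g = c * form s \<rho> f g"
    unfolding form_eq face_deriv_scale[OF f] sum_distrib_left
    by (intro sum.cong refl L2.scale_left[OF D_L2[OF f] D_L2[OF g]])
  show "form s \<rho> (f + g) h = form s \<rho> f h + form s \<rho> g h" if h: "h \<in> Cck 2"
    unfolding form_eq face_deriv_add[OF f g] sum.distrib[symmetric]
    by (intro sum.cong refl L2.add_left[OF D_L2[OF f] D_L2[OF g] D_L2[OF h]])
  show "0 \<le> form s \<rho> f f"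
    unfolding form_eq by (intro sum_nonneg L2_inner_nonneg)
qed (rule subspace_Cck)

interpretation form: semi_inner "Cck 2" "form s \<rho>" by (rule semi_inner_form)

lemma face_inner_le_form:
  assumes "p \<in> dirs"
  shows "L2_inner (M\<^sub>p p) (D\<^sub>p p f) (D\<^sub>p p f) \<le> form s \<rho> f f"
  unfolding form_eq using assms by (intro member_le_sum L2_inner_nonneg finite_dirs)

lemma gradient_limit:
  assumes u: "\<And>k. u k \<in> Cck 2" and Cau: "form.Cau u"
  obtains h where "\<And>p. p \<in> dirs \<Longrightarrow> h p \<in> L2 (M\<^sub>p p)"
    "\<And>p. p \<in> dirs \<Longrightarrow> L2.conv (M\<^sub>p p) (\<lambda>k. D\<^sub>p p (u k)) (h p)"
proof -
  have "\<exists>h. h \<in> L2 (M\<^sub>p p) \<and> L2.conv (M\<^sub>p p) (\<lambda>k. D\<^sub>p p (u k)) h" if p: "p \<in> dirs" for p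
  proof -
    have "L2.Cau (M\<^sub>p p) (\<lambda>k. D\<^sub>p p (u k))"
      unfolding L2.Cau_def
    proof (intro allI impI)
      fix e :: real assume "e > 0"
      then obtain n where n: "\<forall>j\<ge>n. \<forall>k\<ge>n. form s \<rho> (u j - u k) (u j - u k) < e"
        using Cau unfolding form.Cau_def by blast
      have "L2_inner (M\<^sub>p p) (D\<^sub>p p (u j) - D\<^sub>p p (u k)) (D\<^sub>p p (u j) - D\<^sub>p p (u k)) < e" if "j \<ge> n" "k \<ge> n" for j k
        using face_inner_le_form[OF p, of "u j - u k"] n[rule_format, OF that]
        by (simp add: face_deriv_diff[OF u u])
      then show "\<exists>n. \<forall>j\<ge>n. \<forall>k\<ge>n. L2_inner (M\<^sub>p p) (D\<^sub>p p (u j) - D\<^sub>p p (u k)) (D\<^sub>p p (u j) - D\<^sub>p p (u k)) < e" by blast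
    qed
    from L2.completeD[OF L2_complete D_L2[OF u] this] show ?thesis by blast
  qed
  then show ?thesis using that by metis
qed

lemma closable_form_Cck: "closable_form (L2 \<mu>) (L2_inner \<mu>) (Cck 2) (form s \<rho>)"
proof (rule closable_form.intro[OF semi_inner_L2 semi_inner_form], rule closable_form_axioms.intro)
  show "semi_inner.is_complete (L2 \<mu>) (L2_inner \<mu>)" by (rule L2_complete)
  show "Cck 2 \<subseteq> L2 \<mu>" using Cck_L2 by blast
  show "\<exists>g\<in>Cck 2. L2.N \<mu> (f - g) < e" if "f \<in> L2 \<mu>" "e > 0" for f e by (rule Cck_dense[OF that])
  fix u assume u: "\<And>k. u k \<in> Cck 2" and Cau: "form.Cau u" and conv: "L2.conv \<mu> u 0"
  obtain h where h: "\<And>p. p \<in> dirs \<Longrightarrow> h p \<in> L2 (M\<^sub>p p)"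
    "\<And>p. p \<in> dirs \<Longrightarrow> L2.conv (M\<^sub>p p) (\<lambda>k. D\<^sub>p p (u k)) (h p)"
    by (rule gradient_limit[OF u Cau]) blast
  have h0: "L2_inner (M\<^sub>p p) (h p) (h p) = 0" if p: "p \<in> dirs" for p
  proof -
    have "AE x in M\<^sub>p p. x \<in> UNIV \<longrightarrow> h p x = 0"
      by (rule weak_derivative_zero[OF dirs_mem[OF p] u L2.zero_mem conv h(1)[OF p] h(2)[OF p] open_UNIV, of 0]) simp
    then show ?thesis by (subst L2_null_AE[OF h(1)[OF p]]) simp
  qed
  have "(\<lambda>k. \<Sum>p\<in>dirs. L2_inner (M\<^sub>p p) (D\<^sub>p p (u k)) (D\<^sub>p p (u k))) \<longlonglongrightarrow> (\<Sum>p\<in>dirs. L2_inner (M\<^sub>p p) (h p) (h p))"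
    by (intro tendsto_sum L2.conv_tendsto_b D_L2 u h)
  then show "(\<lambda>k. form s \<rho> (u k) (u k)) \<longlonglongrightarrow> 0" unfolding form_eq using h0 by simp
qed

sublocale cl: closable_form "L2 \<mu>" "L2_inner \<mu>" "Cck 2" "form s \<rho>"
  by (rule closable_form_Cck)

abbreviation "cD \<equiv> closure_dom \<mu> (Cck 2) (form s \<rho>)"
abbreviation "cQ \<equiv> closure_form \<mu> (Cck 2) (form s \<rho>)"

lemma cD_eq: "cD = cl.cdom" and cQ_eq: "cQ = cl.cform"
  by (rule closure_dom_eq[OF closable_form_Cck], rule closure_form_eq[OF closable_form_Cck])

lemma closed_L2_form_closure: "closed_L2_form \<mu> cl.cdom cl.cform"
  by (rule closed_L2_form.intro, rule cl.closure_closed_form_space)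

sublocale E: closed_L2_form \<mu> cl.cdom cl.cform
  by (rule closed_L2_form_closure)

end

subsection \<open>The Markov property\<close>

text \<open>The unit contraction is \<open>(1 + |t| - |t - 1|) / 2\<close>. It is smoothed by replacing \<open>|t|\<close> by
\<open>(t\<^sup>2 + \<delta>\<^sup>2)\<^bsup>1/2\<^esup>\<close>; a constant is subtracted so that the result vanishes at \<open>0\<close> and composition with it preserves compact
supports.\<close>

definition sabs :: "real \<Rightarrow> real \<Rightarrow> real" where "sabs \<delta> t = sqrt (t\<^sup>2 + \<delta>\<^sup>2)"

definition sclip :: "real \<Rightarrow> real \<Rightarrow> real" where
  "sclip \<delta> t = (1 + sabs \<delta> t - sabs \<delta> (t - 1)) / 2 - (1 + sabs \<delta> 0 - sabs \<delta> (0 - 1)) / 2"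

definition sclip' :: "real \<Rightarrow> real \<Rightarrow> real" where
  "sclip' \<delta> t = (t / sabs \<delta> t - (t - 1) / sabs \<delta> (t - 1)) / 2"

lemma sabs_pos: "\<delta> > 0 \<Longrightarrow> sabs \<delta> t > 0"
  by (simp add: sabs_def add_nonneg_pos)

lemma sabs_ge: "\<bar>t\<bar> \<le> sabs \<delta> t"
  unfolding sabs_def by (rule real_le_rsqrt) simp

lemma sabs_le: "\<delta> > 0 \<Longrightarrow> sabs \<delta> t \<le> \<bar>t\<bar> + \<delta>"
  unfolding sabs_def by (rule real_le_lsqrt) (auto simp: power2_sum)

lemma sabs_derivative:
  assumes "\<delta> > 0"
  shows "(sabs \<delta> has_real_derivative t / sabs \<delta> t) (at t)"
proof -
  have "t\<^sup>2 + \<delta>\<^sup>2 > 0" using assms by (simp add: add_nonneg_pos)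
  then have "((\<lambda>t. sqrt (t\<^sup>2 + \<delta>\<^sup>2)) has_real_derivative (2 * t) * (inverse (sqrt (t\<^sup>2 + \<delta>\<^sup>2)) / 2)) (at t)"
    by (auto intro!: derivative_eq_intros)
  then show ?thesis unfolding sabs_def[abs_def] by (simp add: field_simps)
qed

lemma sclip_derivative: "\<delta> > 0 \<Longrightarrow> (sclip \<delta> has_real_derivative sclip' \<delta> t) (at t)"
proof -
  assume d: "\<delta> > 0"
  have "((\<lambda>t. sabs \<delta> (t - 1)) has_real_derivative (t - 1) / sabs \<delta> (t - 1) * (1 - 0)) (at t)"
    by (rule DERIV_chain2[OF sabs_derivative[OF d]]) (intro derivative_intros)
  then have "((\<lambda>t. (1 + sabs \<delta> t - sabs \<delta> (t - 1)) / 2 - (1 + sabs \<delta> 0 - sabs \<delta> (0 - 1)) / 2) has_real_derivative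
      (0 + t / sabs \<delta> t - (t - 1) / sabs \<delta> (t - 1) * (1 - 0)) / 2 - 0) (at t)"
    by (intro DERIV_diff DERIV_cdivide DERIV_add DERIV_const sabs_derivative[OF d])
  then show ?thesis unfolding sclip_def[abs_def] sclip'_def by simp
qed

lemma smooth_sclip:
  assumes d: "\<delta> > 0"
  shows "smooth 2 (sclip \<delta>)"
proof -
  have sc: "continuous_on UNIV (sabs \<delta>)"
    unfolding sabs_def[abs_def] by (intro continuous_intros)
  have nz: "sabs \<delta> t \<noteq> 0" for t using sabs_pos[OF d, of t] by simp
  define r where "r t = (1 * sabs \<delta> t - t * (t / sabs \<delta> t)) / (sabs \<delta> t * sabs \<delta> t)" for t
  have r: "((\<lambda>t. t / sabs \<delta> t) has_real_derivative r t) (at t)" for t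
    unfolding r_def by (rule DERIV_divide[OF DERIV_ident sabs_derivative[OF d] nz])
  have r1: "((\<lambda>t. (t - 1) / sabs \<delta> (t - 1)) has_real_derivative r (t - 1) * (1 - 0)) (at t)" for t
    by (rule DERIV_chain2[OF r]) (intro derivative_intros)
  have "(sclip' \<delta> has_real_derivative (r t - r (t - 1) * (1 - 0)) / 2) (at t)" for t
    unfolding sclip'_def[abs_def] by (intro DERIV_cdivide DERIV_diff r r1)
  moreover have rc: "continuous_on UNIV r"
    unfolding r_def[abs_def] using nz by (intro continuous_intros sc) auto
  have "continuous_on UNIV (\<lambda>t. (r t - r (t - 1) * (1 - 0)) / 2)"
    by (intro continuous_intros rc continuous_on_compose2[OF rc]) auto
  ultimately have "smooth 1 (sclip' \<delta>)"
    unfolding One_nat_def smooth.simps by (intro exI[of _ "\<lambda>t. (r t - r (t - 1) * (1 - 0)) / 2"] conjI allI)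
  then show ?thesis using sclip_derivative[OF d] by (auto simp: numeral_2_eq_2)
qed

lemma sclip'_continuous: "\<delta> > 0 \<Longrightarrow> continuous_on UNIV (sclip' \<delta>)"
proof -
  assume d: "\<delta> > 0"
  have sc: "continuous_on UNIV (sabs \<delta>)"
    unfolding sabs_def[abs_def] by (intro continuous_intros)
  have nz: "sabs \<delta> t \<noteq> 0" for t using sabs_pos[OF d, of t] by simp
  show ?thesis
    unfolding sclip'_def[abs_def] using nz
    by (intro continuous_intros sc continuous_on_compose2[OF sc]) auto
qed

text \<open>Both quotients in the derivative have absolute value at most \<open>1\<close>.\<close>

lemma sclip'_bound:
  assumes d: "\<delta> > 0"
  shows "\<bar>sclip' \<delta> t\<bar> \<le> 1"
proof -
  have "\<bar>t / sabs \<delta> t\<bar> \<le> 1" for t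
    using sabs_pos[OF d, of t] sabs_ge[of t \<delta>] by (simp add: abs_divide)
  from this[of t] this[of "t - 1"] have "\<bar>t / sabs \<delta> t - (t - 1) / sabs \<delta> (t - 1)\<bar> \<le> 2"
    by linarith
  then show ?thesis unfolding sclip'_def by (simp add: abs_divide)
qed

lemma sclip_0: "sclip \<delta> 0 = 0"
  by (simp add: sclip_def)

lemma sclip_close:
  assumes d: "\<delta> > 0"
  shows "\<bar>sclip \<delta> t - min (max 0 t) 1\<bar> \<le> 2 * \<delta>"
proof -
  have e: "0 \<le> sabs \<delta> t - \<bar>t\<bar>" "sabs \<delta> t - \<bar>t\<bar> \<le> \<delta>" for t
    using sabs_ge[of t \<delta>] sabs_le[OF d, of t] by auto
  have "min (max 0 t) 1 = (1 + \<bar>t\<bar> - \<bar>t - 1\<bar>) / 2" by (simp add: min_def max_def abs_if)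
  then have "sclip \<delta> t - min (max 0 t) 1 = ((sabs \<delta> t - \<bar>t\<bar>) - (sabs \<delta> (t - 1) - \<bar>t - 1\<bar>)
      - (sabs \<delta> 0 - \<bar>0\<bar>) + (sabs \<delta> (- 1) - \<bar>- 1\<bar>)) / 2"
    unfolding sclip_def by (simp add: field_simps)
  moreover have bound: "\<bar>(p - q - r + v) / 2\<bar> \<le> 2 * \<delta>"
    if "0 \<le> p" "p \<le> \<delta>" "0 \<le> q" "q \<le> \<delta>" "0 \<le> r" "r \<le> \<delta>" "0 \<le> v" "v \<le> \<delta>" for p q r v :: real
    using that by (simp add: abs_le_iff)
  ultimately show ?thesis by (simp only:) (rule bound[OF e e e e])
qed

context face_data begin

lemma sclip_Cck:
  assumes d: "\<delta> > 0" and u: "u \<in> Cck 2"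
  shows "(\<lambda>x. sclip \<delta> (u x)) \<in> Cck 2"
proof -
  obtain R where R: "\<And>x. x \<in> orthant \<Longrightarrow> u x \<noteq> 0 \<Longrightarrow> norm x \<le> R" using u unfolding Cck_iff by blast
  have "\<forall>x\<in>orthant. sclip \<delta> (u x) \<noteq> 0 \<longrightarrow> norm x \<le> R" using R sclip_0 by metis
  then show ?thesis using Ck_compose[OF Cck_imp_Ck[OF u] smooth_sclip[OF d]] unfolding Cck_iff by blast
qed

lemma form_sclip_le:
  assumes d: "\<delta> > 0" and u: "u \<in> Cck 2"
  shows "form s \<rho> (\<lambda>x. sclip \<delta> (u x)) (\<lambda>x. sclip \<delta> (u x)) \<le> form s \<rho> u u"
  unfolding form_eq
proof (rule sum_mono)
  fix p assume "p \<in> dirs"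
  have v: "(\<lambda>x. sclip \<delta> (u x)) \<in> Cck 2" by (rule sclip_Cck[OF d u])
  have "\<bar>D\<^sub>p p (\<lambda>x. sclip \<delta> (u x)) x\<bar> \<le> \<bar>D\<^sub>p p u x\<bar>" if "x \<in> space (M\<^sub>p p)" for x
  proof -
    have "x \<in> orthant" using that by simp
    from ext_partial_compose[OF Cck_2_Ck[OF u] sclip_derivative[OF d] sclip'_continuous[OF d] this, of "snd p"]
    have "\<bar>ext_partial (snd p) (\<lambda>x. sclip \<delta> (u x)) x\<bar> = \<bar>sclip' \<delta> (u x)\<bar> * \<bar>ext_partial (snd p) u x\<bar>"
      by (simp add: abs_mult)
    also have "\<dots> \<le> 1 * \<bar>ext_partial (snd p) u x\<bar>" by (intro mult_right_mono sclip'_bound[OF d]) simp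
    finally show ?thesis by (simp add: face_deriv_def indicator_def)
  qed
  from L2_N_mono[OF D_L2[OF u] D_L2[OF v] this]
  show "L2_inner (M\<^sub>p p) (D\<^sub>p p (\<lambda>x. sclip \<delta> (u x))) (D\<^sub>p p (\<lambda>x. sclip \<delta> (u x))) \<le> L2_inner (M\<^sub>p p) (D\<^sub>p p u) (D\<^sub>p p u)"
    by (simp add: L2.N_def)
qed

text \<open>If \<open>u\<^sub>k\<close> approximates \<open>f\<close>, then the smoothed contractions of \<open>u\<^sub>k\<close>, with smoothing parameter tending to zero,
converge to the contraction of \<open>f\<close>, and their energies are bounded by those of \<open>u\<^sub>k\<close>.\<close>

lemma unit_contraction_operates:
  assumes f: "f \<in> cl.cdom"
  shows "(\<lambda>x. min (max 0 (f x)) 1) \<in> cl.cdom \<and>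
    cl.cform (\<lambda>x. min (max 0 (f x)) 1) (\<lambda>x. min (max 0 (f x)) 1) \<le> cl.cform f f"
proof -
  define \<tau> where "\<tau> t = min (max 0 t) 1" for t :: real
  have fL: "f \<in> L2 \<mu>" by (rule cl.cdom_H[OF f])
  have \<tau>m: "(\<lambda>x. \<tau> (g x)) \<in> borel_measurable M" if "g \<in> borel_measurable M" for g :: "real^'n \<Rightarrow> real" and M
    unfolding \<tau>_def using that by (intro borel_measurable_min borel_measurable_max borel_measurable_const)
  have \<tau>L: "(\<lambda>x. \<tau> (g x)) \<in> L2 \<mu>" if "g \<in> L2 \<mu>" for g
    by (rule L2_dominated[OF that \<tau>m[OF L2_measurable[OF that]]]) (auto simp: \<tau>_def)
  obtain u where u: "cl.approx u f" by (rule cl.cdomE[OF f])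
  define \<delta> where "\<delta> k = 1 / real (Suc k)" for k
  have \<delta>: "\<delta> k > 0" for k by (simp add: \<delta>_def)
  define v where "v k x = sclip (\<delta> k) (u k x)" for k x
  have vC: "v k \<in> Cck 2" for k
    unfolding v_def[abs_def] by (rule sclip_Cck[OF \<delta> cl.approx_D[OF u]])
  have conv: "L2.conv \<mu> v (\<lambda>x. \<tau> (f x))"
  proof (subst L2.conv_N)
    have le: "norm (L2.N \<mu> (v k - (\<lambda>x. \<tau> (f x)))) \<le> 2 * \<delta> k * sqrt (measure \<mu> orthant) + L2.N \<mu> (u k - f)" for k
    proof -
      let ?t = "\<lambda>x. \<tau> (u k x)"
      have L: "v k \<in> L2 \<mu>" "?t \<in> L2 \<mu>" "(\<lambda>x. \<tau> (f x)) \<in> L2 \<mu>" "u k \<in> L2 \<mu>"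
        by (rule Cck_L2[OF vC], rule \<tau>L[OF cl.approx_H[OF u]], rule \<tau>L[OF fL], rule cl.approx_H[OF u])
      have "L2.N \<mu> (v k - ?t) \<le> L2.N \<mu> (\<lambda>x. 2 * \<delta> k)"
        using sclip_close[OF \<delta>, of k] \<delta>[of k]
        by (intro L2_N_mono const_L2 L2.diff_mem L) (simp add: v_def \<tau>_def)
      moreover have "L2.N \<mu> (?t - (\<lambda>x. \<tau> (f x))) \<le> L2.N \<mu> (u k - f)"
        by (intro L2_N_mono L2.diff_mem L fL) (simp add: \<tau>_def min_def max_def)
      moreover have "L2.N \<mu> (v k - (\<lambda>x. \<tau> (f x))) \<le> L2.N \<mu> (v k - ?t) + L2.N \<mu> (?t - (\<lambda>x. \<tau> (f x)))"
        by (rule L2.N_triangle_diff[OF L(1,2,3)])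
      moreover have "0 \<le> L2.N \<mu> (v k - (\<lambda>x. \<tau> (f x)))" by (intro L2.N_nonneg L2.diff_mem L)
      ultimately show ?thesis using \<delta>[of k] by (simp add: const_N)
    qed
    have "\<delta> \<longlonglongrightarrow> 0" unfolding \<delta>_def using LIMSEQ_inverse_real_of_nat by (simp add: inverse_eq_divide)
    moreover have "(\<lambda>k. L2.N \<mu> (u k - f)) \<longlonglongrightarrow> 0"
      using L2.conv_N[of u \<mu> f] cl.approx_H[OF u] fL cl.approx_conv[OF u] by blast
    ultimately have "(\<lambda>k. 2 * \<delta> k * sqrt (measure \<mu> orthant) + L2.N \<mu> (u k - f)) \<longlonglongrightarrow> 2 * 0 * sqrt (measure \<mu> orthant) + 0"
      by (intro tendsto_intros)
    then have lim: "(\<lambda>k. 2 * \<delta> k * sqrt (measure \<mu> orthant) + L2.N \<mu> (u k - f)) \<longlonglongrightarrow> 0" by simp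
    show "(\<lambda>k. L2.N \<mu> (v k - (\<lambda>x. \<tau> (f x)))) \<longlonglongrightarrow> 0"
      by (rule Lim_null_comparison[OF always_eventually lim]) (intro allI le)
  qed (use Cck_L2[OF vC] \<tau>L[OF fL] in auto)
  have "(\<lambda>x. \<tau> (f x)) \<in> cl.cdom \<and> cl.cform (\<lambda>x. \<tau> (f x)) (\<lambda>x. \<tau> (f x)) \<le> cl.cform f f"
  proof (rule E.lower_semicontinuity[OF cl.D_cdom[OF vC] \<tau>L[OF fL] conv])
    show "cl.cform (v k) (v k) \<le> form s \<rho> (u k) (u k)" for k
      unfolding cl.cform_D[OF vC vC] unfolding v_def[abs_def] by (rule form_sclip_le[OF \<delta> cl.approx_D[OF u]])
    show "(\<lambda>k. form s \<rho> (u k) (u k)) \<longlonglongrightarrow> cl.cform f f" by (rule cl.cform_lim[OF fL u fL u])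
  qed
  then show ?thesis by (simp add: \<tau>_def)
qed

subsection \<open>Constants\<close>

text \<open>The constant \<open>1\<close> is the limit of cut-off functions on growing balls, whose gradients tend
  to zero uniformly.\<close>

lemma one_in_closure: "(\<lambda>x. 1) \<in> cl.cdom \<and> cl.cform (\<lambda>x. 1) (\<lambda>x. 1) = 0"
proof -
  define a where "a k = 1 / (real (Suc k))\<^sup>2" for k
  have a: "a k > 0" for k by (simp add: a_def)
  define q where "q k x = 1 - a k * (x \<bullet> x)" for k and x :: "real^'n"
  define u where "u k x = pos3 (q k x)" for k x
  have uC: "u k \<in> Cck 2" for k
    using cutoff_Cck[OF a[of k] Ck_const[of 2 1], of 1] by (simp add: u_def[abs_def] q_def)
  have qC: "Ck (Suc 1) (q k)" for k
  proof -
    have "Ck 2 (\<lambda>x. 1 + (- a k) * (x \<bullet> x))" by (intro Ck_add Ck_scale Ck_const Ck_norm_square)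
    then show ?thesis by (simp add: q_def[abs_def] numeral_2_eq_2)
  qed
  have dq: "ext_partial i (q k) x = - 2 * a k * x $ i" if "x \<in> orthant" for i k x
  proof (rule ext_partial_eqI[where d="\<lambda>i x. - 2 * a k * x $ i" and h="\<lambda>x. - 2 * a k * x $ i", OF _ _ refl that])
    show "continuous_on orthant (\<lambda>x. - 2 * a k * x $ i)" by (intro continuous_intros)
    show "(q k has_derivative (\<lambda>v. \<Sum>i\<in>UNIV. - 2 * a k * x $ i * v $ i)) (at x)" for x
    proof -
      have "(q k has_derivative (\<lambda>v. 0 - a k * (x \<bullet> v + v \<bullet> x))) (at x)"
        unfolding q_def[abs_def] by (intro derivative_intros)
      moreover have "0 - a k * (x \<bullet> v + v \<bullet> x) = (\<Sum>i\<in>UNIV. - 2 * a k * x $ i * v $ i)" for v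
        by (simp add: inner_commute[of v x]) (simp add: inner_vec_def sum_distrib_left sum_negf mult_ac)
      ultimately show ?thesis by simp
    qed
  qed
  have grad: "\<bar>ext_partial i (u k) x\<bar> \<le> 6 / real (Suc k)" if x: "x \<in> orthant" for i k x
  proof -
    have eq: "ext_partial i (u k) x = pos3' (q k x) * (- 2 * a k * x $ i)"
      unfolding u_def[abs_def] using ext_partial_compose[OF qC pos3_derivative pos3'_continuous x] dq[OF x] by simp
    show ?thesis
    proof (cases "q k x \<le> 0")
      case True
      then show ?thesis unfolding eq by (simp add: pos3'_def)
    next
      case False
      have "q k x \<le> 1" using a[of k] by (simp add: q_def)
      then have "\<bar>pos3' (q k x)\<bar> \<le> 3"
        using False mult_mono[of "q k x" 1 "q k x" 1] by (simp add: pos3'_def)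
      moreover have "\<bar>x $ i\<bar> \<le> real (Suc k)"
      proof -
        have "(norm x)\<^sup>2 \<le> (real (Suc k))\<^sup>2"
          using False by (simp add: q_def a_def power2_norm_eq_inner divide_less_eq split: if_splits)
        then have "norm x \<le> real (Suc k)" by (rule power2_le_imp_le) simp
        then show ?thesis using component_le_norm_cart[of x i] by linarith
      qed
      ultimately have "\<bar>pos3' (q k x)\<bar> * (2 * a k * \<bar>x $ i\<bar>) \<le> 3 * (2 * a k * real (Suc k))"
        using a[of k] by (intro mult_mono) auto
      also have "\<dots> = 6 / real (Suc k)" using of_nat_neq_0[of k, where ?'a=real] by (simp only: a_def power2_eq_square) (simp add: field_simps del: of_nat_Suc)
      finally show ?thesis unfolding eq using a[of k] by (simp add: abs_mult)
    qed
  qed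
  have inv: "(\<lambda>k. 6 / real (Suc k)) \<longlonglongrightarrow> 0"
    using tendsto_mult_right_zero[OF LIMSEQ_inverse_real_of_nat, of 6] by (simp add: inverse_eq_divide)
  have null: "(\<lambda>k. form s \<rho> (u k) (u k)) \<longlonglongrightarrow> 0"
  proof (rule tendsto_sandwich[OF _ _ tendsto_const])
    have le: "form s \<rho> (u k) (u k) \<le> (\<Sum>p\<in>dirs. (6 / real (Suc k))\<^sup>2 * measure (M\<^sub>p p) orthant)" for k
      unfolding form_eq
    proof (rule sum_mono)
      fix p assume "p \<in> dirs"
      have "L2.N (M\<^sub>p p) (D\<^sub>p p (u k)) \<le> L2.N (M\<^sub>p p) (\<lambda>x. 6 / real (Suc k))"
      proof (rule L2_N_mono[OF const_L2(2) D_L2[OF uC]])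
        show "\<bar>D\<^sub>p p (u k) x\<bar> \<le> \<bar>6 / real (Suc k)\<bar>" if "x \<in> space (M\<^sub>p p)" for x
          using grad[of x "snd p" k] that by (simp add: face_deriv_def indicator_def)
      qed
      then have "L2_inner (M\<^sub>p p) (D\<^sub>p p (u k)) (D\<^sub>p p (u k)) \<le> L2_inner (M\<^sub>p p) (\<lambda>x. 6 / real (Suc k)) (\<lambda>x. 6 / real (Suc k))"
        by (simp add: L2.N_def)
      then show "L2_inner (M\<^sub>p p) (D\<^sub>p p (u k)) (D\<^sub>p p (u k)) \<le> (6 / real (Suc k))\<^sup>2 * measure (M\<^sub>p p) orthant"
        by (simp add: L2_inner_def power2_eq_square mult.commute)
    qed
    show "\<forall>\<^sub>F k in sequentially. form s \<rho> (u k) (u k) \<le> (\<Sum>p\<in>dirs. (6 / real (Suc k))\<^sup>2 * measure (M\<^sub>p p) orthant)"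
      by (intro always_eventually allI le)
    have "(\<lambda>k. \<Sum>p\<in>dirs. (6 / real (Suc k))\<^sup>2 * measure (M\<^sub>p p) orthant) \<longlonglongrightarrow> (\<Sum>p\<in>dirs. 0\<^sup>2 * measure (M\<^sub>p p) orthant)"
      by (intro tendsto_sum tendsto_mult tendsto_power inv tendsto_const)
    then show "(\<lambda>k. \<Sum>p\<in>dirs. (6 / real (Suc k))\<^sup>2 * measure (M\<^sub>p p) orthant) \<longlonglongrightarrow> 0" by simp
    show "\<forall>\<^sub>F k in sequentially. 0 \<le> form s \<rho> (u k) (u k)" by (intro always_eventually allI cl.Q.nonneg uC)
  qed
  have conv: "L2.conv \<mu> u (\<lambda>x. 1)"
    unfolding L2.conv_def L2_inner_def
  proof -
    have dL: "u k - (\<lambda>x. 1) \<in> L2 \<mu>" for k by (intro L2.diff_mem Cck_L2[OF uC] const_L2)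
    have "(\<lambda>k. \<integral>x. (u k - (\<lambda>x. 1)) x * (u k - (\<lambda>x. 1)) x \<partial>\<mu>) \<longlonglongrightarrow> (\<integral>x. 0 \<partial>\<mu>)"
    proof (rule integral_dominated_convergence)
      show "integrable \<mu> (\<lambda>x. 1::real)" using L2_square_integrable[OF const_L2(1)[of 1]] by simp
      show "(\<lambda>x. (u k - (\<lambda>x. 1)) x * (u k - (\<lambda>x. 1)) x) \<in> borel_measurable \<mu>" for k
        by (rule borel_measurable_integrable[OF L2_product_integrable[OF dL dL]])
      have "(\<lambda>k. u k x) \<longlonglongrightarrow> 1" for x
      proof -
        have "(\<lambda>k. 1 / real (Suc k)) \<longlonglongrightarrow> 0" using LIMSEQ_inverse_real_of_nat by (simp add: inverse_eq_divide)
        from tendsto_power[OF this, of 2] have "a \<longlonglongrightarrow> 0" by (simp add: a_def[abs_def] power_divide)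
        then have "(\<lambda>k. q k x) \<longlonglongrightarrow> 1 - 0 * (x \<bullet> x)" unfolding q_def by (intro tendsto_intros)
        moreover have "isCont pos3 1" using pos3_derivative by (rule DERIV_isCont)
        ultimately have "(\<lambda>k. pos3 (q k x)) \<longlonglongrightarrow> pos3 1" by (intro isCont_tendsto_compose[of 1 pos3]) auto
        then show ?thesis by (simp add: u_def pos3_def)
      qed
      then have "(\<lambda>k. (u k x - 1) * (u k x - 1)) \<longlonglongrightarrow> (1 - 1) * (1 - 1)" for x
        by (intro tendsto_mult tendsto_diff tendsto_const)
      then show "AE x in \<mu>. (\<lambda>k. (u k - (\<lambda>x. 1)) x * (u k - (\<lambda>x. 1)) x) \<longlonglongrightarrow> 0" by simp
      show "AE x in \<mu>. norm ((u k - (\<lambda>x. 1)) x * (u k - (\<lambda>x. 1)) x) \<le> 1" for k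
      proof (rule AE_I2)
        fix x
        have "q k x \<le> 1" using a[of k] by (simp add: q_def)
        then have "u k x \<le> pos3 1" unfolding u_def by (rule pos3_mono)
        then have "0 \<le> u k x" "u k x \<le> 1" by (simp_all add: u_def pos3_nonneg) (simp add: pos3_def)
        then have "\<bar>u k x - 1\<bar> \<le> 1" by simp
        then have "\<bar>u k x - 1\<bar> * \<bar>u k x - 1\<bar> \<le> 1 * 1" by (intro mult_mono) auto
        then show "norm ((u k - (\<lambda>x. 1)) x * (u k - (\<lambda>x. 1)) x) \<le> 1" by (simp add: abs_mult)
      qed
    qed simp
    then show "(\<lambda>k. \<integral>x. (u k - (\<lambda>x. 1)) x * (u k - (\<lambda>x. 1)) x \<partial>\<mu>) \<longlonglongrightarrow> 0" by simp
  qed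
  show ?thesis by (rule cl.approx_of_form_null[OF uC const_L2(1) conv null])
qed

subsection \<open>Strong locality and regularity\<close>

text \<open>The complement of the support is a union of open sets on each of which \<open>f\<close> vanishes almost everywhere; countably
many of them have the same union.\<close>

lemma AE_zero_outside_support:
  obtains W where "open W" "AE x in \<mu>. x \<in> W \<longrightarrow> f x = 0" "orthant - ae_support \<mu> f \<subseteq> W"
proof -
  define F where "F = {U. open U \<and> (AE y in \<mu>. y \<in> U \<longrightarrow> f y = 0)}"
  have "\<And>U. U \<in> F \<Longrightarrow> open U" by (simp add: F_def)
  from Lindelof[OF this] obtain F' where F': "F' \<subseteq> F" "countable F'" "\<Union>F' = \<Union>F" by blast
  have "AE x in \<mu>. \<forall>U\<in>F'. x \<in> U \<longrightarrow> f x = 0"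
    using F'(1) by (subst AE_ball_countable[OF F'(2)]) (auto simp: F_def)
  then have "AE x in \<mu>. x \<in> \<Union>F \<longrightarrow> f x = 0" unfolding F'(3)[symmetric] by eventually_elim auto
  moreover have "open (\<Union>F)" by (auto simp: F_def)
  moreover have "orthant - ae_support \<mu> f \<subseteq> \<Union>F" by (auto simp: ae_support_def F_def)
  ultimately show ?thesis using that by blast
qed

lemma strongly_local_closure: "strongly_local \<mu> cl.cdom cl.cform"
  unfolding strongly_local_def
proof (intro ballI impI, elim conjE exE)
  fix f g U c assume f: "f \<in> cl.cdom" and g: "g \<in> cl.cdom"
    and U: "open U" "ae_support \<mu> f \<subseteq> U" "AE x in \<mu>. x \<in> U \<longrightarrow> g x = c"
  obtain u where u: "cl.approx u f" by (rule cl.cdomE[OF f])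
  obtain v where v: "cl.approx v g" by (rule cl.cdomE[OF g])
  note fL = cl.cdom_H[OF f] and gL = cl.cdom_H[OF g]
  obtain W where W: "open W" "AE x in \<mu>. x \<in> W \<longrightarrow> f x = 0" "orthant - ae_support \<mu> f \<subseteq> W"
    by (rule AE_zero_outside_support[where f=f]) blast
  obtain h where h: "\<And>p. p \<in> dirs \<Longrightarrow> h p \<in> L2 (M\<^sub>p p)"
    "\<And>p. p \<in> dirs \<Longrightarrow> L2.conv (M\<^sub>p p) (\<lambda>k. D\<^sub>p p (u k)) (h p)"
    by (rule gradient_limit[OF cl.approx_D[OF u] cl.approx_Cau[OF u]]) blast
  obtain h' where h': "\<And>p. p \<in> dirs \<Longrightarrow> h' p \<in> L2 (M\<^sub>p p)"
    "\<And>p. p \<in> dirs \<Longrightarrow> L2.conv (M\<^sub>p p) (\<lambda>k. D\<^sub>p p (v k)) (h' p)"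
    by (rule gradient_limit[OF cl.approx_D[OF v] cl.approx_Cau[OF v]]) blast
  have zero: "L2_inner (M\<^sub>p p) (h p) (h' p) = 0" if p: "p \<in> dirs" for p
  proof -
    have 1: "AE x in M\<^sub>p p. x \<in> W \<longrightarrow> h p x = 0"
      by (rule weak_derivative_zero[OF dirs_mem[OF p] cl.approx_D[OF u] fL cl.approx_conv[OF u] h(1)[OF p] h(2)[OF p] W(1,2)])
    have 2: "AE x in M\<^sub>p p. x \<in> U \<longrightarrow> h' p x = 0"
      by (rule weak_derivative_zero[OF dirs_mem[OF p] cl.approx_D[OF v] gL cl.approx_conv[OF v] h'(1)[OF p] h'(2)[OF p] U(1,3)])
    have "AE x in M\<^sub>p p. h p x * h' p x = 0"
      using 1 2 AE_space[of "M\<^sub>p p"] by eventually_elim (use W(3) U(2) in auto)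
    then show ?thesis unfolding L2_inner_def by (rule integral_eq_zero_AE)
  qed
  have "(\<lambda>k. \<Sum>p\<in>dirs. L2_inner (M\<^sub>p p) (D\<^sub>p p (u k)) (D\<^sub>p p (v k))) \<longlonglongrightarrow> (\<Sum>p\<in>dirs. L2_inner (M\<^sub>p p) (h p) (h' p))"
    by (intro tendsto_sum L2.conv_tendsto_b D_L2 cl.approx_D[OF u] cl.approx_D[OF v] h h')
  then have "(\<lambda>k. form s \<rho> (u k) (v k)) \<longlonglongrightarrow> 0" unfolding form_eq using zero by simp
  then show "cl.cform f g = 0" using LIMSEQ_unique[OF cl.cform_lim[OF fL u gL v]] by blast
qed

text \<open>The test functions form a core: they are dense in the domain by construction of the closure, and uniformly dense in the
continuous functions of compact support.\<close>

lemma regular_closure: "regular_form \<mu> cl.cdom cl.cform"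
  unfolding regular_form_def
proof (intro conjI ballI allI impI)
  fix f and e :: real assume f: "f \<in> cl.cdom" and e: "e > 0"
  then have "e/2 > 0" by simp
  obtain g where g: "g \<in> Cck 2" "L2.N \<mu> (f - g) < e/2" "cl.C.N (f - g) < e/2"
    by (rule cl.cdom_approximable[OF f \<open>e/2 > 0\<close>]) blast
  have d: "f - g \<in> cl.cdom" by (rule cl.C.diff_mem[OF f cl.D_cdom[OF g(1)]])
  have "form1 \<mu> cl.cform (f - g) (f - g) = (cl.C.N (f - g))\<^sup>2 + (L2.N \<mu> (f - g))\<^sup>2"
    using d by (simp add: form1_def cl.C.N_sq L2.N_sq)
  also have "\<dots> \<le> (e/2)\<^sup>2 + (e/2)\<^sup>2"
    using g d by (intro add_mono power_mono L2.N_nonneg cl.C.N_nonneg) auto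
  also have "\<dots> < e\<^sup>2" using e by (simp add: power_divide)
  finally have "sqrt (form1 \<mu> cl.cform (f - g) (f - g)) < e"
    using e by (intro real_less_lsqrt) (auto simp: form1_def cl.C.nonneg[OF d] L2_inner_nonneg)
  then show "\<exists>g\<in>cl.cdom \<inter> Cc (space \<mu>). sqrt (form1 \<mu> cl.cform (\<lambda>x. f x - g x) (\<lambda>x. f x - g x)) < e"
    using cl.D_cdom[OF g(1)] Cck_imp_Cc[OF g(1)] by (intro bexI[of _ g]) (auto simp: fun_diff_def)
next
  fix f and e :: real assume f: "f \<in> Cc (space \<mu>)" and e: "e > 0"
  obtain g where "g \<in> Cck 2" "\<And>x. x \<in> orthant \<Longrightarrow> \<bar>f x - g x\<bar> < e"
    by (rule Cck_uniformly_dense[OF _ e]) (use f in auto)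
  then show "\<exists>g\<in>cl.cdom \<inter> Cc (space \<mu>). \<forall>x\<in>space \<mu>. \<bar>f x - g x\<bar> < e"
    using cl.D_cdom Cck_imp_Cc by (intro bexI[of _ g]) auto
qed

lemma symmetric_bilinear_Cck: "symmetric_bilinear_form \<mu> (Cck 2) (form s \<rho>)"
  unfolding symmetric_bilinear_form_def
proof (intro conjI allI ballI impI)
  show "Cck 2 \<subseteq> L2 \<mu>" by (rule cl.D_sub)
  show "(\<lambda>x::real^'n. 0) \<in> Cck 2" using cl.Q.zero_mem unfolding zero_fun_def .
  fix f g :: "real^'n \<Rightarrow> real" and c assume f: "f \<in> Cck 2" and g: "g \<in> Cck 2"
  show "(\<lambda>x. f x + g x) \<in> Cck 2" using cl.Q.add_mem[OF f g] by (simp add: plus_fun_def)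
  show "(\<lambda>x. c * f x) \<in> Cck 2" using cl.Q.scale_mem[OF f, of c] by (simp add: scaleR_fun_def)
  show "form s \<rho> f g = form s \<rho> g f" by (rule cl.Q.sym[OF f g])
  show "form s \<rho> (\<lambda>x. c * f x) g = c * form s \<rho> f g" using cl.Q.scale_left[OF f g, of c] by (simp add: scaleR_fun_def)
  show "form s \<rho> (\<lambda>x. f x + g x) h = form s \<rho> f h + form s \<rho> g h" if "h \<in> Cck 2" for h
    using cl.Q.add_left[OF f g that] by (simp add: plus_fun_def)
  show "form s \<rho> f h = form s \<rho> g h" if h: "h \<in> Cck 2" and ae: "AE x in \<mu>. f x = g x" for h
    using E.symmetric_bilinear cl.D_cdom[OF f] cl.D_cdom[OF g] cl.D_cdom[OF h] ae
    unfolding symmetric_bilinear_form_def cl.cform_D[OF f h, symmetric] cl.cform_D[OF g h, symmetric] by blast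
qed

lemma closable_Cck: "closable \<mu> (Cck 2) (form s \<rho>)"
  unfolding closable_def form_Cauchy_iff[OF semi_inner_form] L2_tendsto_iff
  using cl.closable by (simp add: zero_fun_def)

end

theorem theorem2p13:
  fixes s :: real and \<rho> :: "real^'n \<Rightarrow> real"
  assumes "0 < s"
    and "AE x in m_s s. 0 < \<rho> x"
    and "integrable (m_s s) \<rho>"
    and "\<And>B. B \<noteq> {} \<Longrightarrow>
           AE x in lam_s s B. x \<in> closure (Eplus B) - R_set s \<rho> B \<longrightarrow> \<rho> x = 0"
  shows "symmetric_bilinear_form (mu s \<rho>) (Cck 2) (form s \<rho>)
       \<and> positive_definite (Cck 2) (form s \<rho>)
       \<and> densely_defined (mu s \<rho>) (Cck 2)
       \<and> closable (mu s \<rho>) (Cck 2) (form s \<rho>)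
       \<and> symmetric_Dirichlet_form (mu s \<rho>)
           (closure_dom (mu s \<rho>) (Cck 2) (form s \<rho>))
           (closure_form (mu s \<rho>) (Cck 2) (form s \<rho>))
       \<and> conservative (mu s \<rho>)
           (closure_dom (mu s \<rho>) (Cck 2) (form s \<rho>))
           (closure_form (mu s \<rho>) (Cck 2) (form s \<rho>))
       \<and> strongly_local (mu s \<rho>)
           (closure_dom (mu s \<rho>) (Cck 2) (form s \<rho>))
           (closure_form (mu s \<rho>) (Cck 2) (form s \<rho>))
       \<and> regular_form (mu s \<rho>)
           (closure_dom (mu s \<rho>) (Cck 2) (form s \<rho>))
           (closure_form (mu s \<rho>) (Cck 2) (form s \<rho>))"
proof -
  interpret face_data s \<rho> by (rule face_data.intro[OF assms])
  show ?thesis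
    unfolding cD_eq cQ_eq
  proof (intro conjI)
    show "symmetric_bilinear_form \<mu> (Cck 2) (form s \<rho>)" by (rule symmetric_bilinear_Cck)
    show "positive_definite (Cck 2) (form s \<rho>)"
      unfolding positive_definite_def using semi_inner.nonneg[OF semi_inner_form] by blast
    show "densely_defined \<mu> (Cck 2)"
      unfolding densely_defined_def L2_norm_eq using Cck_dense by (simp add: fun_diff_def)
    show "closable \<mu> (Cck 2) (form s \<rho>)" by (rule closable_Cck)
    show "symmetric_Dirichlet_form \<mu> cl.cdom cl.cform"
      by (rule E.Dirichlet_formI[OF unit_contraction_operates])
    show "conservative \<mu> cl.cdom cl.cform"
      using one_in_closure by (intro E.conservativeI) auto
    show "strongly_local \<mu> cl.cdom cl.cform" by (rule strongly_local_closure)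
    show "regular_form \<mu> cl.cdom cl.cform" by (rule regular_closure)
  qed
qed

end
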